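(* Let $0\le m'\le m\le n$ and let $C\subseteq\Delta_n^{m',m}$ be a weakly separated collection of maximum cardinality among weakly separated collections contained in $\Delta_n^{m',m}$. Then $\mathcal{IS}_n^{m',m}$ can be obtained from $C$ by a finite sequence of lowering 3-flips followed by a finite sequence of lowering 4-flips in level $m'$. Consequently, the set $\mathcal B_n^{m',m}$ coincides with the set of maximum-cardinality weakly separated collections in $\Delta_n^{m',m}$.
   Context: Notation: $[n]=\{1,\dots,n\}$, $[p..q]=\{p,\dots,q\}$; $Xi=X\cup\{i\}$, $Xij=X\cup\{i,j\}$ etc. $\Delta_n^{m',m}=\{S\subseteq[n]:m'\le|S|\le m\}$. $\mathcal I_n^h$ is the set of $h$-element intervals $[p..q]$ of $[n]$ ($\mathcal I_n^0=\{\emptyset\}$); $\mathcal S_n^{h}$ is the set of $h$-element sets $[1..p]\cup[q..r]$ with $p\ge1$, $q\le r$, $q>p+1$. $\mathcal{IS}_n^{m',m}=\mathcal S_n^{m'}\cup\mathcal I_n^{m'}\cup\mathcal I_n^{m'+1}\cup\dots\cup\mathcal I_n^m$. TP-functions on $\Delta_n^{m',m}$: functions $f:\Delta_n^{m',m}\to\mathbb R$ satisfying $f(Xik)+f(Xj)=\max\{f(Xij)+f(Xk),f(Xi)+f(Xjk)\}$ for all $i<j<k$, $X\subseteq[n]\setminus\{i,j,k\}$ for which all six arguments lie in $\Delta_n^{m',m}$, and $f(Xik)+f(Xj\ell)=\max\{f(Xij)+f(Xk\ell),f(Xi\ell)+f(Xjk)\}$ for all $i<j<k<\ell$, $X\subseteq[n]\setminus\{i,j,k,\ell\}$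 for which all six arguments lie in $\Delta_n^{m',m}$. A TP-basis is a $B\subseteq\Delta_n^{m',m}$ for which restriction from TP-functions to $\mathbb R^B$ is bijective; $\mathcal{IS}_n^{m',m}$ is one. Flips on collections in $\Delta_n^{m',m}$: a 3-flip applies when the collection contains $Xi,Xk,Xij,Xjk$ ($i<j<k$, all sets in $\Delta_n^{m',m}$) and exactly one $Y\in\{Xj,Xik\}$, replacing $Y$ by the other member; it is lowering if $Y=Xik$. A 4-flip applies when the collection contains $Xij,Xk\ell,Xi\ell,Xjk$ ($i<j<k<\ell$, all in $\Delta_n^{m',m}$) and exactly one $Y\in\{Xik,Xj\ell\}$, replacing $Y$ by the other; it is lowering if $Y=Xj\ell$, and it is in level $m'$ if $|X|=m'-2$. $\mathcal B_n^{m',m}$ is the set of TP-bases obtained from $\mathcal{IS}_n^{m',m}$ by finite sequences of 3-flips and 4-flips (each of which yields again a TP-basis). Weak separation. $X\prec Y$ means $Y\setminus X\ne\emptyset$ and $i<j$ for all $i\in X\setminus Y$, $j\in Y\setminus X$. $X\rhd Y$ means $Y\setminus X$ has a bipartition $\{Y_1,Y_2\}$ with $Y_1,Y_2,X\setminus Y$ nonempty and $Y_1\prec X\setminus Y\prec Y_2$. $X,Y$ are weakly separated if $X\prec Y$, or $Y\prec X$, or ($X\rhd Y$ and $|X|\ge|Y|$), or ($Y\rhd X$ and $|Y|\ge|X|$). A collection is weakly separated if any two members are. *)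

theory Defs
  imports Complex_Main "HOL-Library.FuncSet"
begin

definition Delta :: "nat \<Rightarrow> nat \<Rightarrow> nat \<Rightarrow> nat set set" where
  "Delta n m' m = {S. S \<subseteq> {1..n} \<and> m' \<le> card S \<and> card S \<le> m}"

text \<open>Empty ranges \<open>{p..q}\<close> with \<open>q < p\<close> are allowed, so \<open>intervals n 0 = {{}}\<close>;
  for positive \<open>h\<close> the cardinality forces \<open>p \<le> q\<close>.\<close>

definition intervals :: "nat \<Rightarrow> nat \<Rightarrow> nat set set" where
  "intervals n h = {S. card S = h \<and> (\<exists>p q. 1 \<le> p \<and> q \<le> n \<and> S = {p..q})}"

definition sesqui_intervals :: "nat \<Rightarrow> nat \<Rightarrow> nat set set" where
  "sesqui_intervals n h =
     {S. card S = h \<and> (\<exists>p q r. 1 \<le> p \<and> p + 1 < q \<and> q \<le> r \<and> r \<le> n \<and> S = {1..p} \<union> {q..r})}"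

definition IS :: "nat \<Rightarrow> nat \<Rightarrow> nat \<Rightarrow> nat set set" where
  "IS n m' m = sesqui_intervals n m' \<union> (\<Union>h\<in>{m'..m}. intervals n h)"

text \<open>Functions on \<open>Delta n m' m\<close> and on a subset \<open>B\<close> are represented by extensional
  functions, so that equality of functions is equality on the domain.\<close>

definition TP_functions :: "nat \<Rightarrow> nat \<Rightarrow> nat \<Rightarrow> (nat set \<Rightarrow> real) set" where
  "TP_functions n m' m = {f \<in> extensional (Delta n m' m).
     (\<forall>X i j k. i < j \<and> j < k \<and> X \<subseteq> {1..n} - {i, j, k} \<and>
        {X \<union> {i}, X \<union> {j}, X \<union> {k}, X \<union> {i, j}, X \<union> {i, k}, X \<union> {j, k}} \<subseteq> Delta n m' m \<longrightarrow>
        f (X \<union> {i, k}) + f (X \<union> {j}) =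
          max (f (X \<union> {i, j}) + f (X \<union> {k})) (f (X \<union> {i}) + f (X \<union> {j, k}))) \<and>
     (\<forall>X i j k l. i < j \<and> j < k \<and> k < l \<and> X \<subseteq> {1..n} - {i, j, k, l} \<and>
        {X \<union> {i, j}, X \<union> {i, k}, X \<union> {i, l}, X \<union> {j, k}, X \<union> {j, l}, X \<union> {k, l}}
          \<subseteq> Delta n m' m \<longrightarrow>
        f (X \<union> {i, k}) + f (X \<union> {j, l}) =
          max (f (X \<union> {i, j}) + f (X \<union> {k, l})) (f (X \<union> {i, l}) + f (X \<union> {j, k})))}"

definition TP_basis :: "nat \<Rightarrow> nat \<Rightarrow> nat \<Rightarrow> nat set set \<Rightarrow> bool" where
  "TP_basis n m' m B \<longleftrightarrow> B \<subseteq> Delta n m' m \<and>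
     bij_betw (\<lambda>f. restrict f B) (TP_functions n m' m) (extensional B)"

definition exchange :: "nat set \<Rightarrow> nat set \<Rightarrow> nat set set \<Rightarrow> nat set set \<Rightarrow> bool" where
  "exchange Y Z C C' \<longleftrightarrow> Y \<in> C \<and> Z \<notin> C \<and> C' = insert Z (C - {Y})"

definition flip3_applicable ::
    "nat \<Rightarrow> nat \<Rightarrow> nat \<Rightarrow> nat set \<Rightarrow> nat \<Rightarrow> nat \<Rightarrow> nat \<Rightarrow> nat set set \<Rightarrow> bool" where
  "flip3_applicable n m' m X i j k C \<longleftrightarrow> i < j \<and> j < k \<and> X \<subseteq> {1..n} - {i, j, k} \<and>
     {X \<union> {i}, X \<union> {j}, X \<union> {k}, X \<union> {i, j}, X \<union> {i, k}, X \<union> {j, k}} \<subseteq> Delta n m' m \<and>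
     {X \<union> {i}, X \<union> {k}, X \<union> {i, j}, X \<union> {j, k}} \<subseteq> C"

definition flip4_applicable ::
    "nat \<Rightarrow> nat \<Rightarrow> nat \<Rightarrow> nat set \<Rightarrow> nat \<Rightarrow> nat \<Rightarrow> nat \<Rightarrow> nat \<Rightarrow> nat set set \<Rightarrow> bool" where
  "flip4_applicable n m' m X i j k l C \<longleftrightarrow>
     i < j \<and> j < k \<and> k < l \<and> X \<subseteq> {1..n} - {i, j, k, l} \<and>
     {X \<union> {i, j}, X \<union> {i, k}, X \<union> {i, l}, X \<union> {j, k}, X \<union> {j, l}, X \<union> {k, l}}
       \<subseteq> Delta n m' m \<and>
     {X \<union> {i, j}, X \<union> {k, l}, X \<union> {i, l}, X \<union> {j, k}} \<subseteq> C"

definition flip3 :: "nat \<Rightarrow> nat \<Rightarrow> nat \<Rightarrow> nat set set \<Rightarrow> nat set set \<Rightarrow> bool" where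
  "flip3 n m' m C C' \<longleftrightarrow> (\<exists>X i j k. flip3_applicable n m' m X i j k C \<and>
     (exchange (X \<union> {j}) (X \<union> {i, k}) C C' \<or> exchange (X \<union> {i, k}) (X \<union> {j}) C C'))"

definition lowering_flip3 :: "nat \<Rightarrow> nat \<Rightarrow> nat \<Rightarrow> nat set set \<Rightarrow> nat set set \<Rightarrow> bool" where
  "lowering_flip3 n m' m C C' \<longleftrightarrow> (\<exists>X i j k. flip3_applicable n m' m X i j k C \<and>
     exchange (X \<union> {i, k}) (X \<union> {j}) C C')"

definition flip4 :: "nat \<Rightarrow> nat \<Rightarrow> nat \<Rightarrow> nat set set \<Rightarrow> nat set set \<Rightarrow> bool" where
  "flip4 n m' m C C' \<longleftrightarrow> (\<exists>X i j k l. flip4_applicable n m' m X i j k l C \<and>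
     (exchange (X \<union> {i, k}) (X \<union> {j, l}) C C' \<or> exchange (X \<union> {j, l}) (X \<union> {i, k}) C C'))"

text \<open>Level \<open>h\<close> is \<open>card X = h - 2\<close> over the integers, hence \<open>card X + 2 = h\<close> in \<open>nat\<close>.\<close>

definition lowering_flip4_in_level ::
    "nat \<Rightarrow> nat \<Rightarrow> nat \<Rightarrow> nat \<Rightarrow> nat set set \<Rightarrow> nat set set \<Rightarrow> bool" where
  "lowering_flip4_in_level h n m' m C C' \<longleftrightarrow>
     (\<exists>X i j k l. flip4_applicable n m' m X i j k l C \<and> card X + 2 = h \<and>
        exchange (X \<union> {j, l}) (X \<union> {i, k}) C C')"

definition flip_TP_bases :: "nat \<Rightarrow> nat \<Rightarrow> nat \<Rightarrow> nat set set set" where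
  "flip_TP_bases n m' m =
     {B. TP_basis n m' m B \<and> (\<lambda>C C'. flip3 n m' m C C' \<or> flip4 n m' m C C')\<^sup>*\<^sup>* (IS n m' m) B}"

definition prec :: "nat set \<Rightarrow> nat set \<Rightarrow> bool" where
  "prec X Y \<longleftrightarrow> Y - X \<noteq> {} \<and> (\<forall>i\<in>X - Y. \<forall>j\<in>Y - X. i < j)"

definition splits :: "nat set \<Rightarrow> nat set \<Rightarrow> bool" where
  "splits X Y \<longleftrightarrow> (\<exists>Y1 Y2. Y1 \<union> Y2 = Y - X \<and> Y1 \<inter> Y2 = {} \<and>
     Y1 \<noteq> {} \<and> Y2 \<noteq> {} \<and> X - Y \<noteq> {} \<and> prec Y1 (X - Y) \<and> prec (X - Y) Y2)"

definition weakly_separated :: "nat set \<Rightarrow> nat set \<Rightarrow> bool" where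
  "weakly_separated X Y \<longleftrightarrow> prec X Y \<or> prec Y X \<or>
     (splits X Y \<and> card X \<ge> card Y) \<or> (splits Y X \<and> card Y \<ge> card X)"

text \<open>No set is weakly separated from itself, so only distinct members are compared.\<close>

definition ws_collection :: "nat set set \<Rightarrow> bool" where
  "ws_collection C \<longleftrightarrow> (\<forall>X\<in>C. \<forall>Y\<in>C. X \<noteq> Y \<longrightarrow> weakly_separated X Y)"

definition maximum_ws_collection :: "nat \<Rightarrow> nat \<Rightarrow> nat \<Rightarrow> nat set set \<Rightarrow> bool" where
  "maximum_ws_collection n m' m C \<longleftrightarrow> C \<subseteq> Delta n m' m \<and> ws_collection C \<and>
     (\<forall>D. D \<subseteq> Delta n m' m \<and> ws_collection D \<longrightarrow> card D \<le> card C)"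

end

theory Submission
  imports Defs
begin

text \<open>
  Let \<open>C\<close> be a weakly separated collection in the cube over \<open>n + 1\<close>. Its members without \<open>n + 1\<close> and its
  members with \<open>n + 1\<close>, from which \<open>n + 1\<close> is deleted, together form a weakly separated collection over
  \<open>n\<close>, and on each level at most one set arises in both ways. This bounds the size of \<open>C\<close>; in the extremal
  case there is exactly one such set on each level, and these sets form a path separating the two kinds.
  Induction along this path shows that in a maximum collection the inclusions between consecutive levels form
  a strip of triangles, and that a triangle with a base in level \<open>h\<close> is matched, across that base, by a set of
  level \<open>h + 1\<close> or by a further set of level \<open>h\<close>. Hence, if level \<open>h + 1\<close> consists of intervals and no
  lowering 3-flip is possible in level \<open>h\<close>, walking along the strip below level \<open>h\<close> shows that level \<open>h\<close>
  consists of intervals. Truncated collections are treated by adding all short cointervals and all long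
  intervals. In a single level, deleting the element 1 turns lowering 4-flips into lowering 3-flips between two
  levels, and one proceeds by induction.

  Flips preserve TP-bases, so it remains to see that \<open>IS n m' m\<close> is one. Its values determine a TP-function by
  the relations; conversely, prescribed values are attained by tropicalizing the flag minors of a matrix with
  prescribed interval minors.
\<close>

subsection \<open>Weak separation of two sets\<close>

text \<open>The guiding picture is planar: the members of a maximum collection are the vertices of a
  triangulated region, with the level as height. All of them compare a set with the path set of its
  level: sets of \<open>low\<close> lie to its left, sets of \<open>high\<close> to its right, and a
  path set squeezed between two sets that differ by one exchange has only few possible forms.

  A lowering 3-flip moves one set down by one level, hence cannot rearrange the lowest level
  \<open>m'\<close>. This is why 4-flips are required exactly there, and why sesqui-intervals occur
  only in that level.

  Prescribing interval minors says nothing directly about sesqui-intervals. For truncated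
  collections the TP-basis property therefore rests on the flip result itself, applied in the full
  cube to \<open>IS n m' m\<close> together with its padding.\<close>

definition encloses :: "nat set \<Rightarrow> nat set \<Rightarrow> bool" where
  "encloses X Y \<longleftrightarrow> (\<exists>a\<in>X - Y. \<exists>b\<in>X - Y. \<exists>c\<in>Y - X. a < c \<and> c < b)"

definition precedes :: "nat set \<Rightarrow> nat set \<Rightarrow> bool" where
  "precedes X Y \<longleftrightarrow> (\<forall>a\<in>X - Y. \<forall>b\<in>Y - X. a < b)"

text \<open>Weak separation without bipartitions: of two sets, only one that is not larger than the
  other may enclose it, and they may not enclose each other. Unlike \<open>weakly_separated\<close>
  this is reflexive, so collections can be tested on all pairs.\<close>

definition wsep :: "nat set \<Rightarrow> nat set \<Rightarrow> bool" where
  "wsep X Y \<longleftrightarrow> \<not> (encloses X Y \<and> encloses Y X) \<and>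
     (encloses X Y \<longrightarrow> card X \<le> card Y) \<and> (encloses Y X \<longrightarrow> card Y \<le> card X)"

lemma enclosesI: "a \<in> X \<Longrightarrow> a \<notin> Y \<Longrightarrow> b \<in> X \<Longrightarrow> b \<notin> Y \<Longrightarrow> c \<in> Y \<Longrightarrow> c \<notin> X \<Longrightarrow> a < c \<Longrightarrow> c < b \<Longrightarrow> encloses X Y"
  unfolding encloses_def by blast

lemma enclosesE:
  assumes "encloses X Y"
  obtains a b c where "a \<in> X" "a \<notin> Y" "b \<in> X" "b \<notin> Y" "c \<in> Y" "c \<notin> X" "a < c" "c < b"
  using assms unfolding encloses_def by blast

lemma precedesD: "precedes X Y \<Longrightarrow> a \<in> X \<Longrightarrow> a \<notin> Y \<Longrightarrow> b \<in> Y \<Longrightarrow> b \<notin> X \<Longrightarrow> a < b"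
  unfolding precedes_def by blast

lemma precedesI: "(\<And>a b. a \<in> X \<Longrightarrow> a \<notin> Y \<Longrightarrow> b \<in> Y \<Longrightarrow> b \<notin> X \<Longrightarrow> a < b) \<Longrightarrow> precedes X Y"
  unfolding precedes_def by blast

lemma wsep_refl [simp]: "wsep X X"
  by (simp add: wsep_def encloses_def)

lemma wsep_sym: "wsep X Y \<longleftrightarrow> wsep Y X"
  unfolding wsep_def by auto

lemma precedes_not_encloses:
  assumes "precedes X Y"
  shows "\<not> encloses X Y" "\<not> encloses Y X"
  using assms unfolding precedes_def encloses_def by (metis less_asym)+

lemma precedes_wsep: "precedes X Y \<Longrightarrow> wsep X Y"
  using precedes_not_encloses by (simp add: wsep_def)

lemma not_enc_precedes:
  assumes "\<not> encloses X Y" "\<not> encloses Y X"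
  shows "precedes X Y \<or> precedes Y X"
proof (rule ccontr)
  assume "\<not> ?thesis"
  then obtain a b a' b' where a: "a \<in> X - Y" "b \<in> Y - X" "\<not> a < b" "a' \<in> X - Y" "b' \<in> Y - X" "\<not> b' < a'"
    unfolding precedes_def by blast
  then have ne: "a \<noteq> b" "a' \<noteq> b'" "b' \<noteq> a" by auto
  with a have "b < a" "a' < b'" by auto
  have "\<not> a < b'" using assms a \<open>b < a\<close> unfolding encloses_def by blast
  with ne have "b' < a" by simp
  then show False using assms a \<open>a' < b'\<close> unfolding encloses_def by blast
qed

text \<open>Between a set and a superset \<open>precedes\<close> holds vacuously in both directions,
  which is why equal size is assumed.\<close>

lemma precedes_antisym:
  assumes "precedes X Y" "precedes Y X" "card X = card Y" "finite X" "finite Y"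
  shows "X = Y"
proof (rule ccontr)
  assume "X \<noteq> Y"
  have "X - Y \<noteq> {}" using assms card_subset_eq[of Y X] \<open>X \<noteq> Y\<close> by blast
  moreover have "Y - X \<noteq> {}" using assms card_subset_eq[of X Y] \<open>X \<noteq> Y\<close> by (metis Diff_eq_empty_iff)
  ultimately show False using assms(1,2) unfolding precedes_def by (meson less_asym all_not_in_conv)
qed

lemma wsep_card_less:
  assumes "wsep X Y" "card X < card Y"
  shows "\<not> encloses Y X"
  using assms by (auto simp: wsep_def)

lemma wsep_card_lessI:
  assumes "\<not> encloses Y X" "card X < card Y"
  shows "wsep X Y"
  using assms by (auto simp: wsep_def)

lemma wsep_alternate:
  assumes "wsep X Y" "a \<in> X" "a \<notin> Y" "b \<in> Y" "b \<notin> X" "c \<in> X" "c \<notin> Y" "d \<in> Y" "d \<notin> X" "a < b" "b < c" "c < d"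
  shows False
  using assms enclosesI[of a X Y c b] enclosesI[of b Y X d c] by (auto simp: wsep_def)

lemma prec_precedes: "prec X Y \<Longrightarrow> precedes X Y"
  by (simp add: prec_def precedes_def)

lemma splits_not_encloses:
  assumes "splits X Y" shows "\<not> encloses X Y"
proof
  assume "encloses X Y"
  then obtain a b c where e: "a \<in> X - Y" "b \<in> X - Y" "c \<in> Y - X" "a < c" "c < b"
    unfolding encloses_def by blast
  obtain Y1 Y2 where y: "Y1 \<union> Y2 = Y - X" "prec Y1 (X - Y)" "prec (X - Y) Y2"
    using assms unfolding splits_def by blast
  have "c \<in> Y1 \<or> c \<in> Y2" using y e by blast
  then show False
  proof
    assume "c \<in> Y1"
    then have "c \<in> Y1 - (X - Y)" "a \<in> (X - Y) - Y1" using e y by auto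
    then show False using y(2) e unfolding prec_def by (meson less_asym)
  next
    assume "c \<in> Y2"
    then have "c \<in> Y2 - (X - Y)" "b \<in> (X - Y) - Y2" using e y by auto
    then show False using y(3) e unfolding prec_def by (meson less_asym)
  qed
qed

lemma encloses_splits:
  assumes "encloses Y X" "\<not> encloses X Y"
  shows "splits X Y"
proof -
  obtain a b c where e: "a \<in> Y - X" "b \<in> Y - X" "c \<in> X - Y" "a < c" "c < b"
    using assms(1) unfolding encloses_def by blast
  let ?Y1 = "{y \<in> Y - X. y < c}" and ?Y2 = "{y \<in> Y - X. c < y}"
  have c: "\<And>y. y \<in> Y - X \<Longrightarrow> y \<noteq> c" using e by auto
  have 1: "y < x" if "y \<in> ?Y1" "x \<in> X - Y" for x y
  proof (rule ccontr)
    assume "\<not> y < x"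
    then have "x < y" using that by (metis (no_types, lifting) Diff_iff linorder_neqE_nat mem_Collect_eq)
    then show False using assms(2) that e unfolding encloses_def by blast
  qed
  have 2: "x < y" if "y \<in> ?Y2" "x \<in> X - Y" for x y
  proof (rule ccontr)
    assume "\<not> x < y"
    then have "y < x" using that by (metis (no_types, lifting) Diff_iff linorder_neqE_nat mem_Collect_eq)
    then show False using assms(2) that e unfolding encloses_def by blast
  qed
  have "?Y1 \<union> ?Y2 = Y - X" using c by (auto simp: nat_neq_iff)
  moreover have "prec ?Y1 (X - Y)" "prec (X - Y) ?Y2" using 1 2 e unfolding prec_def by blast+
  moreover have "?Y1 \<inter> ?Y2 = {}" "?Y1 \<noteq> {}" "?Y2 \<noteq> {}" "X - Y \<noteq> {}" using e by auto
  ultimately show ?thesis unfolding splits_def by blast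
qed

lemma prec_weakly: "precedes X Y \<Longrightarrow> X \<noteq> Y \<Longrightarrow> prec X Y \<or> prec Y X"
  unfolding prec_def precedes_def by blast

text \<open>\<open>splits X Y\<close> amounts to \<open>encloses Y X\<close> without
  \<open>encloses X Y\<close>; the size conditions then match.\<close>

lemma weakly_separated_iff: "weakly_separated X Y \<longleftrightarrow> X \<noteq> Y \<and> wsep X Y"
proof
  assume w: "weakly_separated X Y"
  have "X \<noteq> Y" using w unfolding weakly_separated_def prec_def splits_def by auto
  moreover from w have "wsep X Y"
    unfolding weakly_separated_def
  proof (elim disjE conjE)
    assume "prec X Y"
    then show ?thesis by (intro precedes_wsep prec_precedes)
  next
    assume "prec Y X"
    then have "wsep Y X" by (intro precedes_wsep prec_precedes)
    then show ?thesis by (simp only: wsep_sym)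
  next
    assume "splits X Y" "card Y \<le> card X"
    then show ?thesis using splits_not_encloses[of X Y] by (simp add: wsep_def)
  next
    assume "splits Y X" "card X \<le> card Y"
    then show ?thesis using splits_not_encloses[of Y X] by (simp add: wsep_def)
  qed
  ultimately show "X \<noteq> Y \<and> wsep X Y" by blast
next
  assume a: "X \<noteq> Y \<and> wsep X Y"
  consider "encloses X Y" "\<not> encloses Y X" "card X \<le> card Y" | "encloses Y X" "\<not> encloses X Y" "card Y \<le> card X"
    | "\<not> encloses X Y" "\<not> encloses Y X"
    using a unfolding wsep_def by argo
  then show "weakly_separated X Y"
  proof cases
    case 1
    then show ?thesis using encloses_splits[of X Y] by (simp add: weakly_separated_def)
  next
    case 2
    then show ?thesis using encloses_splits[of Y X] by (simp add: weakly_separated_def)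
  next
    case 3
    then have "prec X Y \<or> prec Y X" using not_enc_precedes[OF 3] prec_weakly a by metis
    then show ?thesis by (auto simp: weakly_separated_def)
  qed
qed

lemma ws_collection_iff: "ws_collection C \<longleftrightarrow> (\<forall>X\<in>C. \<forall>Y\<in>C. wsep X Y)"
  unfolding ws_collection_def weakly_separated_iff by (metis wsep_refl)

subsection \<open>Maximum collections in the full cube\<close>

text \<open>The number counts the intervals of \<open>{1..n}\<close>, the empty one included;
  \<open>ws_collection_card_le\<close> shows that it is the maximum.\<close>

definition maxws :: "nat \<Rightarrow> nat set set \<Rightarrow> bool" where
  "maxws n C \<longleftrightarrow> C \<subseteq> Pow {1..n} \<and> ws_collection C \<and> card C = n * (n + 1) div 2 + 1"

definition low :: "nat \<Rightarrow> nat set set \<Rightarrow> nat set set" where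
  "low n C = {Y \<in> C. Suc n \<notin> Y}"

definition high :: "nat \<Rightarrow> nat set set \<Rightarrow> nat set set" where
  "high n C = {Y. Suc n \<notin> Y \<and> insert (Suc n) Y \<in> C}"

text \<open>Restoring \<open>Suc n\<close> makes the second set strictly larger, so it must not
  enclose the first. As \<open>Suc n\<close> lies to the right of everything, an element of
  \<open>z - y\<close> to the left of an element of \<open>y - z\<close> would produce such an
  enclosure.\<close>

lemma low_high_precedes:
  assumes C: "C \<subseteq> Pow {1..Suc n}" "ws_collection C" and y: "y \<in> low n C" and z: "z \<in> high n C" and c: "card y \<le> card z"
  shows "precedes y z"
proof (rule precedesI)
  fix a b assume ab: "a \<in> y" "a \<notin> z" "b \<in> z" "b \<notin> y"
  let ?N = "Suc n"
  have yC: "y \<in> C" "?N \<notin> y" "insert ?N z \<in> C" "?N \<notin> z" using y z by (auto simp: low_def high_def)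
  have f: "finite z" using C yC finite_subset[of "insert ?N z" "{1..Suc n}"] by auto
  have "card y < card (insert ?N z)" using f yC c by simp
  then have ne: "\<not> encloses (insert ?N z) y" using C(2) yC wsep_card_less unfolding ws_collection_iff by blast
  have "a < ?N" using C(1) yC ab by (metis PowD atLeastAtMost_iff le_neq_implies_less subset_iff)
  then have "\<not> b < a" using ne ab yC enclosesI[of b "insert ?N z" y ?N a] by auto
  then show "a < b" using ab by (metis linorder_neqE_nat)
qed

text \<open>For a low set that is larger than a high set, an enclosure of the high set would,
  continued by \<open>Suc n\<close>, be an alternation of four elements between the original
  sets.\<close>

lemma low_high_ws:
  assumes C: "C \<subseteq> Pow {1..Suc n}" "ws_collection C"
  shows "ws_collection (low n C \<union> high n C)"
proof -
  let ?N = "Suc n"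
  have fin: "finite z" if "z \<in> high n C" for z
    using C that finite_subset[of "insert ?N z" "{1..Suc n}"] by (auto simp: high_def)
  have LL: "wsep y z" if "y \<in> low n C" "z \<in> low n C" for y z
    using that C by (auto simp: low_def ws_collection_iff)
  have HH: "wsep y z" if yz: "y \<in> high n C" "z \<in> high n C" for y z
  proof -
    have c: "wsep (insert ?N y) (insert ?N z)" using C yz by (auto simp: high_def ws_collection_iff)
    have "insert ?N y - insert ?N z = y - z" "insert ?N z - insert ?N y = z - y" using yz by (auto simp: high_def)
    moreover have "card (insert ?N y) = Suc (card y)" "card (insert ?N z) = Suc (card z)"
      using yz fin by (auto simp: high_def)
    ultimately show ?thesis using c unfolding wsep_def encloses_def by simp
  qed
  have LH: "wsep y z" if yz: "y \<in> low n C" "z \<in> high n C" for y z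
  proof (cases "card y \<le> card z")
    case True
    then show ?thesis using low_high_precedes[OF C yz] precedes_wsep by blast
  next
    case False
    have c: "wsep y (insert ?N z)" using C yz by (auto simp: high_def low_def ws_collection_iff)
    have N: "?N \<notin> y" "?N \<notin> z" using yz by (auto simp: high_def low_def)
    have "\<not> encloses y z"
    proof
      assume "encloses y z"
      then obtain a b k where e: "a \<in> y" "a \<notin> z" "b \<in> y" "b \<notin> z" "k \<in> z" "k \<notin> y" "a < k" "k < b" by (rule enclosesE)
      have "b < ?N" using C(1) yz e by (metis (no_types, lifting) N(1) PowD atLeastAtMost_iff le_neq_implies_less low_def mem_Collect_eq subset_iff)
      then show False using wsep_alternate[OF c, of a k b ?N] e N by auto
    qed
    then show ?thesis using False wsep_card_lessI wsep_sym by (metis not_le)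
  qed
  show ?thesis unfolding ws_collection_iff using LL HH LH wsep_sym by (metis Un_iff)
qed

lemma low_high_card:
  assumes C: "C \<subseteq> Pow {1..Suc n}"
  shows "card C = card (low n C \<union> high n C) + card (low n C \<inter> high n C)"
    and "low n C \<subseteq> Pow {1..n}" "high n C \<subseteq> Pow {1..n}" "C = low n C \<union> insert (Suc n) ` high n C"
proof -
  let ?N = "Suc n"
  have sub: "y \<subseteq> {1..n}" if "y \<subseteq> {1..Suc n}" "Suc n \<notin> y" for y
    using that by (metis atLeastAtMostSuc_conv atLeastAtMost_iff le_add1 plus_1_eq_Suc subset_insert)
  show l: "low n C \<subseteq> Pow {1..n}"
  proof
    fix y assume y: "y \<in> low n C"
    then have "y \<subseteq> {1..Suc n}" "Suc n \<notin> y" using C by (auto simp: low_def)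
    then show "y \<in> Pow {1..n}" using sub by blast
  qed
  show h: "high n C \<subseteq> Pow {1..n}"
  proof
    fix y assume y: "y \<in> high n C"
    then have "y \<subseteq> {1..Suc n}" "Suc n \<notin> y" using C by (auto simp: high_def)
    then show "y \<in> Pow {1..n}" using sub by blast
  qed
  show dec: "C = low n C \<union> insert ?N ` high n C" 
  proof
    show "C \<subseteq> low n C \<union> insert ?N ` high n C"
    proof
      fix Y assume Y: "Y \<in> C"
      show "Y \<in> low n C \<union> insert ?N ` high n C"
      proof (cases "?N \<in> Y")
        case True
        then have "insert ?N (Y - {?N}) = Y" by blast
        then have "Y - {?N} \<in> high n C" using Y by (auto simp: high_def)
        then show ?thesis using \<open>insert ?N (Y - {?N}) = Y\<close> by (metis UnCI image_eqI)
      qed (use Y in \<open>auto simp: low_def\<close>)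
    qed
  qed (auto simp: low_def high_def)
  have fin: "finite (low n C)" "finite (high n C)" using l h finite_subset finite_Pow_iff by (metis finite_atLeastAtMost)+
  have inj: "inj_on (insert ?N) (high n C)" by (rule inj_onI) (auto simp: high_def dest: insert_ident[THEN iffD1, rotated 2])
  have "low n C \<inter> insert ?N ` high n C = {}" by (auto simp: low_def)
  then have "card C = card (low n C) + card (high n C)"
    using dec fin inj by (metis card_Un_disjoint card_image finite_imageI)
  then show "card C = card (low n C \<union> high n C) + card (low n C \<inter> high n C)"
    using card_Un_Int[OF fin] by simp
qed

text \<open>A set in both families can stand on either side in \<open>low_high_precedes\<close>, so
  two such sets of equal size precede each other and coincide.\<close>

lemma card_path_le:
  assumes C: "C \<subseteq> Pow {1..Suc n}" "ws_collection C"
  shows "inj_on card (low n C \<inter> high n C)" "card ` (low n C \<inter> high n C) \<subseteq> {0..n}"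
proof -
  have s: "low n C \<inter> high n C \<subseteq> Pow {1..n}" using low_high_card[OF C(1)] by blast
  show "inj_on card (low n C \<inter> high n C)"
  proof (rule inj_onI)
    fix x y assume xy: "x \<in> low n C \<inter> high n C" "y \<in> low n C \<inter> high n C" "card x = card y"
    have "finite x" "finite y" using s xy finite_subset by (metis PowD finite_atLeastAtMost subset_eq)+
    then show "x = y" using precedes_antisym low_high_precedes[OF C] xy by (metis IntD1 IntD2 order_refl)
  qed
  show "card ` (low n C \<inter> high n C) \<subseteq> {0..n}" 
  proof (rule image_subsetI)
    fix x assume "x \<in> low n C \<inter> high n C"
    then have "x \<subseteq> {1..n}" using s by blast
    then show "card x \<in> {0..n}" using card_mono[of "{1..n}" x] by simp
  qed
qed

lemma triangle_Suc: "Suc n * (Suc n + 1) div 2 = n * (n + 1) div 2 + Suc n" for n :: nat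
proof -
  have "Suc n * (Suc n + 1) = n * (n + 1) + 2 * Suc n" by (simp add: algebra_simps)
  then show ?thesis by simp
qed

lemma ws_collection_card_le:
  assumes "C \<subseteq> Pow {1..n}" "ws_collection C"
  shows "card C \<le> n * (n + 1) div 2 + 1"
  using assms
proof (induction n arbitrary: C)
  case 0
  then have "C \<subseteq> {{}}" by auto
  then have "card C \<le> card {{}::nat set}" by (intro card_mono) auto
  then show ?case by simp
next
  case (Suc n)
  have "card (low n C \<inter> high n C) \<le> card {0..n}"
    using card_path_le[OF Suc.prems] by (metis card_image card_mono finite_atLeastAtMost)
  moreover have "card (low n C \<union> high n C) \<le> n * (n + 1) div 2 + 1"
    using Suc.IH low_high_ws[OF Suc.prems] low_high_card[OF Suc.prems(1)] by simp
  ultimately show ?case using low_high_card(1)[OF Suc.prems(1)] triangle_Suc[of n] by simp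
qed

lemma maxws_maximal:
  assumes "maxws n C" "S \<subseteq> {1..n}" "\<And>T. T \<in> C \<Longrightarrow> wsep S T"
  shows "S \<in> C"
proof (rule ccontr)
  assume "S \<notin> C"
  have C: "C \<subseteq> Pow {1..n}" "ws_collection C" "card C = n * (n + 1) div 2 + 1" using assms by (auto simp: maxws_def)
  have "finite C" using C finite_subset by (metis finite_Pow_iff finite_atLeastAtMost)
  have "ws_collection (insert S C)" using C(2) assms(3) unfolding ws_collection_iff by (metis wsep_refl wsep_sym insert_iff)
  then have "card (insert S C) \<le> n * (n + 1) div 2 + 1" using ws_collection_card_le C assms(2) by auto
  then show False using \<open>S \<notin> C\<close> \<open>finite C\<close> C(3) by simp
qed

text \<open>Both summands in \<open>low_high_card\<close> have upper bounds that add up to the given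
  total, so each bound is attained.\<close>

lemma maxws_split:
  assumes "maxws (Suc n) C"
  shows "maxws n (low n C \<union> high n C)"
    and "\<And>g. g \<le> n \<Longrightarrow> \<exists>x \<in> low n C \<inter> high n C. card x = g"
proof -
  have C: "C \<subseteq> Pow {1..Suc n}" "ws_collection C" "card C = Suc n * (Suc n + 1) div 2 + 1" using assms by (auto simp: maxws_def)
  note p = card_path_le[OF C(1,2)]
  have le: "card (low n C \<inter> high n C) \<le> card {0..n}"
    using p by (metis card_image card_mono finite_atLeastAtMost)
  have sub: "low n C \<union> high n C \<subseteq> Pow {1..n}" using low_high_card[OF C(1)] by simp
  have ws: "ws_collection (low n C \<union> high n C)" by (rule low_high_ws[OF C(1,2)])
  have le2: "card (low n C \<union> high n C) \<le> n * (n + 1) div 2 + 1"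
    by (rule ws_collection_card_le[OF sub ws])
  have eq: "card (low n C \<union> high n C) = n * (n + 1) div 2 + 1" "card (low n C \<inter> high n C) = card {0..n}"
    using le le2 low_high_card(1)[OF C(1)] C(3) triangle_Suc[of n] by simp_all
  show "maxws n (low n C \<union> high n C)" using sub ws eq by (simp add: maxws_def)
  have "card ` (low n C \<inter> high n C) = {0..n}"
    using p eq(2) by (metis card_image card_subset_eq finite_atLeastAtMost)
  then show "\<exists>x \<in> low n C \<inter> high n C. card x = g" if "g \<le> n" for g
    using that by (metis atLeastAtMost_iff imageE zero_le)
qed

lemma maxws_finite:
  assumes "maxws n C" shows "finite C" "X \<in> C \<Longrightarrow> finite X" "X \<in> C \<Longrightarrow> X \<subseteq> {1..n}"
    "X \<in> C \<Longrightarrow> Y \<in> C \<Longrightarrow> wsep X Y" "X \<in> C \<Longrightarrow> card X \<le> n"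
proof -
  have C: "C \<subseteq> Pow {1..n}" "ws_collection C" using assms by (auto simp: maxws_def)
  show "finite C" using C finite_subset by (metis finite_Pow_iff finite_atLeastAtMost)
  show s: "X \<in> C \<Longrightarrow> X \<subseteq> {1..n}" using C by blast
  show "X \<in> C \<Longrightarrow> finite X" using s finite_subset by blast
  show "X \<in> C \<Longrightarrow> Y \<in> C \<Longrightarrow> wsep X Y" using C(2) by (simp add: ws_collection_iff)
  show "card X \<le> n" if "X \<in> C" using card_mono[OF _ s[OF that]] by simp
qed

lemma initial_precedes: "S \<subseteq> {1..n} \<Longrightarrow> precedes {1..g} S"
  by (rule precedesI) (force simp: subset_iff)

lemma terminal_precedes: "S \<subseteq> {1..n} \<Longrightarrow> precedes S {g..n}"
  by (rule precedesI) (force simp: subset_iff)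

lemma maxws_initial:
  assumes "maxws n C" "g \<le> n" shows "{1..g} \<in> C"
  using assms(2) precedes_wsep[OF initial_precedes[OF maxws_finite(3)[OF assms(1)]]]
  by (intro maxws_maximal[OF assms(1)]) auto

section \<open>Squeezed sets and the strip between two levels\<close>

lemma finite_max_measure:
  fixes f :: "'a \<Rightarrow> nat"
  assumes "finite S" "S \<noteq> {}"
  obtains m where "m \<in> S" "\<And>y. y \<in> S \<Longrightarrow> f y \<le> f m"
proof -
  have "Max (f ` S) \<in> f ` S" using assms by (intro Max_in) auto
  then obtain m where "m \<in> S" "f m = Max (f ` S)" by auto
  then show ?thesis using that assms by simp
qed

lemma card_diff_swap:
  assumes "finite A" "finite B" "card B = Suc (card A)"
  shows "card (B - A) = Suc (card (A - B))"
proof -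
  have "card B = card (B - A) + card (A \<inter> B)" using assms by (metis Int_commute card_Diff_subset_Int add.commute card_mono diff_add finite_Int inf_le2)
  moreover have "card A = card (A - B) + card (A \<inter> B)" using assms by (metis card_Diff_subset_Int card_mono diff_add finite_Int inf_le1)
  ultimately show ?thesis using assms by simp
qed

lemma subset_card_Suc:
  assumes "A \<subseteq> B" "finite B" "card B = Suc (card A)"
  obtains e where "e \<notin> A" "B = insert e A"
proof -
  have "card (B - A) = 1" using assms by (metis card_Diff_subset diff_Suc_1 finite_subset diff_add_inverse2 plus_1_eq_Suc)
  then obtain e where "B - A = {e}" by (metis card_1_singletonE)
  then show ?thesis using that[of e] assms(1) by blast
qed

text \<open>An element \<open>k\<close> of \<open>K\<close> missing from \<open>x\<close> pushes
  every new element other than \<open>i\<close> above \<open>k\<close> and every new element other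
  than \<open>j\<close> below \<open>k\<close>. Hence only \<open>i\<close> and \<open>j\<close> can
  be new, and counting leaves exactly one missing element.\<close>

lemma squeeze_exchange:
  assumes "finite K" "finite x" "card x = Suc (card K)" "i \<notin> K" "j \<notin> K" "i < j"
    "precedes (insert i K) x" "precedes x (insert j K)"
  obtains e where "e \<notin> K" "x = insert e K" "i \<le> e" "e \<le> j"
  | k where "k \<in> K" "i < k" "k < j" "x = insert i (insert j (K - {k}))"
proof (cases "K \<subseteq> x")
  case True
  obtain e where e: "e \<notin> K" "x = insert e K" using subset_card_Suc[OF True assms(2,3)] .
  have "i \<le> e" using precedesD[OF assms(7), of i e] e assms(4) by (cases "e = i") auto
  moreover have "e \<le> j" using precedesD[OF assms(8), of e j] e assms(5) by (cases "e = j") auto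
  ultimately show ?thesis using that e by blast
next
  case False
  then obtain k where k: "k \<in> K" "k \<notin> x" by blast
  have i: "k < e" if "e \<in> x - K" "e \<noteq> i" for e using precedesD[OF assms(7), of k e] that k by auto
  have j: "e < k" if "e \<in> x - K" "e \<noteq> j" for e using precedesD[OF assms(8), of e k] that k by auto
  have sub: "x - K \<subseteq> {i, j}"
  proof
    fix e assume "e \<in> x - K"
    then show "e \<in> {i, j}" using i[of e] j[of e] by (metis insertCI less_asym)
  qed
  have c: "card (x - K) = Suc (card (K - x))" by (rule card_diff_swap) (use assms in auto)
  have "card (K - x) \<ge> 1" using k assms(1) by (metis Diff_iff One_nat_def Suc_leI card_gt_0_iff empty_iff finite_Diff)
  moreover have "card (x - K) \<le> card {i, j}" by (rule card_mono) (use sub in auto)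
  ultimately have c2: "card (x - K) = card {i, j}" "card (K - x) = 1" using c assms(6) by auto
  then have xk: "x - K = {i, j}" using sub by (simp add: card_subset_eq)
  have kx: "K - x = {k}" using c2(2) k by (metis DiffI card_1_singletonE singletonD)
  have "x = insert i (insert j (K - {k}))" using xk kx by blast
  moreover have "k < j" "i < k" using i[of j] j[of i] xk assms(6) by auto
  ultimately show ?thesis using that k by blast
qed

text \<open>A missing element of \<open>X\<close> would leave \<open>q\<close> as the only possible
  new element, while the sizes would then require two.\<close>

lemma squeeze_up:
  assumes "finite X" "finite x" "card x = Suc (card X)" "q \<notin> X" "precedes X x" "precedes x (insert q X)"
  obtains e where "e \<notin> X" "x = insert e X" "e \<le> q"
proof (cases "X \<subseteq> x")
  case True
  obtain e where e: "e \<notin> X" "x = insert e X" using subset_card_Suc[OF True assms(2,3)] .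
  have "e \<le> q" using precedesD[OF assms(6), of e q] e assms(4) by (cases "e = q") auto
  then show ?thesis using that e by blast
next
  case False
  then obtain k where k: "k \<in> X" "k \<notin> x" by blast
  have "x - X \<subseteq> {q}"
  proof
    fix e assume e: "e \<in> x - X"
    have "k < e" using precedesD[OF assms(5), of k e] k e by auto
    moreover have "e \<noteq> q \<Longrightarrow> e < k" using precedesD[OF assms(6), of e k] k e by auto
    ultimately show "e \<in> {q}" by (metis less_asym singletonI)
  qed
  then have "card (x - X) \<le> 1" by (metis card_mono finite.emptyI finite_insert is_singletonI is_singleton_altdef)
  moreover have "card (X - x) \<ge> 1" using k assms(1) by (metis Diff_iff One_nat_def Suc_leI card_gt_0_iff empty_iff finite_Diff)
  moreover have "card (x - X) = Suc (card (X - x))" by (rule card_diff_swap) (use assms in auto)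
  ultimately show ?thesis by simp
qed

lemma squeeze_down:
  assumes "finite U" "finite x" "card U = Suc (card x)" "p \<in> U" "precedes (U - {p}) x" "precedes x U"
  obtains d where "d \<in> U" "d \<le> p" "x = U - {d}"
proof (cases "x \<subseteq> U")
  case True
  obtain d where d: "d \<notin> x" "U = insert d x" using subset_card_Suc[OF True assms(1,3)] .
  have "d \<le> p" using precedesD[OF assms(5), of d p] d assms(4) by (cases "d = p") auto
  moreover have "d \<in> U" "x = U - {d}" using d by auto
  ultimately show ?thesis using that by blast
next
  case False
  then obtain e where e: "e \<in> x" "e \<notin> U" by blast
  have "U - {p} \<subseteq> x"
  proof
    fix u assume u: "u \<in> U - {p}"
    show "u \<in> x"
    proof (rule ccontr)
      assume "u \<notin> x"
      then show False using precedesD[OF assms(5), of u e] precedesD[OF assms(6), of e u] u e by auto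
    qed
  qed
  moreover have "card (U - {p}) = card x" using assms by simp
  ultimately have "x = U - {p}" using assms by (metis card_subset_eq)
  then show ?thesis using e by blast
qed

lemma card_exchange:
  assumes "finite Z" "d \<in> Z" "p \<notin> Z"
  shows "card (insert p (Z - {d})) = card Z"
proof -
  have "card Z > 0" using assms card_gt_0_iff by blast
  then show ?thesis using assms by simp
qed

lemma sum_exchange_less:
  fixes Z :: "nat set"
  assumes "finite Z" "d \<in> Z" "p \<notin> Z" "d < p"
  shows "\<Sum>Z < \<Sum>(insert p (Z - {d}))"
proof -
  have "\<Sum>Z = d + \<Sum>(Z - {d})" using assms by (simp add: sum.remove)
  moreover have "\<Sum>(insert p (Z - {d})) = p + \<Sum>(Z - {d})" using assms by simp
  ultimately show ?thesis using assms by simp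
qed

text \<open>The hypothesis \<open>St\<close> is the conclusion of \<open>strip_next\<close> over
  \<open>n\<close>, passed in so that the lemma can be used inside that induction. Walking to the
  right along the strip below the level of \<open>x\<close>, with upper set in \<open>low\<close>,
  can only end at \<open>x\<close>; there the required lower neighbour is found.\<close>

lemma path_has_lower:
  assumes M: "maxws (Suc n) C"
    and St: "\<And>X p. X \<in> low n C \<union> high n C \<Longrightarrow> insert p X \<in> low n C \<union> high n C \<Longrightarrow> p \<notin> X \<Longrightarrow>
       (\<exists>q>p. q \<notin> X \<and> insert q X \<in> low n C \<union> high n C) \<or>
       (\<exists>d\<in>X. d < p \<and> insert p (X - {d}) \<in> low n C \<union> high n C) \<or> insert p X = {p..n}"
    and x: "x \<in> low n C" "x \<in> high n C" "x \<noteq> {}"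
  shows "\<exists>d\<in>x. x - {d} \<in> high n C"
proof -
  let ?L = "low n C" and ?H = "high n C"
  let ?D = "?L \<union> ?H"
  have MD: "maxws n ?D" by (rule maxws_split(1)[OF M])
  note D = maxws_finite[OF MD]
  have C: "C \<subseteq> Pow {1..Suc n}" "ws_collection C" using M by (auto simp: maxws_def)
  note LH = low_high_precedes[OF C]
  have fx: "finite x" and xn: "x \<subseteq> {1..n}" and cx: "card x \<le> n" using D x by auto
  have g: "card x \<noteq> 0" using fx x by simp
  then obtain h where h: "card x = Suc h" using not0_implies_Suc by blast
  \<comment> \<open>These are the inclusions of the strip whose upper set lies in
    \<open>low\<close>. Both kinds of moves along the strip increase the sum of all elements, so a
    maximal sum marks the rightmost pair.\<close>
  define E where "E = {(Z, U). Z \<in> ?D \<and> U \<in> ?L \<and> Z \<subseteq> U \<and> card U = Suc h \<and> card Z = h}"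
  have "finite E" by (rule finite_subset[of _ "?D \<times> ?D"]) (use D(1) in \<open>auto simp: E_def\<close>)
  moreover have "E \<noteq> {}"
  proof -
    have "{1..Suc h} \<in> ?D" "{1..h} \<in> ?D" using maxws_initial[OF MD] cx h by auto
    \<comment> \<open>Membership in \<open>high\<close> puts this initial segment to the right of
      the path set \<open>x\<close>, while it precedes every set; so it equals
      \<open>x\<close>.\<close>
    moreover have "{1..Suc h} \<in> ?L" if "{1..Suc h} \<in> ?H"
    proof -
      have "precedes x {1..Suc h}" using LH[OF x(1) that] h by simp
      moreover have "precedes {1..Suc h} x" by (rule initial_precedes[OF xn])
      ultimately show ?thesis using precedes_antisym[of x "{1..Suc h}"] fx h x by simp
    qed
    ultimately have "({1..h}, {1..Suc h}) \<in> E" unfolding E_def by auto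
    then show ?thesis by blast
  qed
  ultimately obtain ZU where ZU: "ZU \<in> E" "\<And>y. y \<in> E \<Longrightarrow> \<Sum>(fst y) + \<Sum>(snd y) \<le> \<Sum>(fst ZU) + \<Sum>(snd ZU)"
    using finite_max_measure[of E "\<lambda>y. \<Sum>(fst y) + \<Sum>(snd y)"] by blast
  obtain Z U where zu: "ZU = (Z, U)" by (cases ZU)
  have Z: "Z \<in> ?D" "U \<in> ?L" "Z \<subseteq> U" "card U = Suc h" "card Z = h" using ZU zu by (auto simp: E_def)
  have mx: "\<And>Z' U'. (Z', U') \<in> E \<Longrightarrow> \<Sum>Z' + \<Sum>U' \<le> \<Sum>Z + \<Sum>U" using ZU zu by fastforce
  have fZ: "finite Z" "finite U" using Z D by auto
  obtain p where p: "p \<notin> Z" "U = insert p Z" using subset_card_Suc[OF Z(3) fZ(2)] Z by auto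
  have Ux: "precedes U x" using LH[OF Z(2) x(2)] Z h by simp
  have "U = x"
  proof (rule ccontr)
    assume ne: "U \<noteq> x"
    have "(\<exists>q>p. q \<notin> Z \<and> insert q Z \<in> ?D) \<or> (\<exists>d\<in>Z. d < p \<and> insert p (Z - {d}) \<in> ?D) \<or> insert p Z = {p..n}"
      using St[OF Z(1) _ p(1)] Z p by auto
    then consider "\<exists>q>p. q \<notin> Z \<and> insert q Z \<in> ?D" | d where "d\<in>Z" "d < p" "insert p (Z - {d}) \<in> ?D" | "U = {p..n}"
      using p by blast
    then show False
    proof cases
      case 1
      \<comment> \<open>The least choice ensures that no set \<open>insert e Z\<close> with
        \<open>e\<close> strictly between \<open>p\<close> and \<open>q\<close> belongs to the
        collection.\<close>
      define q where "q = (LEAST q. q > p \<and> q \<notin> Z \<and> insert q Z \<in> ?D)"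
      have q: "q > p" "q \<notin> Z" "insert q Z \<in> ?D" using LeastI_ex[OF 1] unfolding q_def by auto
      have qmin: "\<And>r. r > p \<Longrightarrow> r \<notin> Z \<Longrightarrow> insert r Z \<in> ?D \<Longrightarrow> q \<le> r" unfolding q_def by (rule Least_le) auto
      have notL: "insert q Z \<notin> ?L"
      proof
        assume "insert q Z \<in> ?L"
        then have "(Z, insert q Z) \<in> E" using Z q fZ by (auto simp: E_def)
        then have "\<Sum>Z + \<Sum>(insert q Z) \<le> \<Sum>Z + \<Sum>U" by (rule mx)
        then show False using p q fZ by simp
      qed
      then have "insert q Z \<in> ?H" using q by blast
      then have xq: "precedes x (insert q Z)" using LH[OF x(1)] q fZ Z h by simp
      show False
      proof (rule squeeze_exchange[of Z x p q])
        show "precedes (insert p Z) x" using Ux p by simp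
      next
        fix e assume e: "e \<notin> Z" "x = insert e Z" "p \<le> e" "e \<le> q"
        have "e \<noteq> p" "e \<noteq> q" using e ne p notL x by auto
        then have "q \<le> e" using qmin[of e] e x by auto
        then show False using e \<open>e \<noteq> q\<close> by simp
      next
        fix k assume k: "k \<in> Z" "p < k" "k < q" "x = insert p (insert q (Z - {k}))"
        have "encloses x Z" using k p q by (intro enclosesI[of p x Z q k]) auto
        moreover have "wsep Z x" using D(4) Z x by blast
        ultimately show False using wsep_card_less[of Z x] Z h by simp
      qed (use fZ fx h Z p q xq in auto)
    next
      case 2
      then have "(insert p (Z - {d}), U) \<in> E" using Z p card_exchange[OF fZ(1) 2(1) p(1)] by (auto simp: E_def)
      then have "\<Sum>(insert p (Z - {d})) + \<Sum>U \<le> \<Sum>Z + \<Sum>U" by (rule mx)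
      then show False using sum_exchange_less[OF fZ(1) 2(1) p(1) 2(2)] by simp
    next
      case 3
      have "precedes x U" unfolding 3 by (rule terminal_precedes[OF xn])
      then show False using precedes_antisym[OF Ux] Z h fx fZ ne by simp
    qed
  qed
  then have xp: "p \<in> x" "x - {p} = Z" using p by auto
  show ?thesis
  proof (cases "Z \<in> ?H")
    case True
    then show ?thesis using xp by blast
  next
    case False
    then have ZL: "Z \<in> ?L" using Z by blast
    obtain y where y: "y \<in> ?L" "y \<in> ?H" "card y = h" using maxws_split(2)[OF M, of h] h cx by auto
    have "precedes Z y" using LH[OF ZL y(2)] Z y by simp
    moreover have "precedes y x" using LH[OF y(1) x(2)] h y by simp
    ultimately obtain d where "d \<in> x" "y = x - {d}"
      using squeeze_down[of x y p] fx D(2)[of y] y h xp by auto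
    then show ?thesis using y by blast
  qed
qed

text \<open>The inclusions \<open>X \<subset> X \<union> {p}\<close> between two consecutive levels of \<open>C\<close> form a strip of triangles
  from left to right; every inclusion except the last one has a right neighbour.\<close>

lemma strip_next:
  assumes "maxws n C" "X \<in> C" "insert p X \<in> C" "p \<notin> X"
  shows "(\<exists>q>p. q \<notin> X \<and> insert q X \<in> C) \<or> (\<exists>d\<in>X. d < p \<and> insert p (X - {d}) \<in> C) \<or> insert p X = {p..n}"
  using assms
proof (induction n arbitrary: C X p)
  case 0
  then have "insert p X \<subseteq> {1..0}" using maxws_finite(3) by blast
  then show ?case by auto
next
  case (Suc n)
  let ?L = "low n C" and ?H = "high n C" and ?N = "Suc n"
  let ?D = "?L \<union> ?H"
  note M = Suc.prems(1)
  have MD: "maxws n ?D" by (rule maxws_split(1)[OF M])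
  note D = maxws_finite[OF MD]
  have C: "C \<subseteq> Pow {1..Suc n}" "ws_collection C" using M by (auto simp: maxws_def)
  note LH = low_high_precedes[OF C]
  have N: "?N \<notin> y" if "y \<in> ?D" for y using D(3)[OF that] by auto
  note IH = Suc.IH[OF MD]
  have X: "X \<in> C" "insert p X \<in> C" "p \<notin> X" using Suc.prems by auto
  have fX: "finite X" using X maxws_finite[OF M] by blast
  show ?case
  proof (cases "?N \<in> X")
    case True
    \<comment> \<open>After deletion of \<open>?N\<close> both sets lie in \<open>high\<close>. A
      move to the right cannot leave \<open>high\<close>, because low sets precede high sets of
      equal size.\<close>
    define X' where "X' = X - {?N}"
    have XX: "X = insert ?N X'" "?N \<notin> X'" "p \<noteq> ?N" "p \<notin> X'" "finite X'" using True X X'_def fX by auto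
    have H: "X' \<in> ?H" "insert p X' \<in> ?H" using X XX by (auto simp: high_def insert_commute)
    consider q where "q > p" "q \<notin> X'" "insert q X' \<in> ?D" | d where "d \<in> X'" "d < p" "insert p (X' - {d}) \<in> ?D"
      | "insert p X' = {p..n}" using IH[of X' p] H XX by blast
    then show ?thesis
    proof cases
      case 1
      have "insert q X' \<notin> ?L"
      proof
        assume "insert q X' \<in> ?L"
        from LH[OF this H(2)] have "precedes (insert q X') (insert p X')" using XX 1 by simp
        from precedesD[OF this, of q p] show False using 1 XX by auto
      qed
      then have "insert ?N (insert q X') \<in> C" "q \<noteq> ?N" using 1 N[of "insert q X'"] by (auto simp: high_def)
      then have "insert q X \<in> C" "q \<notin> X" using XX 1 by (auto simp: insert_commute)
      then show ?thesis using 1 by blast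
    next
      case 2
      have "insert p (X' - {d}) \<notin> ?L"
      proof
        assume "insert p (X' - {d}) \<in> ?L"
        moreover have "card (insert p (X' - {d})) = card X'" by (rule card_exchange) (use XX 2 in auto)
        ultimately have "precedes (insert p (X' - {d})) X'" using LH H(1) by simp
        from precedesD[OF this, of p d] show False using 2 XX by auto
      qed
      then have "insert ?N (insert p (X' - {d})) \<in> C" using 2 by (auto simp: high_def)
      moreover have "insert ?N (insert p (X' - {d})) = insert p (X - {d})" using XX 2 by auto
      ultimately show ?thesis using 2 XX by auto
    next
      case 3
      have "p \<le> Suc n" using X C by auto
      then have "insert p X = {p..Suc n}" using 3 XX by (auto simp: atLeastAtMostSuc_conv insert_commute)
      then show ?thesis by blast
    qed
  next
    case False
    then have XL: "X \<in> ?L" using X by (simp add: low_def)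
    show ?thesis
    proof (cases "p = ?N")
      case True
      \<comment> \<open>\<open>X\<close> lies on the path and the inclusion leads from
        \<open>low\<close> to a set containing \<open>?N\<close>; the neighbour comes from a set of
        \<open>high\<close> one level below \<open>X\<close>.\<close>
      then have XH: "X \<in> ?H" using X False by (simp add: high_def)
      show ?thesis
      proof (cases "X = {}")
        case True
        then show ?thesis using \<open>p = ?N\<close> by auto
      next
        case False
        obtain d where d: "d \<in> X" "X - {d} \<in> ?H" using path_has_lower[OF M IH XL XH False] by blast
        then have "insert p (X - {d}) \<in> C" using True by (simp add: high_def)
        moreover have "d < p" using d XL N D(3)[of X] True by auto
        ultimately show ?thesis using d by blast
      qed
    next
      case pN: False
      then have pL: "insert p X \<in> ?L" using X False by (simp add: low_def)
      show ?thesis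
      proof (cases "X \<in> ?H")
        case True
        then have "insert ?N X \<in> C" "?N \<notin> X" by (auto simp: high_def)
        moreover have "p < ?N" using D(3)[of "insert p X"] pL by auto
        ultimately show ?thesis by blast
      next
        case nH: False
        let ?g = "card X"
        have cg: "card (insert p X) = Suc ?g" using fX X by simp
        then have "Suc ?g \<le> n" using D(5)[of "insert p X"] pL by simp
        then obtain x y where x: "x \<in> ?L" "x \<in> ?H" "card x = Suc ?g" and y: "y \<in> ?L" "y \<in> ?H" "card y = ?g"
          using maxws_split(2)[OF M, of "Suc ?g"] maxws_split(2)[OF M, of ?g] by auto
        have fxy: "finite x" "finite y" using D(2) x y by auto
        have Xy: "precedes X y" using LH[OF XL y(2)] y by simp
        have px: "precedes (insert p X) x" using LH[OF pL x(2)] x cg by simp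
        have yC: "y \<in> C" "x \<in> C" using y x by (auto simp: low_def)
        consider "\<exists>q>p. q \<notin> X \<and> insert q X \<in> ?D" | d where "d \<in> X" "d < p" "insert p (X - {d}) \<in> ?D"
          | "insert p X = {p..n}" using IH[of X p] XL pL X by blast
        then show ?thesis
        proof cases
          case 1
          define q where "q = (LEAST q. q > p \<and> q \<notin> X \<and> insert q X \<in> ?D)"
          have q: "q > p" "q \<notin> X" "insert q X \<in> ?D" using LeastI_ex[OF 1] unfolding q_def by auto
          show ?thesis
          proof (cases "insert q X \<in> ?L")
            case True
            then show ?thesis using q by (auto simp: low_def)
          next
            case False
            then have "insert q X \<in> ?H" using q by blast
            then have xq: "precedes x (insert q X)" using LH[OF x(1)] x q fX by simp
            show ?thesis
            proof (rule squeeze_exchange[OF fX fxy(1) x(3) X(3) q(2) q(1) px xq])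
              fix e assume e: "e \<notin> X" "x = insert e X" "p \<le> e" "e \<le> q"
              show ?thesis
              proof (cases "e = p")
                case True
                have "precedes y x" using LH[OF y(1) x(2)] x y by simp
                then obtain d where d: "d \<in> x" "d \<le> p" "y = x - {d}"
                  using squeeze_down[of x y p] fxy x y e True Xy by auto
                have "d \<noteq> p" using d e True y nH by auto
                then have "d \<in> X" "d < p" "y = insert p (X - {d})" using d e True by auto
                then show ?thesis using yC by blast
              next
                case False
                then show ?thesis using e yC by (metis le_neq_implies_less)
              qed
            next
              fix k assume k: "k \<in> X" "p < k" "k < q" "x = insert p (insert q (X - {k}))"
              have "encloses x X" using k q X by (intro enclosesI[of p x X q k]) auto
              moreover have "wsep X x" using D(4) XL x by blast
              ultimately show ?thesis using wsep_card_less[of X x] x by simp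
            qed
          qed
        next
          case 2
          show ?thesis
          proof (cases "insert p (X - {d}) \<in> ?L")
            case True
            then show ?thesis using 2 by (auto simp: low_def)
          next
            case False
            then have "insert p (X - {d}) \<in> ?H" using 2 by blast
            moreover have cK: "Suc (card (X - {d})) = ?g" using fX 2 by (metis card.remove)
            ultimately have yp: "precedes y (insert p (X - {d}))" using LH[OF y(1)] y fX X by simp
            have ins: "insert d (X - {d}) = X" using 2 by blast
            show ?thesis
            proof (rule squeeze_exchange[of "X - {d}" y d p])
              fix e assume e: "e \<notin> X - {d}" "y = insert e (X - {d})" "d \<le> e" "e \<le> p"
              have "e \<noteq> d" using e ins nH y by auto
              then have "d < e" using e by simp
              show ?thesis
              proof (cases "e = p")
                case True
                then show ?thesis using e yC 2 by auto
              next
                case False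
                then have "encloses (insert p X) y" using e \<open>d < e\<close> 2 X by (intro enclosesI[of d _ _ p e]) auto
                moreover have "wsep y (insert p X)" using D(4) y pL by blast
                ultimately show ?thesis using wsep_card_less[of y "insert p X"] y cg by simp
              qed
            next
              fix k assume k: "k \<in> X - {d}" "d < k" "k < p" "y = insert d (insert p (X - {d} - {k}))"
              then have "y = insert p (X - {k})" using 2 by auto
              then show ?thesis using k yC by auto
            qed (use fX fxy cK y X 2 Xy yp ins in auto)
          qed
        next
          case 3
          then have "X = {Suc p..n}" using X by (metis Icc_eq_insert_lb_nat atLeastAtMost_iff empty_iff insertI1 insert_ident le_refl not_less_eq_eq)
          then have "precedes y X" using terminal_precedes[OF D(3)] y by auto
          then have "X = y" using precedes_antisym[OF Xy] y fX fxy by simp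
          then show ?thesis using nH y by simp
        qed
      qed
    qed
  qed
qed

text \<open>If \<open>S\<close> had at least the size of \<open>Xpq\<close>, an enclosure of
  \<open>Xpq\<close> by \<open>S\<close> would use a single element of \<open>Xpq\<close> and thus
  already enclose \<open>Xp\<close> or \<open>Xq\<close>. If \<open>S\<close> had at most the size
  of \<open>X\<close>, the ends of the opposite enclosure would have to be \<open>p\<close> and
  \<open>q\<close>; but then some element of \<open>X\<close> is missing from \<open>S\<close> and
  can replace one of them.\<close>

lemma not_wsep_witness:
  assumes "finite X" "finite S" "p < q" "p \<notin> X" "q \<notin> X"
    and w: "wsep S X" "wsep S (insert p X)" "wsep S (insert q X)" "\<not> wsep S (insert p (insert q X))"
  shows "card S = Suc (card X)" "encloses (insert p (insert q X)) S"
proof -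
  let ?U = "insert p (insert q X)"
  have cU: "card ?U = Suc (Suc (card X))" using assms by simp
  have ge: "\<not> (encloses S ?U \<and> card S \<ge> Suc (Suc (card X)))"
  proof
    assume a: "encloses S ?U \<and> card S \<ge> Suc (Suc (card X))"
    then obtain a b c where e: "a \<in> S" "a \<notin> ?U" "b \<in> S" "b \<notin> ?U" "c \<in> ?U" "c \<notin> S" "a < c" "c < b" by (elim conjE enclosesE)
    have "card X < card S" "card (insert p X) < card S" "card (insert q X) < card S" using a assms by auto
    then have ne: "\<not> encloses S X" "\<not> encloses S (insert p X)" "\<not> encloses S (insert q X)"
      using wsep_card_less w wsep_sym by metis+
    consider "c \<in> insert p X" | "c \<in> insert q X" using e by blast
    then show False
    proof cases
      case 1
      then have "encloses S (insert p X)" using e by (intro enclosesI[of a _ _ b c]) auto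
      then show False using ne by blast
    next
      case 2
      then have "encloses S (insert q X)" using e by (intro enclosesI[of a _ _ b c]) auto
      then show False using ne by blast
    qed
  qed
  then have lt: "card S < Suc (Suc (card X))" and en: "encloses ?U S"
    using w(4) unfolding wsep_def cU by (auto simp: not_le)
  then show "encloses ?U S" by blast
  show "card S = Suc (card X)"
  proof (rule ccontr)
    assume "card S \<noteq> Suc (card X)"
    then have le: "card S < Suc (card X)" using lt by simp
    then have ne: "\<not> encloses (insert p X) S" "\<not> encloses (insert q X) S"
      using wsep_card_less[OF w(2)] wsep_card_less[OF w(3)] assms by auto
    obtain a b c where e: "a \<in> ?U" "a \<notin> S" "b \<in> ?U" "b \<notin> S" "c \<in> S" "c \<notin> ?U" "a < c" "c < b"
      using en by (rule enclosesE)
    have "a \<notin> insert p X \<or> b \<notin> insert p X" "a \<notin> insert q X \<or> b \<notin> insert q X"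
      using ne enclosesI[of a "insert p X" S b c] enclosesI[of a "insert q X" S b c] e by blast+
    then have ab: "a = p" "b = q" using e assms(3) by auto
    have "\<not> X \<subseteq> S"
    proof
      assume "X \<subseteq> S"
      then have "card (insert c X) \<le> card S" using e assms by (intro card_mono) auto
      then show False using e assms le by simp
    qed
    then obtain x where x: "x \<in> X" "x \<notin> S" by blast
    then have "x \<noteq> c" using e by auto
    then have "x < c \<or> c < x" by auto
    then show False using ne enclosesI[of x "insert q X" S q c] enclosesI[of p "insert p X" S x c] e x ab by auto
  qed
qed

text \<open>\<open>Xp\<close> and \<open>Xq\<close> are neighbours above \<open>X\<close>, and the
  conclusion names what lies on the other side of the edge joining them. A \<open>d\<close> between
  \<open>p\<close> and \<open>q\<close> is impossible, since \<open>X\<close> would be enclosed by a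
  larger set. In the induction, a set found over \<open>n\<close> either lies in the right one of
  \<open>low\<close> and \<open>high\<close>, or it and a known set squeeze the path set of the
  level, which then supplies the required set or leads to a contradiction.\<close>

lemma lens_fill:
  assumes "maxws n C" "X \<in> C" "insert p X \<in> C" "insert q X \<in> C" "p \<notin> X" "q \<notin> X" "p < q"
    "\<And>r. p < r \<Longrightarrow> r < q \<Longrightarrow> r \<notin> X \<Longrightarrow> insert r X \<notin> C"
  shows "insert p (insert q X) \<in> C \<or> (\<exists>d\<in>X. (d < p \<or> q < d) \<and> insert p (insert q (X - {d})) \<in> C)"
  using assms
proof (induction n arbitrary: C X p q)
  case 0
  then have "insert p X \<subseteq> {1..0}" using maxws_finite(3) by blast
  then show ?case by auto
next
  case (Suc n)
  let ?L = "low n C" and ?H = "high n C" and ?N = "Suc n"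
  let ?D = "?L \<union> ?H"
  note M = Suc.prems(1)
  have MD: "maxws n ?D" by (rule maxws_split(1)[OF M])
  note D = maxws_finite[OF MD]
  have C: "C \<subseteq> Pow {1..Suc n}" "ws_collection C" using M by (auto simp: maxws_def)
  note LH = low_high_precedes[OF C]
  have N: "?N \<notin> y" if "y \<in> ?D" for y using D(3)[OF that] by auto
  note IH = Suc.IH[OF MD]
  have X: "X \<in> C" "insert p X \<in> C" "insert q X \<in> C" "p \<notin> X" "q \<notin> X" "p < q" using Suc.prems by auto
  note cons = Suc.prems(8)
  have fX: "finite X" using X maxws_finite[OF M] by blast
  have qN: "q \<le> ?N" using X C by auto
  \<comment> \<open>By maximality a missing \<open>insert p (insert q Z)\<close> is obstructed by
    some member, and \<open>not_wsep_witness\<close> places this member in the level of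
    \<open>insert p Z\<close>.\<close>
  have witness: "\<exists>S\<in>?D. card S = Suc (card Z) \<and> encloses (insert p (insert q Z)) S"
    if Z: "Z \<in> ?D" "insert p Z \<in> ?D" "insert q Z \<in> ?D" "insert p (insert q Z) \<notin> ?D" "p \<notin> Z" "q \<notin> Z" for Z
  proof -
    have "insert p (insert q Z) \<subseteq> {1..n}" using D(3)[OF Z(2)] D(3)[OF Z(3)] by auto
    then obtain S where S: "S \<in> ?D" "\<not> wsep (insert p (insert q Z)) S" using maxws_maximal[OF MD] Z(4) by blast
    then have "\<not> wsep S (insert p (insert q Z))" using wsep_sym by blast
    then show ?thesis using not_wsep_witness[of Z S p q] S D(2,4) Z X(6) by blast
  qed
  show ?case
  proof (cases "?N \<in> X")
    case True
    define X' where "X' = X - {?N}"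
    have XX: "X = insert ?N X'" "?N \<notin> X'" "p \<noteq> ?N" "q \<noteq> ?N" "p \<notin> X'" "q \<notin> X'" "finite X'" using True X X'_def fX by auto
    have H: "X' \<in> ?H" "insert p X' \<in> ?H" "insert q X' \<in> ?H" using X XX by (auto simp: high_def insert_commute)
    have cons': "insert r X' \<notin> ?D" if r: "p < r" "r < q" "r \<notin> X'" for r
    proof
      assume rD: "insert r X' \<in> ?D"
      have rN: "r \<noteq> ?N" using N[OF rD] by auto
      have "insert r X' \<notin> ?L"
      proof
        assume "insert r X' \<in> ?L"
        from LH[OF this H(2)] have "precedes (insert r X') (insert p X')" using XX r by simp
        from precedesD[OF this, of r p] show False using r XX by auto
      qed
      then have "insert ?N (insert r X') \<in> C" using rD by (auto simp: high_def)
      then show False using cons[of r] r XX rN by (auto simp: insert_commute)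
    qed
    have lift: "insert p (insert q (X - {d})) \<in> C" if "insert p (insert q (X' - {d})) \<in> ?H" "d \<in> X'" for d
    proof -
      have "insert ?N (insert p (insert q (X' - {d}))) = insert p (insert q (X - {d}))" using XX that by auto
      then show ?thesis using that by (auto simp: high_def)
    qed
    consider "insert p (insert q X') \<in> ?D"
      | d where "d \<in> X'" "d < p \<or> q < d" "insert p (insert q (X' - {d})) \<in> ?D" "insert p (insert q X') \<notin> ?D"
      using IH[of X' p q] H XX X(6) cons' by blast
    then show ?thesis
    proof cases
      case 1
      show ?thesis
      proof (cases "insert p (insert q X') \<in> ?H")
        case True
        then have "insert ?N (insert p (insert q X')) \<in> C" by (auto simp: high_def)
        then show ?thesis using XX by (auto simp: insert_commute)
      next
        case False
        \<comment> \<open>Here \<open>?N\<close> itself serves as the deleted element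
          \<open>d\<close>, to the right of \<open>q\<close>.\<close>
        then have "insert p (insert q (X - {?N})) \<in> C" using 1 X'_def by (auto simp: low_def)
        moreover have "q < ?N" using qN XX by simp
        ultimately show ?thesis using True by blast
      qed
    next
      case 2
      let ?y = "insert p (insert q (X' - {d}))"
      show ?thesis
      proof (cases "?y \<in> ?H")
        case True
        then show ?thesis using lift 2 XX by auto
      next
        case False
        then have yL: "?y \<in> ?L" using 2 by blast
        have cy: "card ?y = Suc (card X')" using card_exchange[of X' d q] XX 2 X(6) by auto
        have "precedes ?y (insert p X')" using LH[OF yL H(2)] cy XX by simp
        from precedesD[OF this, of q d] have qd: "q < d" using 2 XX X(6) by auto
        have "Suc (card X') \<le> n" using D(5)[of "insert p X'"] H XX by simp
        then obtain x where x: "x \<in> ?L" "x \<in> ?H" "card x = Suc (card X')" using maxws_split(2)[OF M] by blast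
        have fx: "finite x" using D x by auto
        have yx: "precedes ?y x" using LH[OF yL x(2)] cy x by simp
        have xp: "precedes x (insert p X')" "precedes x (insert q X')" using LH[OF x(1)] H x XX by auto
        \<comment> \<open>The obstructing set lies on one side of the path set \<open>x\<close>. If
          \<open>x\<close> were \<open>insert p X'\<close>, this would restrict the ends of the
          enclosure so much that on either side a known order or separation relation fails.\<close>
        have xne: "x \<noteq> insert p X'"
        proof
          assume xe: "x = insert p X'"
          obtain S where S: "S \<in> ?D" "card S = Suc (card X')" "encloses (insert p (insert q X')) S"
            using witness[of X'] H 2 XX by blast
          obtain a b c where e: "a \<in> insert p (insert q X')" "a \<notin> S" "b \<in> insert p (insert q X')" "b \<notin> S"
            "c \<in> S" "c \<notin> insert p (insert q X')" "a < c" "c < b" using S(3) by (rule enclosesE)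
          show False
          proof (cases "S \<in> ?L")
            case True
            then have Sx: "precedes S x" using LH[OF True x(2)] S x by simp
            have aq: "a = q" using precedesD[OF Sx, of c a] e xe by auto
            show False
            proof (cases "p \<in> S")
              case False
              then show False using precedesD[OF Sx, of c p] e xe aq X(6) by auto
            next
              case True
              have "wsep S (insert q X')" using D(4) S H by blast
              then show False using wsep_alternate[of S "insert q X'" p q c b] True e aq X(6) XX by auto
            qed
          next
            case False
            then have SH: "S \<in> ?H" using S by blast
            have xS: "precedes x S" using LH[OF x(1) SH] S x by simp
            have bq: "b = q" using precedesD[OF xS, of b c] e xe by auto
            have "precedes ?y S" using LH[OF yL SH] S cy by simp
            from precedesD[OF this, of q c] show False using e bq by auto
          qed
        qed
        \<comment> \<open>This \<open>?K\<close> exhibits \<open>?y\<close> and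
          \<open>insert p X'\<close> as two extensions of one set, by \<open>q\<close> and by
          \<open>d\<close>, as \<open>squeeze_exchange\<close> requires.\<close>
        let ?K = "insert p (X' - {d})"
        have K: "insert q ?K = ?y" "insert d ?K = insert p X'" "q \<notin> ?K" "d \<notin> ?K" "finite ?K"
          using 2 XX X(6) by auto
        have cK: "card x = Suc (card ?K)" using x card_exchange[of X' d p] XX 2 by simp
        show ?thesis
        proof (rule squeeze_exchange[OF K(5) fx cK K(3,4) qd, unfolded K(1,2), OF yx xp(1)])
          fix e assume e: "e \<notin> ?K" "x = insert e ?K" "q \<le> e" "e \<le> d"
          have "e \<noteq> d" using e xne K(2) by auto
          have "e \<noteq> q" using e False x K(1) by auto
          from precedesD[OF xp(2), of e q] show ?thesis using e \<open>e \<noteq> d\<close> \<open>e \<noteq> q\<close> K XX by auto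
        next
          fix k assume k: "k \<in> ?K" "q < k" "k < d" "x = insert q (insert d (?K - {k}))"
          then have "k \<in> X'" using X(6) by auto
          moreover have "x = insert p (insert q (X' - {k}))" using k 2 X(6) by auto
          ultimately show ?thesis using lift[of k] x k XX by auto
        qed
      qed
    qed
  next
    case False
    then have XL: "X \<in> ?L" using X by (simp add: low_def)
    have pN: "p \<noteq> ?N" using X(6) qN by simp
    then have pL: "insert p X \<in> ?L" using X False by (simp add: low_def)
    show ?thesis
    proof (cases "q = ?N")
      case True
      then have XH: "X \<in> ?H" using X False by (simp add: high_def)
      show ?thesis
      proof (cases "insert p X \<in> ?H")
        case True
        then have "insert ?N (insert p X) \<in> C" by (simp add: high_def)
        then show ?thesis using \<open>q = ?N\<close> by (simp add: insert_commute)
      next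
        case pnH: False
        have cp: "card (insert p X) = Suc (card X)" using fX X by simp
        then have "Suc (card X) \<le> n" using D(5)[of "insert p X"] pL by simp
        then obtain x where x: "x \<in> ?L" "x \<in> ?H" "card x = Suc (card X)" using maxws_split(2)[OF M] by blast
        have fx: "finite x" using D x by auto
        have xC: "x \<in> C" using x by (simp add: low_def)
        have px: "precedes (insert p X) x" using LH[OF pL x(2)] x cp by simp
        \<comment> \<open>A step of the strip that exchanges an element supplies \<open>d\<close>;
          the other two outcomes contradict either the choice of \<open>p\<close> and
          \<open>q\<close> as neighbours or the assumption that \<open>insert p X\<close> is not on
          the path.\<close>
        consider r where "r > p" "r \<notin> X" "insert r X \<in> ?D" | d where "d \<in> X" "d < p" "insert p (X - {d}) \<in> ?D"
          | "insert p X = {p..n}" using strip_next[OF MD, of X p] XL pL X by blast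
        then show ?thesis
        proof cases
          case 1
          have "r \<noteq> ?N" using N[OF 1(3)] by auto
          moreover have "r \<le> ?N" using D(3)[OF 1(3)] by auto
          ultimately have rN: "r < q" using True by simp
          then have "insert r X \<notin> C" using cons 1 by blast
          then have "insert r X \<in> ?H" using 1 by (auto simp: low_def)
          then have xr: "precedes x (insert r X)" using LH[OF x(1)] x fX 1 by simp
          have "precedes X x" using LH[OF XL x(2)] x by simp
          then obtain e where e: "e \<notin> X" "x = insert e X" "e \<le> r" using squeeze_up[OF fX fx x(3) 1(2) _ xr] by blast
          have "e \<noteq> p" using e x pnH by auto
          then have "p < e" using precedesD[OF px, of p e] e X by auto
          then show ?thesis using cons[of e] e rN xC by auto
        next
          case 2
          have "insert p (X - {d}) \<notin> ?L"
          proof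
            assume "insert p (X - {d}) \<in> ?L"
            moreover have "card (insert p (X - {d})) = card X" by (rule card_exchange) (use fX X 2 in auto)
            ultimately have "precedes (insert p (X - {d})) X" using LH XH by simp
            from precedesD[OF this, of p d] show False using 2 X by auto
          qed
          then have "insert ?N (insert p (X - {d})) \<in> C" using 2 by (auto simp: high_def)
          then show ?thesis using 2 True by (auto simp: insert_commute)
        next
          case 3
          have "precedes x (insert p X)" unfolding 3 using terminal_precedes[OF D(3)] x by auto
          then have "insert p X = x" using precedes_antisym[OF px] x cp fx fX by simp
          then show ?thesis using pnH x by simp
        qed
      qed
    next
      case qnN: False
      then have qL: "insert q X \<in> ?L" using X False by (simp add: low_def)
      have cons': "insert r X \<notin> ?D" if r: "p < r" "r < q" "r \<notin> X" for r
      proof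
        assume rD: "insert r X \<in> ?D"
        have "insert r X \<notin> C" using cons r by blast
        then have rH: "insert r X \<in> ?H" using rD by (auto simp: low_def)
        have "precedes (insert q X) (insert r X)" using LH[OF qL rH] fX X r by simp
        from precedesD[OF this, of q r] show False using r X by auto
      qed
      have cc: "card (insert p X) = Suc (card X)" "card (insert q X) = Suc (card X)" using fX X by auto
      consider "insert p (insert q X) \<in> ?D"
        | d where "d \<in> X" "d < p \<or> q < d" "insert p (insert q (X - {d})) \<in> ?D" "insert p (insert q X) \<notin> ?D"
        using IH[of X p q] XL pL qL X cons' by blast
      then show ?thesis
      proof cases
        case 1
        show ?thesis
        proof (cases "insert p (insert q X) \<in> ?L")
          case True
          then show ?thesis by (simp add: low_def)
        next
          case nL: False
          then have UH: "insert p (insert q X) \<in> ?H" using 1 by blast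
          have cU: "card (insert p (insert q X)) = Suc (Suc (card X))" using fX X by simp
          then have "Suc (Suc (card X)) \<le> n" using D(5)[OF 1] by simp
          then obtain x where x: "x \<in> ?L" "x \<in> ?H" "card x = Suc (Suc (card X))" using maxws_split(2)[OF M] by blast
          have fx: "finite x" using D x by auto
          have qx: "precedes (insert q X) x" and px: "precedes (insert p X) x" using LH[OF qL x(2)] LH[OF pL x(2)] x cc by auto
          have xU: "precedes x (insert p (insert q X))" using LH[OF x(1) UH] x cU by simp
          obtain e where e: "e \<notin> insert q X" "x = insert e (insert q X)" "e \<le> p"
            using squeeze_up[OF _ fx _ _ qx xU] fX x cc X by auto
          have "e \<noteq> p" using e x nL by auto
          then show ?thesis using precedesD[OF px, of p e] e X by auto
        qed
      next
        case 2
        let ?y = "insert p (insert q (X - {d}))"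
        show ?thesis
        proof (cases "?y \<in> ?L")
          case True
          then show ?thesis using 2 by (auto simp: low_def)
        next
          case False
          then have yH: "?y \<in> ?H" using 2 by blast
          have cy: "card ?y = Suc (card X)" using card_exchange[of X d q] fX 2 X by auto
          have "precedes (insert q X) ?y" using LH[OF qL yH] cy cc by simp
          from precedesD[OF this, of d p] have dp: "d < p" using 2 X by auto
          have "Suc (card X) \<le> n" using D(5)[of "insert p X"] pL cc by simp
          then obtain x where x: "x \<in> ?L" "x \<in> ?H" "card x = Suc (card X)" using maxws_split(2)[OF M] by blast
          have fx: "finite x" using D x by auto
          have xy: "precedes x ?y" using LH[OF x(1) yH] cy x by simp
          have qx: "precedes (insert q X) x" and px: "precedes (insert p X) x" using LH[OF qL x(2)] LH[OF pL x(2)] x cc by auto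
          have xC: "x \<in> C" using x by (simp add: low_def)
          have xne: "x \<noteq> insert q X"
          proof
            assume xe: "x = insert q X"
            obtain S where S: "S \<in> ?D" "card S = Suc (card X)" "encloses (insert p (insert q X)) S"
              using witness[of X] XL pL qL 2 X by blast
            obtain a b c where e: "a \<in> insert p (insert q X)" "a \<notin> S" "b \<in> insert p (insert q X)" "b \<notin> S"
              "c \<in> S" "c \<notin> insert p (insert q X)" "a < c" "c < b" using S(3) by (rule enclosesE)
            show False
            proof (cases "S \<in> ?L")
              case True
              then have Sx: "precedes S x" using LH[OF True x(2)] S x by simp
              have ap: "a = p" using precedesD[OF Sx, of c a] e xe by auto
              have "precedes S ?y" using LH[OF True yH] S cy by simp
              from precedesD[OF this, of c p] show False using e ap by auto
            next
              case False
              then have SH: "S \<in> ?H" using S by blast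
              have xS: "precedes x S" using LH[OF x(1) SH] S x by simp
              have bp: "b = p" using precedesD[OF xS, of b c] e xe by auto
              show False
              proof (cases "q \<in> S")
                case False
                then show False using precedesD[OF xS, of q c] e xe bp X(6) by auto
              next
                case True
                have "wsep (insert p X) S" using D(4) S pL by blast
                then show False using wsep_alternate[of "insert p X" S a c p q] True e bp X by auto
              qed
            qed
          qed
          let ?K = "insert q (X - {d})"
          have K: "insert p ?K = ?y" "insert d ?K = insert q X" "p \<notin> ?K" "d \<notin> ?K" "finite ?K"
            using 2 X fX by auto
          have cK: "card x = Suc (card ?K)" using x card_exchange[of X d q] fX X 2 by simp
          show ?thesis
          proof (rule squeeze_exchange[OF K(5) fx cK K(4,3) dp, unfolded K(2), OF qx xy])
            fix e assume e: "e \<notin> ?K" "x = insert e ?K" "d \<le> e" "e \<le> p"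
            have "e \<noteq> d" using e xne K(2) by auto
            have "e \<noteq> p" using e False x by auto
            from precedesD[OF px, of p e] show ?thesis using e \<open>e \<noteq> d\<close> \<open>e \<noteq> p\<close> K X by auto
          next
            fix k assume k: "k \<in> ?K" "d < k" "k < p" "x = insert d (insert p (?K - {k}))"
            then have "k \<in> X" using X(6) by auto
            moreover have "x = insert p (insert q (X - {k}))" using k 2 X(6) by auto
            ultimately show ?thesis using xC k by auto
          qed
        qed
      qed
    qed
  qed
qed

subsection \<open>Existence of lowering flips\<close>

text \<open>\<open>h\<close> is the level of the set \<open>Xik\<close> that a lowering 3-flip
  removes. The set \<open>Xj\<close> created by the flip is not mentioned: it is enclosed by the
  larger set \<open>Xik\<close>, so a weakly separated collection never contains both.\<close>

definition lowerable_at :: "nat set set \<Rightarrow> nat \<Rightarrow> bool" where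
  "lowerable_at C h \<longleftrightarrow> (\<exists>X i j k. i < j \<and> j < k \<and> i \<notin> X \<and> j \<notin> X \<and> k \<notin> X \<and> card X + 2 = h \<and>
     {insert i X, insert k X, insert i (insert j X), insert j (insert k X), insert i (insert k X)} \<subseteq> C)"

text \<open>\<open>Y\<close> is the set to be lowered, and \<open>p\<close>, \<open>a\<close>,
  \<open>c\<close> play the roles of \<open>i\<close>, \<open>j\<close>, \<open>k\<close>.\<close>

lemma lowerable_atI:
  assumes "finite Y" "Y \<in> C" "p \<in> Y" "c \<in> Y" "a \<notin> Y" "p < a" "a < c"
    "Y - {c} \<in> C" "Y - {p} \<in> C" "insert a (Y - {c}) \<in> C" "insert a (Y - {p}) \<in> C"
  shows "lowerable_at C (card Y)"
proof -
  let ?X = "Y - {p, c}"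
  have e: "insert p ?X = Y - {c}" "insert c ?X = Y - {p}" "insert p (insert c ?X) = Y"
    "insert p (insert a ?X) = insert a (Y - {c})" "insert a (insert c ?X) = insert a (Y - {p})"
    using assms by auto
  have "card Y = card (insert p (insert c ?X))" using e by simp
  also have "\<dots> = card ?X + 2" using assms by simp
  finally have c: "card ?X + 2 = card Y" by simp
  have "{insert p ?X, insert c ?X, insert p (insert a ?X), insert a (insert c ?X), insert p (insert c ?X)} \<subseteq> C"
    unfolding e using assms by (simp add: insert_absorb)
  moreover have "p \<notin> ?X" "c \<notin> ?X" "a \<notin> ?X" using assms by auto
  ultimately show ?thesis unfolding lowerable_at_def using c assms(6,7)
    by (intro exI[of _ ?X] exI[of _ p] exI[of _ a] exI[of _ c] conjI)
qed

text \<open>If no flip is available at \<open>Y\<close>, then the hypotheses hold again for the next set of the upper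
  boundary of the strip below level \<open>card Y\<close>, which has a larger sum.\<close>

lemma ladder:
  assumes M: "maxws n C"
  shows "Y \<in> C \<Longrightarrow> c \<in> Y \<Longrightarrow> d \<in> Y \<Longrightarrow> a \<notin> Y \<Longrightarrow> d < a \<Longrightarrow> a < c \<Longrightarrow> Y - {c} \<in> C \<Longrightarrow>
    insert a (Y - {c}) \<in> C \<Longrightarrow> insert a (Y - {d}) \<in> C \<Longrightarrow> lowerable_at C (card Y)"
proof (induction "\<Sum>{1..n} - \<Sum>Y" arbitrary: Y c a d rule: less_induct)
  case less
  note Y = less.prems
  note fin = maxws_finite[OF M]
  have fY: "finite Y" using fin Y by blast
  \<comment> \<open>Removing the least possible element gives the rightmost inclusion below
    \<open>Y\<close>, so the next step of the strip must change the upper set.\<close>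
  define p where "p = (LEAST p. p \<in> Y \<and> Y - {p} \<in> C)"
  have p: "p \<in> Y" "Y - {p} \<in> C" using LeastI[of "\<lambda>p. p \<in> Y \<and> Y - {p} \<in> C" c] Y unfolding p_def by auto
  have pmin: "\<And>r. r \<in> Y \<Longrightarrow> Y - {r} \<in> C \<Longrightarrow> p \<le> r" unfolding p_def by (rule Least_le) auto
  let ?X = "Y - {p}"
  have insX: "insert p ?X = Y" "p \<notin> ?X" using p by auto
  show ?case
  proof (cases "p = d")
    case True
    then show ?thesis using lowerable_atI[of Y C d c a] Y p fY by auto
  next
    case pd: False
    have cad: "card (insert a (Y - {d})) = card Y" by (rule card_exchange) (use fY Y in auto)
    have cp: "card ?X < card Y" using fY p by (metis card_Diff1_less)
    have "\<not> p < d"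
    proof
      assume "p < d"
      then have "encloses (insert a (Y - {d})) ?X" using Y p pd by (intro enclosesI[of p _ _ a d]) auto
      moreover have "wsep ?X (insert a (Y - {d}))" using fin(4) p Y by blast
      ultimately show False using wsep_card_less cp cad by metis
    qed
    then have dp: "d < p" using pd by simp
    have "(\<exists>q>p. q \<notin> ?X \<and> insert q ?X \<in> C)"
    proof -
      consider "\<exists>q>p. q \<notin> ?X \<and> insert q ?X \<in> C" | r where "r \<in> ?X" "r < p" "insert p (?X - {r}) \<in> C"
        | "Y = {p..n}" using strip_next[OF M p(2) _ insX(2), unfolded insX(1), OF Y(1)] by blast
      then show ?thesis
      proof cases
        case 2
        then have "insert p (?X - {r}) = Y - {r}" using p by auto
        then show ?thesis using pmin[of r] 2 by auto
      next
        case 3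
        then show ?thesis using Y(3) dp by auto
      qed
    qed
    note ex = this
    define q where "q = (LEAST q. q > p \<and> q \<notin> ?X \<and> insert q ?X \<in> C)"
    have q: "q > p" "q \<notin> ?X" "insert q ?X \<in> C" using LeastI_ex[OF ex] unfolding q_def by auto
    have qmin: "\<And>r. r > p \<Longrightarrow> r \<notin> ?X \<Longrightarrow> insert r ?X \<in> C \<Longrightarrow> q \<le> r" unfolding q_def by (rule Least_le) auto
    have qY: "q \<notin> Y" using q by auto
    show ?thesis
    proof (cases "q = a")
      case True
      then show ?thesis using lowerable_atI[of Y C p c a] Y p q fY by auto
    next
      case qa: False
      \<comment> \<open>The set \<open>insert a (Y - {d})\<close> is a barrier: separation from it
        excludes \<open>q < a\<close>, the set \<open>?U\<close> and \<open>q < r\<close>, so that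
        only the step to \<open>?Y2\<close> remains.\<close>
      have wa: "\<And>T. T \<in> C \<Longrightarrow> wsep T (insert a (Y - {d}))" using fin(4) Y by blast
      have "\<not> q < a"
      proof
        assume "q < a"
        then show False using wsep_alternate[OF wa[OF q(3)], of d p q a] Y p q qY dp qa pd by auto
      qed
      then have aq: "a < q" using qa by simp
      let ?U = "insert p (insert q ?X)"
      have "?U \<notin> C"
      proof
        assume U: "?U \<in> C"
        have "?U = insert q Y" using insX by blast
        then have "card ?U = Suc (card Y)" using qY fY by simp
        moreover have "encloses ?U (insert a (Y - {d}))" using Y p qY aq pd dp by (intro enclosesI[of d _ _ q a]) auto
        ultimately show False using wa[OF U] wsep_sym wsep_card_less cad by (metis lessI)
      qed
      then obtain r where r: "r \<in> ?X" "r < p \<or> q < r" "insert p (insert q (?X - {r})) \<in> C"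
        using lens_fill[OF M p(2) _ q(3) insX(2) q(2) q(1)] qmin insX Y by (metis leD)
      have "\<not> q < r"
      proof
        assume "q < r"
        then show False using wsep_alternate[OF wa[OF r(3)], of d a q r] Y p q r dp aq pd qY by auto
      qed
      then have rp: "r < p" using r by simp
      let ?Y2 = "insert q ?X"
      have Y2: "card ?Y2 = card Y" by (rule card_exchange) (use fY p qY in auto)
      have lt: "\<Sum>Y < \<Sum>?Y2" by (rule sum_exchange_less) (use fY p qY q in auto)
      have "\<Sum>?Y2 \<le> \<Sum>{1..n}" by (rule sum_mono2) (use fin(3)[OF q(3)] in auto)
      then have "\<Sum>{1..n} - \<Sum>?Y2 < \<Sum>{1..n} - \<Sum>Y" using lt by linarith
      \<comment> \<open>For \<open>?Y2\<close> the elements \<open>q\<close>, \<open>p\<close>,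
        \<open>r\<close> take over the roles of \<open>c\<close>, \<open>a\<close>,
        \<open>d\<close>.\<close>
      from less.hyps[OF this, of q r p] have "lowerable_at C (card ?Y2)"
      proof -
        have "?Y2 - {q} = ?X" "insert p (?Y2 - {r}) = insert p (insert q (?X - {r}))" using q r rp by auto
        then show ?thesis using less.hyps[OF \<open>\<Sum>{1..n} - \<Sum>?Y2 < \<Sum>{1..n} - \<Sum>Y\<close>, of q r p] q r rp p insX Y by auto
      qed
      then show ?thesis using Y2 by simp
    qed
  qed
qed

section \<open>Levels without lowering flips consist of intervals\<close>

definition is_interval :: "nat set \<Rightarrow> bool" where
  "is_interval S \<longleftrightarrow> (\<exists>p q. S = {p..q})"

lemma is_intervalD: "is_interval S \<Longrightarrow> a \<in> S \<Longrightarrow> b \<in> S \<Longrightarrow> a \<le> c \<Longrightarrow> c \<le> b \<Longrightarrow> c \<in> S"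
  unfolding is_interval_def by auto

lemma is_intervalI:
  assumes "finite S" "\<And>a b c. a \<in> S \<Longrightarrow> b \<in> S \<Longrightarrow> a < c \<Longrightarrow> c < b \<Longrightarrow> c \<in> S"
  shows "is_interval S"
proof (cases "S = {}")
  case True
  then have "S = {1..0}" by simp
  then show ?thesis unfolding is_interval_def by blast
next
  case False
  have "S = {Min S..Max S}"
  proof
    show "{Min S..Max S} \<subseteq> S"
    proof
      fix c assume "c \<in> {Min S..Max S}"
      then show "c \<in> S" using assms(2)[of "Min S" "Max S" c] Min_in[OF assms(1) False] Max_in[OF assms(1) False]
        by (metis atLeastAtMost_iff le_neq_implies_less)
    qed
    show "S \<subseteq> {Min S..Max S}" using assms(1) by auto
  qed
  then show ?thesis unfolding is_interval_def by blast
qed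

lemma not_lowerable_chain_step:
  assumes M: "maxws n C" and nf: "\<not> lowerable_at C h"
    and up: "\<And>S. S \<in> C \<Longrightarrow> card S = Suc h \<Longrightarrow> is_interval S"
    and h: "1 \<le> h" and s: "s + h \<le> n" and Y: "{s..<s+h} \<in> C" "c \<in> {s..<s+h}" "{s..<s+h} - {c} \<in> C"
  shows "{Suc s..<s+h} \<in> C \<and> {Suc s..<Suc s+h} \<in> C"
proof -
  let ?Y = "{s..<s+h}"
  note fin = maxws_finite[OF M]
  define p where "p = (LEAST p. p \<in> ?Y \<and> ?Y - {p} \<in> C)"
  have p: "p \<in> ?Y" "?Y - {p} \<in> C" using LeastI[of "\<lambda>p. p \<in> ?Y \<and> ?Y - {p} \<in> C" c] Y unfolding p_def by auto
  have pmin: "\<And>r. r \<in> ?Y \<Longrightarrow> ?Y - {r} \<in> C \<Longrightarrow> p \<le> r" unfolding p_def by (rule Least_le) auto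
  let ?X = "?Y - {p}"
  have insX: "insert p ?X = ?Y" "p \<notin> ?X" using p by auto
  have ex: "\<exists>q>p. q \<notin> ?X \<and> insert q ?X \<in> C"
  proof -
    consider "\<exists>q>p. q \<notin> ?X \<and> insert q ?X \<in> C" | r where "r \<in> ?X" "r < p" "insert p (?X - {r}) \<in> C"
      | "?Y = {p..n}" using strip_next[OF M p(2) _ insX(2), unfolded insX(1), OF Y(1)] by blast
    then show ?thesis
    proof cases
      case 2
      then have "insert p (?X - {r}) = ?Y - {r}" using p by auto
      then show ?thesis using pmin[of r] 2 by auto
    next
      case 3
      have "n \<in> {p..n}" using p(1) s by auto
      then show ?thesis using 3 s by (metis atLeastLessThan_iff not_le)
    qed
  qed
  define q where "q = (LEAST q. q > p \<and> q \<notin> ?X \<and> insert q ?X \<in> C)"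
  have q: "q > p" "q \<notin> ?X" "insert q ?X \<in> C" using LeastI_ex[OF ex] unfolding q_def by auto
  have qmin: "\<And>r. r > p \<Longrightarrow> r \<notin> ?X \<Longrightarrow> insert r ?X \<in> C \<Longrightarrow> q \<le> r" unfolding q_def by (rule Least_le) auto
  have qY: "q \<notin> ?Y" using q by auto
  have qs: "s + h \<le> q" using qY q(1) p(1) by (metis atLeastLessThan_iff le_trans less_imp_le not_le)
  let ?Y2 = "insert q ?X"
  have Y2: "card ?Y2 = h" using card_exchange[of ?Y p q] p qY by simp
  have Y2q: "?Y2 - {q} = ?X" using q by auto
  have lad: False if "r \<in> ?X" "r < p" "insert p (insert q (?X - {r})) \<in> C" for r
  proof -
    have "insert p (?Y2 - {r}) = insert p (insert q (?X - {r}))" using q that qY by auto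
    then have "lowerable_at C (card ?Y2)"
      using ladder[OF M q(3), of q r p] that Y2q q insX Y p by auto
    then show False using nf Y2 by simp
  qed
  let ?U = "insert p (insert q ?X)"
  have U: "?U \<in> C"
  proof (rule ccontr)
    assume "?U \<notin> C"
    then obtain r where r: "r \<in> ?X" "r < p \<or> q < r" "insert p (insert q (?X - {r})) \<in> C"
      using lens_fill[OF M p(2) _ q(3) insX(2) q(2) q(1)] qmin insX Y by (metis leD)
    moreover have "\<not> q < r" using r(1) qs by auto
    ultimately show False using lad by blast
  qed
  define V where "V = insert q ?Y"
  have "?U = V" unfolding V_def using insX by blast
  then have V: "V \<in> C" using U by simp
  have cV: "card V = Suc h" using qY by (simp add: V_def)
  then have "is_interval V" using up V by blast
  then have "s + h \<in> V" using is_intervalD[of V s q "s+h"] qs h by (auto simp: V_def)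
  then have qe: "q = s + h" by (auto simp: V_def)
  have Vi: "V = {s..<Suc (s+h)}" using qe by (auto simp: V_def)
  \<comment> \<open>As before, the least element selects the last inclusion below \<open>V\<close>.
    A further step to an interval of the same size can only drop the first element of
    \<open>V\<close>.\<close>
  define p' where "p' = (LEAST r. r \<in> V \<and> V - {r} \<in> C)"
  have "V - {q} = ?Y" using qY by (auto simp: V_def)
  then have p': "p' \<in> V" "V - {p'} \<in> C"
    using LeastI[of "\<lambda>r. r \<in> V \<and> V - {r} \<in> C" q] Y V_def unfolding p'_def by auto
  have p'min: "\<And>r. r \<in> V \<Longrightarrow> V - {r} \<in> C \<Longrightarrow> p' \<le> r" unfolding p'_def by (rule Least_le) auto
  have ins': "insert p' (V - {p'}) = V" using p' by blast
  have "p' = s"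
  proof -
    consider r where "r > p'" "r \<notin> V - {p'}" "insert r (V - {p'}) \<in> C" | r where "r \<in> V - {p'}" "r < p'" "insert p' (V - {p'} - {r}) \<in> C"
      | "V = {p'..n}" using strip_next[OF M p'(2), of p', unfolded ins', OF V] by blast
    then show ?thesis
    proof cases
      case 1
      have rU: "r \<notin> V" using 1 by auto
      have "card (insert r (V - {p'})) = Suc h"
        using card_exchange[of V p' r] rU p' cV Vi by simp
      then have I: "is_interval (insert r (V - {p'}))" using up 1 by blast
      show ?thesis
      proof (rule ccontr)
        assume "p' \<noteq> s"
        then have "p' \<in> insert r (V - {p'})" using is_intervalD[OF I, of s r p'] 1 p' Vi by auto
        then show False using 1 by auto
      qed
    next
      case 2
      then have "insert p' (V - {p'} - {r}) = V - {r}" using p' by auto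
      then show ?thesis using p'min[of r] 2 by auto
    next
      case 3
      have "s \<in> V" using Vi by auto
      then have "p' \<le> s" using 3 by (metis atLeastAtMost_iff)
      then show ?thesis using p'(1) Vi by auto
    qed
  qed
  then have Us: "V - {s} \<in> C" using p' by simp
  have "p = s"
  proof (rule ccontr)
    assume ne: "p \<noteq> s"
    have "V - {s} = insert p (insert q (?X - {s}))" using ne qs p(1) h by (auto simp: V_def)
    then show False using lad[of s] Us ne p(1) h by auto
  qed
  then have "?X = {Suc s..<s+h}" by auto
  moreover have "insert q {Suc s..<s+h} = {Suc s..<Suc s+h}" using qe h by auto
  ultimately show ?thesis using p(2) q(3) by simp
qed

text \<open>Iterating the chain step from the initial segment puts every interval of size
  \<open>h - 1\<close> that avoids \<open>1\<close> and \<open>n\<close> into the collection; a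
  non-interval of size \<open>h\<close> would enclose one of them.\<close>

lemma not_lowerable_intervals:
  assumes M: "maxws n C" and nf: "\<not> lowerable_at C h"
    and up: "\<And>S. S \<in> C \<Longrightarrow> card S = Suc h \<Longrightarrow> is_interval S"
    and S: "S \<in> C" "card S = h"
  shows "is_interval S"
proof (rule ccontr)
  assume ni: "\<not> is_interval S"
  note fin = maxws_finite[OF M]
  have fS: "finite S" "S \<subseteq> {1..n}" using fin S by auto
  obtain i k j where ijk: "i \<in> S" "k \<in> S" "i < j" "j < k" "j \<notin> S" using is_intervalI[OF fS(1)] ni by blast
  define a where "a = Min S"
  define b where "b = Max S"
  have Sne: "S \<noteq> {}" using ijk by blast
  have "a \<le> i" "k \<le> b" using fS(1) ijk by (auto simp: a_def b_def)
  then have "a < j" "j < b" using ijk by auto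
  then have ab: "a \<in> S" "b \<in> S" "S \<subseteq> {a..b}" "a < j" "j < b" "a \<ge> 1" "b \<le> n"
    using fS Sne Min_in[OF fS(1)] Max_in[OF fS(1)] by (auto simp: a_def b_def)
  have "S \<subseteq> {a..b} - {j}" using ab ijk by auto
  then have "card S \<le> card ({a..b} - {j})" by (intro card_mono) auto
  then have hb: "h \<le> b - a" using S ab by simp
  have "card {i, k} \<le> card S" using ijk fS by (intro card_mono) auto
  then have h2: "2 \<le> h" using ijk S by simp
  have chain: "{s..<s+h} \<in> C \<and> (\<exists>c\<in>{s..<s+h}. {s..<s+h} - {c} \<in> C)" if "1 \<le> s" "s + h \<le> Suc n" for s
    using that
  proof (induction s rule: nat_induct_at_least)
    case base
    have e: "{1..<1+h} = {1..h}" "{1..<1+h} - {h} = {1..h-1}" using h2 by auto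
    have "{1..h} \<in> C" "{1..h-1} \<in> C" using maxws_initial[OF M] base by auto
    then show ?case using e h2 by (metis atLeastAtMost_iff le_refl numeral_2_eq_2 Suc_leD One_nat_def)
  next
    case (Suc s)
    then obtain c where c: "{s..<s+h} \<in> C" "c\<in>{s..<s+h}" "{s..<s+h} - {c} \<in> C" by auto
    have "{Suc s..<s+h} \<in> C \<and> {Suc s..<Suc s+h} \<in> C"
      by (rule not_lowerable_chain_step[OF M nf up _ _ c]) (use Suc h2 in auto)
    moreover have "{Suc s..<Suc s+h} - {s+h} = {Suc s..<s+h}" using h2 by auto
    ultimately show ?case using h2 by (intro conjI bexI[of _ "s+h"]) auto
  qed
  have J: "{Suc s..<s+h} \<in> C" if s: "1 \<le> s" "s + h \<le> n" for s
  proof -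
    obtain c where c: "{s..<s+h} \<in> C" "c\<in>{s..<s+h}" "{s..<s+h} - {c} \<in> C" using chain[of s] s by auto
    show ?thesis using not_lowerable_chain_step[OF M nf up _ _ c] s h2 by simp
  qed
  \<comment> \<open>With this \<open>s\<close> the interval \<open>{Suc s..<s+h}\<close> lies
    strictly between \<open>a\<close> and \<open>b\<close> and covers the gap
    \<open>j\<close>.\<close>
  define s where "s = min (j - 1) (b - h)"
  have s: "1 \<le> s" "a \<le> s" "s < j" "j < s + h" "s + h \<le> b" using hb h2 ab by (auto simp: s_def)
  have T: "{Suc s..<s+h} \<in> C" using J s ab by auto
  have "encloses S {Suc s..<s+h}" using ab ijk s by (intro enclosesI[of a _ _ b j]) auto
  moreover have "card {Suc s..<s+h} < card S" using S h2 by simp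
  ultimately show False using wsep_card_less fin(4)[OF T S(1)] by blast
qed

text \<open>Above a non-interval of greatest size there are only intervals, so
  \<open>not_lowerable_intervals\<close> applies to its level.\<close>

lemma exists_lowerable:
  assumes M: "maxws n C" and up: "\<And>S. S \<in> C \<Longrightarrow> card S > m \<Longrightarrow> is_interval S"
    and S: "S \<in> C" "\<not> is_interval S" "m' < card S"
  shows "\<exists>h. m' < h \<and> h \<le> m \<and> lowerable_at C h"
proof -
  note fin = maxws_finite[OF M]
  let ?B = "{T \<in> C. \<not> is_interval T}"
  obtain T where T: "T \<in> ?B" "\<And>R. R \<in> ?B \<Longrightarrow> card R \<le> card T"
    using finite_max_measure[of ?B card] fin(1) S by auto
  have "lowerable_at C (card T)"
  proof (rule ccontr)
    assume "\<not> ?thesis"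
    then have "is_interval T"
    proof (rule not_lowerable_intervals[OF M])
      show "is_interval R" if "R \<in> C" "card R = Suc (card T)" for R using T(2)[of R] that by auto
    qed (use T in auto)
    then show False using T by auto
  qed
  moreover have "m' < card T" using T(2)[of S] S by auto
  moreover have "card T \<le> m" using up[of T] T(1) by (cases "m < card T") auto
  ultimately show ?thesis by blast
qed

text \<open>These sets are weakly separated from every member of \<open>Delta n m' m\<close>; adding them turns maximum
  collections in \<open>Delta n m' m\<close> into maximum collections in the full cube.\<close>

definition padding :: "nat \<Rightarrow> nat \<Rightarrow> nat \<Rightarrow> nat set set" where
  "padding n m' m = {S. S \<subseteq> {1..n} \<and> (card S < m' \<and> is_interval ({1..n} - S) \<or> m < card S \<and> is_interval S)}"

lemma interval_wsep:
  assumes "is_interval T" "card S \<le> card T"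
  shows "wsep T S"
proof -
  have "\<not> encloses T S"
  proof
    assume "encloses T S"
    then show False by (rule enclosesE) (meson assms(1) is_intervalD less_imp_le)
  qed
  then show ?thesis using assms(2) by (simp add: wsep_def)
qed

lemma cointerval_wsep:
  assumes "is_interval ({1..n} - T)" "S \<subseteq> {1..n}" "T \<subseteq> {1..n}" "card T \<le> card S"
  shows "wsep T S"
proof -
  have "\<not> encloses S T"
  proof
    assume "encloses S T"
    then obtain a b c where e: "a \<in> S" "a \<notin> T" "b \<in> S" "b \<notin> T" "c \<in> T" "c \<notin> S" "a < c" "c < b" by (rule enclosesE)
    then have "a \<in> {1..n} - T" "b \<in> {1..n} - T" using assms by auto
    then have "c \<in> {1..n} - T" using is_intervalD[OF assms(1), of a b c] e by simp
    then show False using e by simp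
  qed
  then show ?thesis using assms(4) by (simp add: wsep_def)
qed

text \<open>An interval encloses no set and a cointerval is enclosed by none, so large intervals and
  small cointervals meet the size condition against every set between them.\<close>

lemma padding_ws:
  assumes "m' \<le> m" "C \<subseteq> Delta n m' m" "ws_collection C"
  shows "ws_collection (C \<union> padding n m' m)"
proof -
  have C: "S \<subseteq> {1..n} \<and> m' \<le> card S \<and> card S \<le> m" if "S \<in> C" for S using assms that by (auto simp: Delta_def)
  have PC: "wsep T S" if "T \<in> padding n m' m" "S \<in> C" for S T
    using that(1) C[OF that(2)] interval_wsep[of T S] cointerval_wsep[of n T S] by (auto simp: padding_def)
  have PP: "wsep T S" if ts: "T \<in> padding n m' m" "S \<in> padding n m' m" "card T \<le> card S" for S T
  proof -
    consider "card T < m'" "is_interval ({1..n} - T)" "T \<subseteq> {1..n}" "S \<subseteq> {1..n}" | "m < card S" "is_interval S"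
      using ts assms(1) by (auto simp: padding_def)
    then show ?thesis
    proof cases
      case 1
      then show ?thesis using cointerval_wsep[of n T S] ts by auto
    next
      case 2
      then have "wsep S T" using interval_wsep ts by blast
      then show ?thesis using wsep_sym by blast
    qed
  qed
  have CC: "wsep S T" if "S \<in> C" "T \<in> C" for S T using assms(3) that by (simp add: ws_collection_iff)
  have PP': "wsep T S" if ts: "T \<in> padding n m' m" "S \<in> padding n m' m" for S T
    using PP[OF ts] PP[OF ts(2,1)] wsep_sym[of S T] by (meson nat_le_linear)
  show ?thesis unfolding ws_collection_iff
  proof (intro ballI)
    fix X Y assume "X \<in> C \<union> padding n m' m" "Y \<in> C \<union> padding n m' m"
    then show "wsep X Y" using PC[of X Y] PC[of Y X] wsep_sym[of X Y] CC[of X Y] PP'[of X Y] by blast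
  qed
qed

section \<open>The standard collection and its size\<close>

lemma intervals_iff: "S \<in> intervals n h \<longleftrightarrow> S \<subseteq> {1..n} \<and> card S = h \<and> is_interval S"
proof
  assume "S \<in> intervals n h"
  then obtain p q where "card S = h" "1 \<le> p" "q \<le> n" "S = {p..q}" by (auto simp: intervals_def)
  then show "S \<subseteq> {1..n} \<and> card S = h \<and> is_interval S" by (auto simp: is_interval_def)
next
  assume a: "S \<subseteq> {1..n} \<and> card S = h \<and> is_interval S"
  then obtain p q where pq: "S = {p..q}" by (auto simp: is_interval_def)
  show "S \<in> intervals n h"
  proof (cases "p \<le> q")
    case True
    then have "1 \<le> p" "q \<le> n" using a pq by auto
    then show ?thesis using a pq by (auto simp: intervals_def)
  next
    case False
    then have "S = {1..0}" using pq by simp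
    then show ?thesis using a unfolding intervals_def by (metis (mono_tags, lifting) le_refl mem_Collect_eq zero_le)
  qed
qed

lemma IS_iff: "S \<in> IS n m' m \<longleftrightarrow> S \<in> sesqui_intervals n m' \<or> (S \<subseteq> {1..n} \<and> m' \<le> card S \<and> card S \<le> m \<and> is_interval S)"
  unfolding IS_def by (auto simp: intervals_iff)

lemma sesqui_intervalsE:
  assumes "S \<in> sesqui_intervals n h"
  obtains p q r where "1 \<le> p" "p + 1 < q" "q \<le> r" "r \<le> n" "S = {1..p} \<union> {q..r}" "card S = h" "S \<subseteq> {1..n}"
  using assms unfolding sesqui_intervals_def by force

lemma IS_Delta:
  assumes "m' \<le> m" shows "IS n m' m \<subseteq> Delta n m' m"
proof
  fix S assume "S \<in> IS n m' m"
  then show "S \<in> Delta n m' m" unfolding IS_iff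
  proof
    assume "S \<in> sesqui_intervals n m'"
    then show ?thesis using assms by (rule_tac sesqui_intervalsE) (auto simp: Delta_def)
  qed (simp add: Delta_def)
qed

text \<open>For equal sizes it suffices that one set does not enclose the other. The one with the
  shorter initial run does not: its elements outside the other set lie in an interval.\<close>

lemma sesqui_wsep:
  assumes "S \<in> sesqui_intervals n h" "T \<in> sesqui_intervals n h"
  shows "wsep S T"
proof -
  have *: "wsep S T" if S: "S = {1..p} \<union> {q..r}" and T: "{1..p} \<subseteq> T" and c: "card S = card T" for S T :: "nat set" and p q r
  proof -
    have "\<not> encloses S T"
    proof
      assume "encloses S T"
      then obtain a b c where e: "a \<in> S" "a \<notin> T" "b \<in> S" "b \<notin> T" "c \<in> T" "c \<notin> S" "a < c" "c < b" by (rule enclosesE)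
      then have "a \<in> {q..r}" "b \<in> {q..r}" using S T by auto
      then have "c \<in> S" using e S by auto
      then show False using e by simp
    qed
    then show ?thesis using c by (simp add: wsep_def)
  qed
  obtain p q r where S: "S = {1..p} \<union> {q..r}" "card S = h" using assms(1) by (rule sesqui_intervalsE)
  obtain p' q' r' where T: "T = {1..p'} \<union> {q'..r'}" "card T = h" using assms(2) by (rule sesqui_intervalsE)
  show ?thesis
  proof (cases "p \<le> p'")
    case True
    then have "{1..p} \<subseteq> T" using T by auto
    then show ?thesis using *[OF S(1), of T] S T by simp
  next
    case False
    then have "{1..p'} \<subseteq> S" using S by auto
    then have "wsep T S" using *[OF T(1), of S] S T by simp
    then show ?thesis using wsep_sym by blast
  qed
qed

lemma IS_ws: "ws_collection (IS n m' m)"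
  unfolding ws_collection_iff
proof (intro ballI)
  fix X Y assume XY: "X \<in> IS n m' m" "Y \<in> IS n m' m"
  have si: "wsep X Y \<and> wsep Y X" if "X \<in> sesqui_intervals n m'" "is_interval Y" "m' \<le> card Y" for X Y
  proof -
    have "card X = m'" using that(1) by (simp add: sesqui_intervals_def)
    then have "wsep Y X" using that interval_wsep by simp
    then show ?thesis using wsep_sym by blast
  qed
  have ii: "wsep X Y" if "is_interval X" "is_interval Y" for X Y
    using interval_wsep[OF that(1), of Y] interval_wsep[OF that(2), of X] wsep_sym[of X Y] by (meson nat_le_linear)
  show "wsep X Y" using XY si[of X Y] si[of Y X] ii[of X Y] sesqui_wsep[of X n m' Y] by (auto simp: IS_iff)
qed

text \<open>A pair records the start and the length of a nonempty interval.\<close>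

lemma card_pairs: "card {(p, s). 1 \<le> p \<and> 1 \<le> s \<and> p + s \<le> Suc n} = n * (n + 1) div 2"
  and finite_pairs: "finite {(p, s). 1 \<le> p \<and> 1 \<le> s \<and> p + s \<le> Suc n}"
proof -
  show f: "finite {(p::nat, s). 1 \<le> p \<and> 1 \<le> s \<and> p + s \<le> Suc n}" for n
    by (rule finite_subset[of _ "{..Suc n} \<times> {..Suc n}"]) auto
  show "card {(p::nat, s). 1 \<le> p \<and> 1 \<le> s \<and> p + s \<le> Suc n} = n * (n + 1) div 2"
  proof (induction n)
    case 0
    have e: "{(p::nat, s). 1 \<le> p \<and> 1 \<le> s \<and> p + s \<le> Suc 0} = {}" by auto
    show ?case unfolding e by simp
  next
    case (Suc n)
    let ?P = "\<lambda>n. {(p::nat, s). 1 \<le> p \<and> 1 \<le> s \<and> p + s \<le> Suc n}"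
    let ?E = "(\<lambda>p. (p, Suc (Suc n) - p)) ` {1..Suc n}"
    have e: "?P (Suc n) = ?P n \<union> ?E"
    proof
      show "?P (Suc n) \<subseteq> ?P n \<union> ?E"
      proof clarsimp
        fix a b :: nat assume "Suc 0 \<le> a" "Suc 0 \<le> b" "a + b \<le> Suc (Suc n)" "(a, b) \<notin> (\<lambda>p. (p, Suc (Suc n) - p)) ` {Suc 0..Suc n}"
        moreover have "(a, b) \<in> (\<lambda>p. (p, Suc (Suc n) - p)) ` {Suc 0..Suc n}" if "a + b = Suc (Suc n)" "Suc 0 \<le> a" "Suc 0 \<le> b"
          using that by (intro image_eqI[of _ _ a]) auto
        ultimately show "a + b \<le> Suc n" by linarith
      qed
    qed auto
    have "card ?E = Suc n" by (subst card_image) (auto simp: inj_on_def)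
    moreover have "?P n \<inter> ?E = {}" by auto
    ultimately have "card (?P (Suc n)) = n * (n + 1) div 2 + Suc n"
      unfolding e using card_Un_disjoint[of "?P n" ?E] f[of n] Suc by simp
    then show ?case using triangle_Suc by simp
  qed
qed

text \<open>Intervals shorter than \<open>m'\<close> are replaced by sesqui-intervals of size \<open>m'\<close> or, when they start
  too early, by cointervals of size below \<open>m'\<close>.\<close>

definition IS_index :: "nat \<Rightarrow> nat \<Rightarrow> nat \<times> nat \<Rightarrow> nat set" where
  "IS_index n m' = (\<lambda>(p, s). if s = 0 then {} else if m' \<le> s then {p..<p + s}
     else if m' + 2 \<le> p + s then {1..m' - s} \<union> {p..<p + s}
     else {1..<p} \<union> {n + p + s - m'..n})"

text \<open>The first gap \<open>g\<close> recovers the index: it equals \<open>p\<close> for a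
  cointerval of size \<open>m' - s\<close>, and \<open>m' - s + 1\<close> for a sesqui-interval,
  whose last element \<open>p + s - 1\<close> then yields \<open>p\<close>.\<close>

definition IS_unindex :: "nat \<Rightarrow> nat \<Rightarrow> nat set \<Rightarrow> nat \<times> nat" where
  "IS_unindex n m' T = (let g = (LEAST x. 1 \<le> x \<and> x \<notin> T) in
     if T = {} then (0, 0) else if card T < m' then (g, m' - card T)
     else if is_interval T then (Min T, card T)
     else (Suc (Max T) - (Suc m' - g), Suc m' - g))"

lemma IS_index:
  assumes "m' \<le> m" "m' \<le> n" "u = (0, 0) \<or> (1 \<le> fst u \<and> 1 \<le> snd u \<and> fst u + snd u \<le> Suc n)"
  shows "IS_index n m' u \<in> IS n m' m \<union> padding n m' m" "IS_unindex n m' (IS_index n m' u) = u"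
proof -
  obtain p s where u: "u = (p, s)" by (cases u)
  let ?T = "IS_index n m' u"
  have "?T \<in> IS n m' m \<union> padding n m' m \<and> IS_unindex n m' ?T = u"
  proof (cases "s = 0")
    case True
    then have pu: "u = (0, 0)" using assms(3) u by auto
    then have T: "?T = {}" by (simp add: IS_index_def)
    have e: "is_interval {}" by (rule is_intervalI) auto
    have f: "is_interval {1..n}" by (auto simp: is_interval_def)
    have "{} \<in> IS n m' m \<union> padding n m' m" using e f by (cases "m' = 0") (auto simp: IS_iff padding_def)
    then show ?thesis using T pu by (simp add: IS_unindex_def)
  next
    case s0: False
    then have ps: "1 \<le> p" "1 \<le> s" "p + s \<le> Suc n" using assms(3) u by auto
    \<comment> \<open>The bound \<open>m' + 2 \<le> p + s\<close> says that \<open>m' - s\<close>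
      and \<open>p\<close> leave a gap, as a sesqui-interval requires.\<close>
    consider "m' \<le> s" | "s < m'" "m' + 2 \<le> p + s" | "s < m'" "p + s < m' + 2" by linarith
    then show ?thesis
    proof cases
      case 1
      then have T: "?T = {p..<p+s}" using s0 u by (simp add: IS_index_def)
      have I: "is_interval {p..<p+s}" by (rule is_intervalI) auto
      have sub: "{p..<p+s} \<subseteq> {1..n}" using ps by auto
      have "?T \<in> IS n m' m \<union> padding n m' m" unfolding T using I sub 1
        by (cases "s \<le> m") (auto simp: IS_iff padding_def)
      moreover have "Min {p..<p+s} = p" using s0 by (intro Min_eqI) auto
      ultimately show ?thesis using T I 1 s0 u by (simp add: IS_unindex_def Let_def)
    next
      case 2
      then have T: "?T = {1..m'-s} \<union> {p..<p+s}" using s0 u by (simp add: IS_index_def)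
      have cT: "card ?T = m'"
      proof -
        have "card ?T = card {1..m'-s} + card {p..<p+s}" unfolding T using 2 by (intro card_Un_disjoint) auto
        then show ?thesis using 2 by simp
      qed
      have "{p..<p+s} = {p..p+s-1}" using ps by auto
      then have "?T = {1..m'-s} \<union> {p..p+s-1}" using T by simp
      moreover have "1 \<le> m'-s" "m'-s+1 < p" "p \<le> p+s-1" "p+s-1 \<le> n" using 2 ps by linarith+
      ultimately have "?T \<in> sesqui_intervals n m'" unfolding sesqui_intervals_def using cT by blast
      moreover have "\<not> is_interval ?T"
      proof
        assume "is_interval ?T"
        then have I: "is_interval ({1..m'-s} \<union> {p..<p+s})" by (simp only: T)
        have "m'-s+1 \<in> {1..m'-s} \<union> {p..<p+s}" by (rule is_intervalD[OF I, of 1 p]) (use 2 ps in auto)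
        then show False using 2 by auto
      qed
      moreover have "(LEAST x. 1 \<le> x \<and> x \<notin> ?T) = Suc (m' - s)"
        by (rule Least_equality) (use T 2 in auto)
      moreover have "Max ?T = p + s - 1" unfolding T by (rule Max_eqI) (use 2 ps in auto)
      moreover have "?T \<noteq> {}" using T ps by auto
      ultimately show ?thesis using cT 2 ps u by (auto simp: IS_unindex_def Let_def IS_iff)
    next
      case 3
      then have T: "?T = {1..<p} \<union> {n+p+s-m'..n}" using s0 u by (simp add: IS_index_def)
      have k: "p < n + p + s - m'" "n + p + s - m' \<le> n + 1" using 3 assms(2) ps by auto
      have cT: "card ?T = m' - s"
      proof -
        have "card ?T = card {1..<p} + card {n+p+s-m'..n}" unfolding T using k by (intro card_Un_disjoint) auto
        then show ?thesis using 3 ps assms(2) by simp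
      qed
      have sub: "?T \<subseteq> {1..n}" using T k by auto
      have "{1..n} - ?T = {p..n+p+s-m'-1}" using T k ps by auto
      then have "is_interval ({1..n} - ?T)" unfolding is_interval_def by blast
      then have "?T \<in> padding n m' m" using sub cT 3 ps by (simp add: padding_def)
      moreover have "(LEAST x. 1 \<le> x \<and> x \<notin> ?T) = p"
        by (rule Least_equality) (use T k ps in auto)
      moreover have "?T \<noteq> {}" using cT 3 by auto
      ultimately show ?thesis using cT 3 ps u by (auto simp: IS_unindex_def Let_def)
    qed
  qed
  then show "?T \<in> IS n m' m \<union> padding n m' m" "IS_unindex n m' ?T = u" by auto
qed

lemma finite_Delta: "finite (Delta n m' m)"
  by (rule finite_subset[of _ "Pow {1..n}"]) (auto simp: Delta_def)

lemma finite_padding: "finite (padding n m' m)"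
  by (rule finite_subset[of _ "Pow {1..n}"]) (auto simp: padding_def)

lemma padding_disjoint: "Delta n m' m \<inter> padding n m' m = {}"
  by (auto simp: Delta_def padding_def)

text \<open>Injectivity of the index map bounds the size from below, the general bound for weakly
  separated collections bounds it from above.\<close>

lemma card_IS_padding:
  assumes "m' \<le> m" "m' \<le> n"
  shows "card (IS n m' m) + card (padding n m' m) = n * (n + 1) div 2 + 1"
proof -
  let ?P = "{(p, s). 1 \<le> p \<and> 1 \<le> s \<and> p + s \<le> Suc n}"
  let ?Q = "IS n m' m \<union> padding n m' m"
  have fI: "finite (IS n m' m)" using IS_Delta[OF assms(1)] finite_Delta finite_subset by metis
  have c: "card ?Q = card (IS n m' m) + card (padding n m' m)"
    using IS_Delta[OF assms(1)] padding_disjoint fI finite_padding by (intro card_Un_disjoint) blast+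
  have "inj_on (IS_index n m') (insert (0, 0) ?P)"
    by (rule inj_on_inverseI[of _ "IS_unindex n m'"], rule IS_index(2)[OF assms]) auto
  moreover have "IS_index n m' ` insert (0, 0) ?P \<subseteq> ?Q"
    by (rule image_subsetI, rule IS_index(1)[OF assms]) auto
  ultimately have "card (insert (0, 0) ?P) \<le> card ?Q"
    using card_inj_on_le[of "IS_index n m'" "insert (0, 0) ?P" ?Q] fI finite_padding by blast
  moreover have "card (insert (0, 0) ?P) = n * (n + 1) div 2 + 1"
    using card_pairs[of n] finite_pairs[of n] by (subst card_insert_disjoint) auto
  moreover have "card ?Q \<le> n * (n + 1) div 2 + 1"
  proof (rule ws_collection_card_le)
    show "?Q \<subseteq> Pow {1..n}" using IS_Delta[OF assms(1)] by (auto simp: Delta_def padding_def)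
    show "ws_collection ?Q" by (rule padding_ws[OF assms(1) IS_Delta[OF assms(1)] IS_ws])
  qed
  ultimately show ?thesis using c by simp
qed

lemma card_Un_padding:
  assumes "C \<subseteq> Delta n m' m"
  shows "card (C \<union> padding n m' m) = card C + card (padding n m' m)"
  using assms padding_disjoint finite_padding finite_subset[OF assms finite_Delta]
  by (intro card_Un_disjoint) blast+

lemma ws_Delta_card_le:
  assumes "m' \<le> m" "m' \<le> n" "C \<subseteq> Delta n m' m" "ws_collection C"
  shows "card C \<le> card (IS n m' m)"
proof -
  have "card (C \<union> padding n m' m) \<le> n * (n + 1) div 2 + 1"
    by (rule ws_collection_card_le[OF _ padding_ws[OF assms(1,3,4)]]) (use assms(3) in \<open>auto simp: Delta_def padding_def\<close>)
  then show ?thesis using card_Un_padding[OF assms(3)] card_IS_padding[OF assms(1,2)] by simp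
qed

lemma maximum_ws_iff:
  assumes "m' \<le> m" "m' \<le> n"
  shows "maximum_ws_collection n m' m C \<longleftrightarrow>
    C \<subseteq> Delta n m' m \<and> ws_collection C \<and> card C = card (IS n m' m)"
proof
  assume a: "maximum_ws_collection n m' m C"
  then have "card (IS n m' m) \<le> card C" using IS_Delta[OF assms(1)] IS_ws by (auto simp: maximum_ws_collection_def)
  then show "C \<subseteq> Delta n m' m \<and> ws_collection C \<and> card C = card (IS n m' m)"
    using a ws_Delta_card_le[OF assms] by (simp add: maximum_ws_collection_def le_antisym)
next
  assume "C \<subseteq> Delta n m' m \<and> ws_collection C \<and> card C = card (IS n m' m)"
  then show "maximum_ws_collection n m' m C"
    using ws_Delta_card_le[OF assms] by (simp add: maximum_ws_collection_def)
qed

lemma maximum_ws_padding: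
  assumes "m' \<le> m" "m' \<le> n" "maximum_ws_collection n m' m C"
  shows "maxws n (C \<union> padding n m' m)"
proof -
  have C: "C \<subseteq> Delta n m' m" "ws_collection C" "card C = card (IS n m' m)"
    using assms maximum_ws_iff by auto
  have "C \<union> padding n m' m \<subseteq> Pow {1..n}" using C(1) by (auto simp: Delta_def padding_def)
  then show ?thesis using card_Un_padding[OF C(1)] card_IS_padding[OF assms(1,2)] C(3)
      padding_ws[OF assms(1) C(1,2)] by (simp add: maxws_def)
qed

subsection \<open>Flips preserve weak separation\<close>

text \<open>Exactly one of \<open>c\<close>, \<open>d\<close> lies between \<open>a\<close> and \<open>b\<close>; written with exclusive or, so that it is
  additive in \<open>{a, b}\<close> and in \<open>{c, d}\<close>.\<close>

definition alternate :: "nat \<Rightarrow> nat \<Rightarrow> nat \<Rightarrow> nat \<Rightarrow> bool" where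
  "alternate a b c d \<longleftrightarrow> ((a < c) \<noteq> (b < c)) \<noteq> ((a < d) \<noteq> (b < d))"

lemma alternate_swap:
  assumes "{a, b} \<inter> {c, d} = {}"
  shows "alternate a b c d \<longleftrightarrow> alternate c d a b"
proof -
  have "c < a \<longleftrightarrow> \<not> a < c" "d < a \<longleftrightarrow> \<not> a < d" "c < b \<longleftrightarrow> \<not> b < c" "d < b \<longleftrightarrow> \<not> b < d"
    using assms by auto
  then show ?thesis unfolding alternate_def
    by (cases "a < c"; cases "b < c"; cases "a < d"; cases "b < d"; simp)
qed

lemma alternate_commute: "alternate a b c d \<longleftrightarrow> alternate b a c d" "alternate a b c d \<longleftrightarrow> alternate a b d c"
  unfolding alternate_def by auto

lemma alternate_ordered:
  assumes "alternate a b c d" "a < b" "c < d" "{a, b} \<inter> {c, d} = {}"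
  shows "a < c \<and> c < b \<and> b < d \<or> c < a \<and> a < d \<and> d < b"
proof -
  have "a \<noteq> c" "a \<noteq> d" "b \<noteq> c" "b \<noteq> d" using assms by auto
  then show ?thesis using assms(1-3) unfolding alternate_def
    by (cases "a < c"; cases "b < c"; cases "a < d"; cases "b < d"; simp; linarith)
qed

lemma wsep_alternateD:
  assumes "wsep V S" "a \<in> V" "b \<in> V" "a \<notin> S" "b \<notin> S" "c \<in> S" "d \<in> S" "c \<notin> V" "d \<notin> V"
  shows "\<not> alternate a b c d"
proof
  assume alt: "alternate a b c d"
  have *: False if V: "a \<in> V" "b \<in> V" "a \<notin> S" "b \<notin> S" "c \<in> S" "d \<in> S" "c \<notin> V" "d \<notin> V" "a < b" "c < d" "alternate a b c d" for a b c d
  proof -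
    have "wsep S V" using assms(1) wsep_sym by blast
    moreover have "{a, b} \<inter> {c, d} = {}" using V by auto
    ultimately show False using alternate_ordered[OF V(11,9,10)] wsep_alternate[OF assms(1), of a c b d] wsep_alternate[of S V c a d b] V by blast
  qed
  have "a \<noteq> b" "c \<noteq> d" using alt by (auto simp: alternate_def)
  then consider "a < b" "c < d" | "b < a" "c < d" | "a < b" "d < c" | "b < a" "d < c" by linarith
  then show False using *[of a b c d] *[of b a c d] *[of a b d c] *[of b a d c] alt alternate_commute assms by cases blast+
qed

text \<open>Together with \<open>wsep_alternateD\<close>: for sets of equal size, weak separation
  fails exactly when two elements of each difference alternate.\<close>

lemma encloses_both_alternate:
  assumes "encloses V S" "encloses S V"
  obtains a b c d where "a \<in> V" "b \<in> V" "a \<notin> S" "b \<notin> S" "c \<in> S" "d \<in> S" "c \<notin> V" "d \<notin> V" "alternate a b c d" "a < b" "c < d"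
proof -
  obtain a b c where 1: "a \<in> V" "a \<notin> S" "b \<in> V" "b \<notin> S" "c \<in> S" "c \<notin> V" "a < c" "c < b" using assms(1) by (rule enclosesE)
  obtain a' b' c' where 2: "a' \<in> S" "a' \<notin> V" "b' \<in> S" "b' \<notin> V" "c' \<in> V" "c' \<notin> S" "a' < c'" "c' < b'" using assms(2) by (rule enclosesE)
  have ne: "a \<noteq> a'" "b \<noteq> b'" using 1 2 by auto
  consider "b < b'" | "a' < a" | "a < a'" "b' < b" using ne by linarith
  then show ?thesis
  proof cases
    case 1
    then show ?thesis using that[of a b c b'] \<open>a \<in> V\<close> \<open>a \<notin> S\<close> \<open>b \<in> V\<close> \<open>b \<notin> S\<close> \<open>c \<in> S\<close> \<open>c \<notin> V\<close> \<open>a < c\<close> \<open>c < b\<close> 2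
      by (auto simp: alternate_def)
  next
    case c2: 2
    then show ?thesis using that[of a b a' c] 1 2 by (auto simp: alternate_def)
  next
    case 3
    then show ?thesis using that[of a c' a' b'] 1 2 by (auto simp: alternate_def)
  qed
qed

text \<open>By additivity the value for \<open>v1\<close>, \<open>v2\<close> is the exclusive or of
  the values for \<open>v1\<close>, \<open>e\<close> and for \<open>v2\<close>,
  \<open>e\<close>.\<close>

lemma alternate_replace_one:
  assumes "alternate v1 v2 r s"
  shows "alternate v1 e r s \<or> alternate v2 e r s"
  using assms unfolding alternate_def
  by (cases "v1 < r"; cases "v2 < r"; cases "v1 < s"; cases "v2 < s"; cases "e < r"; simp)

lemma alternate_replace_other:
  assumes "alternate a b u1 u2"
  shows "alternate a b u1 f \<or> alternate a b u2 f"
  using assms unfolding alternate_def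
  by (cases "a < u1"; cases "b < u1"; cases "a < u2"; cases "b < u2"; cases "a < f"; simp)

lemma alternate_replace_both:
  assumes "alternate v1 v2 u1 u2"
  shows "alternate v1 e u1 f \<or> alternate v1 e u2 f \<or> alternate v2 e u1 f \<or> alternate v2 e u2 f"
  using alternate_replace_one[OF assms, of e] alternate_replace_other by blast

lemma alternate_trans:
  assumes "alternate v1 v2 r s" "u1 \<noteq> u2" "r \<noteq> s"
    "{r, s} \<noteq> {u1, u2}"
    "u1 \<notin> {r, s} \<Longrightarrow> \<not> alternate v1 u1 r s \<and> \<not> alternate v2 u1 r s"
    "u2 \<notin> {r, s} \<Longrightarrow> \<not> alternate v1 u2 r s \<and> \<not> alternate v2 u2 r s"
  shows False
proof -
  have "u1 \<notin> {r, s} \<or> u2 \<notin> {r, s}" using assms(2-4) by auto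
  then show False using assms(5,6) alternate_replace_one[OF assms(1)] by blast
qed

text \<open>The two interleaving pairs enter symmetrically, so the lemma serves both directions of a
  4-flip. A violation that uses neither \<open>v1\<close>, \<open>v2\<close> together nor
  \<open>u1\<close>, \<open>u2\<close> together already occurs for one of the four sets
  \<open>X \<union> {v, u}\<close>; any other violation either pins down \<open>S\<close> or can be
  moved to such a place.\<close>

lemma flip4_wsep:
  assumes fin: "finite X" "finite S"
    and d: "v1 \<notin> X" "v2 \<notin> X" "u1 \<notin> X" "u2 \<notin> X"
    and il: "v1 < u1 \<and> u1 < v2 \<and> v2 < u2 \<or> u1 < v1 \<and> v1 < u2 \<and> u2 < v2"
    and w: "wsep S (insert v1 (insert u1 X))" "wsep S (insert v1 (insert u2 X))"
      "wsep S (insert v2 (insert u1 X))" "wsep S (insert v2 (insert u2 X))"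
    and ne: "S \<noteq> insert u1 (insert u2 X)"
  shows "wsep S (insert v1 (insert v2 X))"
proof (rule ccontr)
  let ?V = "insert v1 (insert v2 X)"
  assume nw: "\<not> wsep S ?V"
  have dist: "v1 \<noteq> v2" "v1 \<noteq> u1" "v1 \<noteq> u2" "v2 \<noteq> u1" "v2 \<noteq> u2" "u1 \<noteq> u2" "v1 < v2" "u1 < u2" using il by auto
  let ?k = "Suc (Suc (card X))"
  have cV: "card ?V = ?k" using fin d dist by simp
  have W: "wsep S (insert v (insert u X))" "card (insert v (insert u X)) = ?k" if "v \<in> {v1, v2}" "u \<in> {u1, u2}" for u v
    using that w fin d dist by auto
  show False
  proof (cases "card S" ?k rule: linorder_cases)
    case less
    have en: "encloses ?V S" using nw less cV by (auto simp: wsep_def)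
    have nW: "\<not> encloses (insert v (insert u X)) S" if "v \<in> {v1, v2}" "u \<in> {u1, u2}" for u v
      using wsep_card_less[OF W(1)[OF that]] W(2)[OF that] less by simp
    \<comment> \<open>Since only \<open>v1\<close> and \<open>v2\<close> can be the ends,
      \<open>S\<close> must be \<open>insert c X\<close>, which one of the four given sets
      encloses.\<close>
    have h: "a = v1 \<and> b = v2" if abc: "a \<in> ?V" "a \<notin> S" "b \<in> ?V" "b \<notin> S" "c \<in> S" "c \<notin> ?V" "a < c" "c < b" for a b c
    proof (rule ccontr)
      assume "\<not> ?thesis"
      moreover have "\<not> (a = v2 \<and> b = v1)" using abc dist by auto
      ultimately obtain v where v: "v \<in> {v1, v2}" "a \<in> insert v X" "b \<in> insert v X" using abc by auto
      obtain u where u: "u \<in> {u1, u2}" "u \<noteq> c" using dist by (metis insertCI)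
      have "encloses (insert v (insert u X)) S" by (rule enclosesI[of a _ _ b c]) (use v u abc in auto)
      then show False using nW v u by blast
    qed
    obtain a b c where abc: "a \<in> ?V" "a \<notin> S" "b \<in> ?V" "b \<notin> S" "c \<in> S" "c \<notin> ?V" "a < c" "c < b" using en by (rule enclosesE)
    have ab: "a = v1" "b = v2" using h[OF abc] by auto
    have XS: "X \<subseteq> S"
    proof
      fix x assume x: "x \<in> X"
      show "x \<in> S"
      proof (rule ccontr)
        assume xS: "x \<notin> S"
        then have "x \<noteq> c" using abc by auto
        then consider "x < c" | "c < x" by linarith
        then show False
        proof cases
          case 1
          then show False using h[of x b c] abc x xS d by auto
        next
          case 2
          then show False using h[of a x c] abc x xS d by auto
        qed
      qed
    qed
    have cX: "c \<notin> X" using abc(6) by blast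
    have "insert c X \<subseteq> S" using XS abc(5) by blast
    moreover have "card S \<le> card (insert c X)" using cX less fin by simp
    ultimately have S: "S = insert c X" using fin card_seteq by metis
    from il show False
    proof
      assume i: "v1 < u1 \<and> u1 < v2 \<and> v2 < u2"
      have "encloses (insert v1 (insert u2 X)) S" by (rule enclosesI[of v1 _ _ u2 c]) (use i S abc ab d in auto)
      then show False using nW by blast
    next
      assume i: "u1 < v1 \<and> v1 < u2 \<and> u2 < v2"
      have "encloses (insert v2 (insert u1 X)) S" by (rule enclosesI[of u1 _ _ v2 c]) (use i S abc ab d in auto)
      then show False using nW by blast
    qed
  next
    case greater
    have en: "encloses S ?V" using nw greater cV by (auto simp: wsep_def)
    have nW: "\<not> encloses S (insert v (insert u X))" if "v \<in> {v1, v2}" "u \<in> {u1, u2}" for u v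
      using W(1)[OF that] W(2)[OF that] greater by (auto simp: wsep_def)
    \<comment> \<open>Dually, \<open>S\<close> must consist of \<open>X\<close>, \<open>v1\<close>,
      \<open>v2\<close>, \<open>u1\<close>, \<open>u2\<close> without \<open>c\<close>.\<close>
    have h: "a = u1 \<and> b = u2" if abc: "a \<in> S" "a \<notin> ?V" "b \<in> S" "b \<notin> ?V" "c \<in> ?V" "c \<notin> S" "a < c" "c < b" for a b c
    proof (rule ccontr)
      assume "\<not> ?thesis"
      moreover have "\<not> (a = u2 \<and> b = u1)" using abc dist by auto
      ultimately obtain u where u: "u \<in> {u1, u2}" "u \<noteq> a" "u \<noteq> b" using dist by (metis insertCI)
      obtain v where v: "v \<in> {v1, v2}" "c \<in> insert v X" using abc by auto
      have "encloses S (insert v (insert u X))" by (rule enclosesI[of a _ _ b c]) (use v u abc in auto)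
      then show False using nW v u by blast
    qed
    obtain a b c where abc: "a \<in> S" "a \<notin> ?V" "b \<in> S" "b \<notin> ?V" "c \<in> ?V" "c \<notin> S" "a < c" "c < b" using en by (rule enclosesE)
    have ab: "a = u1" "b = u2" using h[OF abc] by auto
    let ?A = "insert u1 (insert u2 ?V)"
    have SA: "S \<subseteq> ?A - {c}"
    proof
      fix x assume x: "x \<in> S"
      show "x \<in> ?A - {c}"
      proof (rule ccontr)
        assume xS: "x \<notin> ?A - {c}"
        have "x \<noteq> c" using abc x by auto
        then consider "x < c" | "c < x" by linarith
        then show False
        proof cases
          case 1
          then show False using h[of x b c] abc x xS by auto
        next
          case 2
          then show False using h[of a x c] abc x xS by auto
        qed
      qed
    qed
    have "card (?A - {c}) = Suc ?k" using fin d dist abc by simp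
    then have S: "S = ?A - {c}" using SA greater fin card_seteq[of "?A - {c}" S] by auto
    from il show False
    proof
      assume i: "v1 < u1 \<and> u1 < v2 \<and> v2 < u2"
      have "encloses S (insert v2 (insert u1 X))" by (rule enclosesI[of v1 _ _ u2 c]) (use i S abc ab d in auto)
      then show False using nW by blast
    next
      assume i: "u1 < v1 \<and> v1 < u2 \<and> u2 < v2"
      have "encloses S (insert v1 (insert u2 X))" by (rule enclosesI[of u1 _ _ v2 c]) (use i S abc ab d in auto)
      then show False using nW by blast
    qed
  next
    case equal
    have en: "encloses ?V S" "encloses S ?V" using nw equal cV by (auto simp: wsep_def)
    have altvu: "alternate v1 v2 u1 u2" using il by (auto simp: alternate_def)
    have W': "\<not> alternate a b c e" if "v \<in> {v1, v2}" "u \<in> {u1, u2}" "a \<in> insert v (insert u X)" "b \<in> insert v (insert u X)"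
       "a \<notin> S" "b \<notin> S" "c \<in> S" "e \<in> S" "c \<notin> insert v (insert u X)" "e \<notin> insert v (insert u X)" for u v a b c e
      using wsep_alternateD[of "insert v (insert u X)" S a b c e] W(1)[OF that(1,2)] wsep_sym that by blast
    have N: "\<not> alternate a b c e" if abc: "a \<in> ?V" "b \<in> ?V" "a \<notin> S" "b \<notin> S" "c \<in> S" "e \<in> S" "c \<notin> ?V" "e \<notin> ?V"
      "{a, b} \<noteq> {v1, v2}" "{c, e} \<noteq> {u1, u2}" for a b c e
    proof
      assume alt: "alternate a b c e"
      then have abne: "a \<noteq> b" "c \<noteq> e" by (auto simp: alternate_def)
      have "v1 \<notin> {a, b} \<or> v2 \<notin> {a, b}" using abc(9) abne(1) dist(1) by auto
      then obtain v where v: "v \<in> {v1, v2}" "a \<in> insert v X" "b \<in> insert v X" using abc(1,2) by blast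
      have "u1 \<notin> {c, e} \<or> u2 \<notin> {c, e}" using abc(10) abne(2) dist(6) by auto
      then obtain u where u: "u \<in> {u1, u2}" "u \<noteq> c" "u \<noteq> e" by blast
      have "a \<in> insert v (insert u X)" "b \<in> insert v (insert u X)" using v(2,3) by blast+
      moreover have "c \<notin> insert v (insert u X)" "e \<notin> insert v (insert u X)" using abc(7,8) u(2,3) v(1) by blast+
      ultimately show False using W'[OF v(1) u(1)] alt abc(3-6) by blast
    qed
    obtain a b c e where A: "a \<in> ?V" "b \<in> ?V" "a \<notin> S" "b \<notin> S" "c \<in> S" "e \<in> S" "c \<notin> ?V" "e \<notin> ?V" "alternate a b c e" "a < b" "c < e"
      using encloses_both_alternate[OF en] by blast
    have Ad: "distinct [a, b, c, e]" using A by auto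
    have cSV: "card (S - ?V) = card (?V - S)"
    proof -
      have "card S = card (S - ?V) + card (S \<inter> ?V)" using fin by (metis card_Diff_subset_Int add.commute card_mono diff_add finite_Int inf_le1)
      moreover have "card ?V = card (?V - S) + card (S \<inter> ?V)" using fin by (metis card_Diff_subset_Int card_mono diff_add finite_Int finite_insert inf_le1 inf_commute)
      ultimately show ?thesis using equal cV by simp
    qed
    have "{a, b} = {v1, v2} \<or> {c, e} = {u1, u2}" using N[OF A(1-8)] A(9) by blast
    then consider "{a, b} = {v1, v2}" "{c, e} = {u1, u2}" | "{a, b} = {v1, v2}" "{c, e} \<noteq> {u1, u2}" | "{a, b} \<noteq> {v1, v2}" "{c, e} = {u1, u2}"
      by blast
    then show False
    proof cases
      case 1
      then have eqs: "a = v1" "b = v2" "c = u1" "e = u2" using A(10,11) dist(7,8) by (auto simp: doubleton_eq_iff)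
      \<comment> \<open>This is where \<open>ne\<close> enters: it provides \<open>x\<close> and
        \<open>f\<close>, with which both pairs can be broken at once.\<close>
      have "card (insert u1 (insert u2 X)) = card S" using equal fin d dist by simp
      then have "\<not> insert u1 (insert u2 X) \<subseteq> S" "\<not> S \<subseteq> insert u1 (insert u2 X)"
        using ne fin card_subset_eq by (metis, metis finite_insert)
      then obtain x f where x: "x \<in> X" "x \<notin> S" and f: "f \<in> S" "f \<notin> insert u1 (insert u2 X)" using A eqs by blast
      have fV: "f \<notin> ?V" using f A eqs by auto
      have xd: "x \<noteq> v1" "x \<noteq> v2" "x \<noteq> u1" "x \<noteq> u2" using x d by auto
      have "alternate v1 x u1 f \<or> alternate v1 x u2 f \<or> alternate v2 x u1 f \<or> alternate v2 x u2 f"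
        by (rule alternate_replace_both[OF altvu])
      moreover have "\<not> alternate v x u f" if "v \<in> {v1, v2}" "u \<in> {u1, u2}" for u v
        by (rule N) (use that A eqs x f fV xd in \<open>auto simp: doubleton_eq_iff\<close>)
      ultimately show False by blast
    next
      case 2
      then have eqs: "a = v1" "b = v2" using A(10,11) dist(7,8) by (auto simp: doubleton_eq_iff)
      show False
      proof (cases "X \<subseteq> S")
        case False
        then obtain x where x: "x \<in> X" "x \<notin> S" by blast
        have xd: "x \<noteq> v1" "x \<noteq> v2" "x \<noteq> c" "x \<noteq> e" using x d A by auto
        have "alternate v1 x c e \<or> alternate v2 x c e"
          by (rule alternate_replace_one) (use A eqs in auto)
        moreover have "\<not> alternate v x c e" if "v \<in> {v1, v2}" for v
          by (rule N) (use that A eqs 2 x xd in \<open>auto simp: doubleton_eq_iff\<close>)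
        ultimately show False by blast
      next
        case True
        have "insert c (insert e X) \<subseteq> S" "card S \<le> card (insert c (insert e X))" using True A equal fin Ad by auto
        then have S: "S = insert c (insert e X)" using fin card_seteq by metis
        show False
        \<comment> \<open>A \<open>u\<close> outside \<open>{c, e}\<close> is missing from
          \<open>S\<close>, so \<open>v\<close> and \<open>u\<close> may not alternate with
          \<open>c\<close>, \<open>e\<close> by separation from
          \<open>insert v (insert u X)\<close>.\<close>
        proof (rule alternate_trans[of v1 v2 c e u1 u2])
          show "\<not> alternate v1 u1 c e \<and> \<not> alternate v2 u1 c e" if "u1 \<notin> {c, e}"
            using W'[of v1 u1 v1 u1 c e] W'[of v2 u1 v2 u1 c e] that A eqs S d dist by auto
          show "\<not> alternate v1 u2 c e \<and> \<not> alternate v2 u2 c e" if "u2 \<notin> {c, e}"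
            using W'[of v1 u2 v1 u2 c e] W'[of v2 u2 v2 u2 c e] that A eqs S d dist by auto
        qed (use altvu A Ad eqs 2 dist in auto)
      qed
    next
      case 3
      then have eqs: "c = u1" "e = u2" using A(10,11) dist(7,8) by (auto simp: doubleton_eq_iff)
      show False
      proof (cases "S - ?V \<subseteq> {u1, u2}")
        case False
        then obtain f where f: "f \<in> S" "f \<notin> ?V" "f \<noteq> u1" "f \<noteq> u2" by blast
        have fd: "f \<noteq> a" "f \<noteq> b" using f A by auto
        have "alternate u1 u2 a b" using alternate_swap[of a b u1 u2] A(9) Ad unfolding eqs by simp
        then have "alternate u1 f a b \<or> alternate u2 f a b" by (rule alternate_replace_one)
        moreover have "\<not> alternate a b u f" if "u \<in> {u1, u2}" for u
          by (rule N) (use that A eqs 3 f in \<open>auto simp: doubleton_eq_iff\<close>)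
        moreover have "alternate a b u f \<longleftrightarrow> alternate u f a b" if "u \<in> {u1, u2}" for u
          by (rule alternate_swap) (use that Ad eqs fd in auto)
        ultimately show False by blast
      next
        case True
        then have SV: "S - ?V = {u1, u2}" using A(5-8) eqs by blast
        have "{a, b} \<subseteq> ?V - S" using A(1-4) by blast
        moreover have "card (?V - S) \<le> card {a, b}" unfolding cSV[symmetric] SV using dist(6) Ad by simp
        ultimately have VS: "?V - S = {a, b}" using fin card_seteq[of "?V - S" "{a, b}"] by auto
        show False
        proof (rule alternate_trans[of u1 u2 a b v1 v2])
          show "\<not> alternate u1 v1 a b \<and> \<not> alternate u2 v1 a b" if v1: "v1 \<notin> {a, b}"
          proof -
            have v1S: "v1 \<in> S" using VS v1 by blast
            have "a \<in> insert v2 X" "b \<in> insert v2 X" using A(1,2) v1 by blast+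
            then have "\<not> alternate a b u2 v1" "\<not> alternate a b u1 v1"
              using W'[of v2 u1 a b u2 v1] W'[of v2 u2 a b u1 v1] A(3-6) v1S eqs d dist(1-6) by (simp; blast)+
            moreover have "alternate a b u1 v1 \<longleftrightarrow> alternate u1 v1 a b" "alternate a b u2 v1 \<longleftrightarrow> alternate u2 v1 a b"
              using Ad eqs v1 by (auto intro!: alternate_swap)
            ultimately show ?thesis by blast
          qed
          show "\<not> alternate u1 v2 a b \<and> \<not> alternate u2 v2 a b" if v1: "v2 \<notin> {a, b}"
          proof -
            have v2S: "v2 \<in> S" using VS v1 by blast
            have "a \<in> insert v1 X" "b \<in> insert v1 X" using A(1,2) v1 by blast+
            then have "\<not> alternate a b u2 v2" "\<not> alternate a b u1 v2"
              using W'[of v1 u1 a b u2 v2] W'[of v1 u2 a b u1 v2] A(3-6) v2S eqs d dist(1-6) by (simp; blast)+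
            moreover have "alternate a b u1 v2 \<longleftrightarrow> alternate u1 v2 a b" "alternate a b u2 v2 \<longleftrightarrow> alternate u2 v2 a b"
              using Ad eqs v1 by (auto intro!: alternate_swap)
            ultimately show ?thesis by blast
          qed
          show "alternate u1 u2 a b" using alternate_swap[of a b u1 u2] A(9) Ad unfolding eqs by simp
        qed (use Ad 3 dist in auto)
      qed
    qed
  qed
qed

text \<open>Adding a new largest element \<open>l\<close> to all sets of size at most \<open>h\<close> respects weak separation and
  turns 3-flips between the levels \<open>h\<close> and \<open>h + 1\<close> into 4-flips in level \<open>h + 1\<close>.\<close>

lemma wsep_lift:
  assumes "finite S" "finite T" "\<And>x. x \<in> S \<union> T \<Longrightarrow> x < l"
  shows "wsep (if card S \<le> h then insert l S else S) (if card T \<le> h then insert l T else T) \<longleftrightarrow> wsep S T"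
proof -
  have lt: "l \<notin> S" "l \<notin> T" using assms(3) by blast+
  have mixed: "wsep (insert l S) T \<longleftrightarrow> wsep S T" if "finite S" "finite T" "\<And>x. x \<in> S \<union> T \<Longrightarrow> x < l" "card S < card T" for S T
  proof -
    have lt: "l \<notin> S" "l \<notin> T" using that(3) by blast+
    have bound: "\<And>x. x \<in> T \<Longrightarrow> x < l" using that(3) by blast
    have c: "card (insert l S) \<le> card T" using that lt by simp
    have 1: "encloses T (insert l S) \<longleftrightarrow> encloses T S"
    proof
      assume "encloses T (insert l S)"
      then obtain a b c where e: "a \<in> T" "a \<notin> insert l S" "b \<in> T" "b \<notin> insert l S" "c \<in> insert l S" "c \<notin> T" "a < c" "c < b" by (rule enclosesE)
      have "c \<noteq> l" using e that(3)[of b] by auto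
      then show "encloses T S" using e by (intro enclosesI[of a _ _ b c]) auto
    next
      assume "encloses T S"
      then obtain a b c where e: "a \<in> T" "a \<notin> S" "b \<in> T" "b \<notin> S" "c \<in> S" "c \<notin> T" "a < c" "c < b" by (rule enclosesE)
      then show "encloses T (insert l S)" using lt by (intro enclosesI[of a _ _ b c]) auto
    qed
    have 2: "encloses (insert l S) T" if en: "encloses T S"
    proof -
      obtain a b c where e: "a \<in> T" "a \<notin> S" "b \<in> T" "b \<notin> S" "c \<in> S" "c \<notin> T" "a < c" "c < b" using en by (rule enclosesE)
      have "b < l" using e bound by blast
      then show ?thesis using e lt by (intro enclosesI[of c _ _ l b]) auto
    qed
    show ?thesis using 1 2 c \<open>card S < card T\<close> by (auto simp: wsep_def)
  qed
  have both: "wsep (insert l S) (insert l T) \<longleftrightarrow> wsep S T"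
  proof -
    have "insert l S - insert l T = S - T" "insert l T - insert l S = T - S" using lt by auto
    then show ?thesis using assms lt by (simp add: wsep_def encloses_def)
  qed
  consider "card S \<le> h" "card T \<le> h" | "card S \<le> h" "h < card T" | "h < card S" "card T \<le> h" | "h < card S" "h < card T" by linarith
  then show ?thesis
  proof cases
    case 3
    have "wsep (insert l T) S \<longleftrightarrow> wsep T S" by (rule mixed) (use assms 3 in auto)
    then show ?thesis using 3 wsep_sym by auto
  qed (use both mixed[OF assms] in auto)
qed

text \<open>For \<open>h = Suc (card X)\<close>, the lift adjoins \<open>l\<close> to
  \<open>Xi\<close>, \<open>Xj\<close>, \<open>Xk\<close> but not to \<open>Xij\<close>,
  \<open>Xik\<close>, \<open>Xjk\<close>, and these become the six sets of a 4-flip on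
  \<open>i < j < k < l\<close>.\<close>

lemma flip3_wsep:
  assumes fin: "finite X" "finite S" and d: "i \<notin> X" "j \<notin> X" "k \<notin> X" and o: "i < j" "j < k"
    and w: "wsep S (insert i X)" "wsep S (insert k X)" "wsep S (insert i (insert j X))" "wsep S (insert j (insert k X))"
  shows "S \<noteq> insert i (insert k X) \<Longrightarrow> wsep S (insert j X)"
    and "S \<noteq> insert j X \<Longrightarrow> wsep S (insert i (insert k X))"
proof -
  define l where "l = Suc (Max (insert k (S \<union> X)))"
  have l: "\<And>x. x \<in> insert k (S \<union> X) \<Longrightarrow> x < l" using fin by (simp add: l_def less_Suc_eq_le)
  define h where "h = Suc (card X)"
  define F where "F = (\<lambda>T. if card T \<le> h then insert l T else T)"
  have kl: "i < l" "j < l" "k < l" using l[of k] o by auto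
  have lX: "l \<notin> X" "l \<notin> S" using l by blast+
  have eq: "wsep (F S) (F T) \<longleftrightarrow> wsep S T" if "T \<subseteq> insert i (insert j (insert k X))" for T
    unfolding F_def by (rule wsep_lift) (use that fin l kl finite_subset[OF that] in auto)
  have f1: "F (insert a X) = insert a (insert l X)" if "a \<in> {i, j, k}" for a using that d fin by (auto simp: h_def F_def)
  have f2: "F (insert a (insert b X)) = insert a (insert b X)" if "a \<in> {i, j, k}" "b \<in> {i, j, k}" "a \<noteq> b" for a b
    using that d fin by (auto simp: h_def F_def)
  have subX: "X \<subseteq> insert i (insert j (insert k X))" by blast
  have fs: "finite (F S)" using fin by (simp add: F_def)
  have W: "wsep (F S) (insert i (insert l X))" "wsep (F S) (insert k (insert l X))" "wsep (F S) (insert i (insert j X))"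
    "wsep (F S) (insert j (insert k X))"
    using eq[of "insert i X"] eq[of "insert k X"] eq[of "insert i (insert j X)"] eq[of "insert j (insert k X)"] w
      f1[of i] f1[of k] f2[of i j] f2[of j k] o subX by auto
  show "wsep S (insert j X)" if ne: "S \<noteq> insert i (insert k X)"
  proof -
    have "F S \<noteq> insert i (insert k X)" using ne lX kl by (auto simp: F_def)
    then have "wsep (F S) (insert j (insert l X))"
      using flip4_wsep[OF fin(1) fs, of j l i k] d lX o kl W by (simp add: insert_commute)
    then show ?thesis using eq[of "insert j X"] f1[of j] subX by auto
  qed
  show "wsep S (insert i (insert k X))" if ne: "S \<noteq> insert j X"
  proof -
    have "F S \<noteq> insert j (insert l X)"
    proof
      assume a: "F S = insert j (insert l X)"
      then have "card S \<le> h" using lX by (auto simp: F_def split: if_splits)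
      then have "insert l S = insert l (insert j X)" using a by (simp add: insert_commute F_def)
      then have "S = insert j X" using lX kl by (metis insert_ident insert_iff less_irrefl)
      then show False using ne by simp
    qed
    then have "wsep (F S) (insert i (insert k X))"
      using flip4_wsep[OF fin(1) fs, of i k j l] d lX o kl W by (simp add: insert_commute)
    then show ?thesis using eq[of "insert i (insert k X)"] f2[of i k] o subX by auto
  qed
qed

section \<open>Flips of maximum collections\<close>

lemma Delta_finite: "S \<in> Delta n m' m \<Longrightarrow> finite S"
  using finite_subset[of S "{1..n}"] by (simp add: Delta_def)

lemma finite_IS: "m' \<le> m \<Longrightarrow> finite (IS n m' m)"
  by (rule finite_subset[OF IS_Delta finite_Delta])

lemma exchange_maximum:
  assumes m: "m' \<le> m" "m' \<le> n" and C: "maximum_ws_collection n m' m C" and ex: "exchange Y Z C C'"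
    and Z: "Z \<in> Delta n m' m" "\<And>S. S \<in> C \<Longrightarrow> S \<noteq> Y \<Longrightarrow> wsep S Z"
  shows "maximum_ws_collection n m' m C'"
proof -
  have C1: "C \<subseteq> Delta n m' m" "ws_collection C" "card C = card (IS n m' m)" using C maximum_ws_iff[OF m] by auto
  have e: "Y \<in> C" "Z \<notin> C" "C' = insert Z (C - {Y})" using ex by (auto simp: exchange_def)
  have fC: "finite C" using C1(1) finite_Delta finite_subset by blast
  have "C' \<subseteq> Delta n m' m" using e C1 Z by auto
  moreover have "ws_collection C'" unfolding ws_collection_iff
  proof (intro ballI)
    fix S T assume "S \<in> C'" "T \<in> C'"
    then consider "S = Z" "T = Z" | "S = Z" "T \<in> C" "T \<noteq> Y" | "T = Z" "S \<in> C" "S \<noteq> Y" | "S \<in> C" "T \<in> C" using e by blast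
    then show "wsep S T" using Z(2)[of S] Z(2)[of T] wsep_sym[of S T] C1(2) by cases (auto simp: ws_collection_iff)
  qed
  moreover have "card C' = card C"
  proof -
    have "card C > 0" using e fC card_gt_0_iff by blast
    then show ?thesis using e fC by simp
  qed
  ultimately show ?thesis using maximum_ws_iff[OF m] C1(3) by simp
qed

lemma flip3_maximum:
  assumes m: "m' \<le> m" "m' \<le> n" and C: "maximum_ws_collection n m' m C" and f: "flip3 n m' m C C'"
  shows "maximum_ws_collection n m' m C'"
proof -
  obtain X i j k where a: "flip3_applicable n m' m X i j k C"
    and ex: "exchange (X \<union> {j}) (X \<union> {i, k}) C C' \<or> exchange (X \<union> {i, k}) (X \<union> {j}) C C'"
    using f by (auto simp: flip3_def)
  have C1: "C \<subseteq> Delta n m' m" "ws_collection C" using C by (auto simp: maximum_ws_collection_def)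
  have w: "\<And>S T. S \<in> C \<Longrightarrow> T \<in> C \<Longrightarrow> wsep S T" using C1(2) by (simp add: ws_collection_iff)
  have X: "i < j" "j < k" "i \<notin> X" "j \<notin> X" "k \<notin> X" "insert j X \<in> Delta n m' m" "insert i (insert k X) \<in> Delta n m' m"
    "insert i X \<in> C" "insert k X \<in> C" "insert i (insert j X) \<in> C" "insert j (insert k X) \<in> C"
    using a by (auto simp: flip3_applicable_def)
  have fX: "finite X" using Delta_finite[OF X(6)] by simp
  have *: "wsep S (insert j X)" if "S \<in> C" "S \<noteq> insert i (insert k X)" for S
    by (rule flip3_wsep(1)[of X S i j k]) (use that fX X w C1 Delta_finite in auto)
  have **: "wsep S (insert i (insert k X))" if "S \<in> C" "S \<noteq> insert j X" for S
    by (rule flip3_wsep(2)[of X S i j k]) (use that fX X w C1 Delta_finite in auto)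
  from ex show ?thesis
  proof
    assume "exchange (X \<union> {j}) (X \<union> {i, k}) C C'"
    then show ?thesis by (rule exchange_maximum[OF m C]) (use X ** in auto)
  next
    assume "exchange (X \<union> {i, k}) (X \<union> {j}) C C'"
    then show ?thesis by (rule exchange_maximum[OF m C]) (use X * in auto)
  qed
qed

lemma flip4_maximum:
  assumes m: "m' \<le> m" "m' \<le> n" and C: "maximum_ws_collection n m' m C" and f: "flip4 n m' m C C'"
  shows "maximum_ws_collection n m' m C'"
proof -
  obtain X i j k l where a: "flip4_applicable n m' m X i j k l C"
    and ex: "exchange (X \<union> {i, k}) (X \<union> {j, l}) C C' \<or> exchange (X \<union> {j, l}) (X \<union> {i, k}) C C'"
    using f by (auto simp: flip4_def)
  have C1: "C \<subseteq> Delta n m' m" "ws_collection C" using C by (auto simp: maximum_ws_collection_def)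
  have w: "\<And>S T. S \<in> C \<Longrightarrow> T \<in> C \<Longrightarrow> wsep S T" using C1(2) by (simp add: ws_collection_iff)
  have X: "i < j" "j < k" "k < l" "i \<notin> X" "j \<notin> X" "k \<notin> X" "l \<notin> X"
    "insert j (insert l X) \<in> Delta n m' m" "insert i (insert k X) \<in> Delta n m' m"
    "insert i (insert j X) \<in> C" "insert k (insert l X) \<in> C" "insert i (insert l X) \<in> C" "insert j (insert k X) \<in> C"
    using a by (auto simp: flip4_applicable_def)
  have X': "insert k (insert j X) \<in> C" "insert j (insert i X) \<in> C" "insert l (insert i X) \<in> C" "insert l (insert k X) \<in> C"
    using X by (auto simp: insert_commute)
  have fX: "finite X" using Delta_finite[OF X(8)] by simp
  have *: "wsep S (insert i (insert k X))" if "S \<in> C" "S \<noteq> insert j (insert l X)" for S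
    by (rule flip4_wsep[of X S i k j l]) (use that fX X X' w C1 Delta_finite in auto)
  have **: "wsep S (insert j (insert l X))" if "S \<in> C" "S \<noteq> insert i (insert k X)" for S
    by (rule flip4_wsep[of X S j l i k]) (use that fX X X' w C1 Delta_finite in auto)
  from ex show ?thesis
  proof
    assume "exchange (X \<union> {i, k}) (X \<union> {j, l}) C C'"
    then show ?thesis by (rule exchange_maximum[OF m C]) (use X ** in auto)
  next
    assume "exchange (X \<union> {j, l}) (X \<union> {i, k}) C C'"
    then show ?thesis by (rule exchange_maximum[OF m C]) (use X * in auto)
  qed
qed

lemma lowering_flip3_flip3: "lowering_flip3 n m' m C C' \<Longrightarrow> flip3 n m' m C C'"
  unfolding lowering_flip3_def flip3_def by blast

lemma lowering_flip4_flip4: "lowering_flip4_in_level h n m' m C C' \<Longrightarrow> flip4 n m' m C C'"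
  unfolding lowering_flip4_in_level_def flip4_def by blast

lemma lowering_flip4_rtranclp_maximum:
  assumes "m' \<le> m" "m' \<le> n" "(lowering_flip4_in_level h n m' m)\<^sup>*\<^sup>* C C'" "maximum_ws_collection n m' m C"
  shows "maximum_ws_collection n m' m C'"
  using assms(3)
proof (induction rule: rtranclp_induct)
  case base
  then show ?case by (rule assms(4))
next
  case (step A B)
  then show ?case using flip4_maximum[OF assms(1,2) step.IH lowering_flip4_flip4] by blast
qed

text \<open>The flip is found in the padded collection; as its level satisfies
  \<open>m' < h \<le> m\<close>, its sets avoid the padding. The total size drops, which makes
  repeated flipping terminate.\<close>

lemma exists_lowering_flip3:
  assumes m: "m' \<le> m" "m' \<le> n" and C: "maximum_ws_collection n m' m C"
    and S: "S \<in> C" "m' < card S" "\<not> is_interval S"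
  shows "\<exists>C'. lowering_flip3 n m' m C C' \<and> (\<Sum>T\<in>C'. card T) < (\<Sum>T\<in>C. card T)"
proof -
  let ?D = "C \<union> padding n m' m"
  have M: "maxws n ?D" by (rule maximum_ws_padding[OF m C])
  have C1: "C \<subseteq> Delta n m' m" "ws_collection C" using C by (auto simp: maximum_ws_collection_def)
  have fC: "finite C" using C1(1) finite_Delta finite_subset by blast
  have up: "is_interval T" if "T \<in> ?D" "card T > m" for T
    using that C1(1) m(1) by (auto simp: padding_def Delta_def)
  have SD: "S \<in> ?D" using S by blast
  obtain h where h: "m' < h" "h \<le> m" "lowerable_at ?D h"
    using exists_lowerable[OF M up SD S(3,2)] by blast
  obtain X i j k where X: "i < j" "j < k" "i \<notin> X" "j \<notin> X" "k \<notin> X" "card X + 2 = h"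
    "insert i X \<in> ?D" "insert k X \<in> ?D" "insert i (insert j X) \<in> ?D" "insert j (insert k X) \<in> ?D" "insert i (insert k X) \<in> ?D"
    using h(3) unfolding lowerable_at_def by auto
  have fX: "finite X" using maxws_finite(2)[OF M X(7)] by simp
  have c1: "card (insert a X) = h - 1" if "a \<in> {i, j, k}" for a using that X fX by auto
  have c2: "card (insert a (insert b X)) = h" if "a \<in> {i, j, k}" "b \<in> {i, j, k}" "a \<noteq> b" for a b using that X fX by auto
  have inC: "T \<in> C" if "T \<in> ?D" "m' \<le> card T" "card T \<le> m" for T using that by (auto simp: padding_def)
  have XC: "insert i X \<in> C" "insert k X \<in> C" "insert i (insert j X) \<in> C" "insert j (insert k X) \<in> C" "insert i (insert k X) \<in> C"
    by (rule inC, use X(1,2,7-11) c1[of i] c1[of k] c2[of i j] c2[of j k] c2[of i k] h(1,2) in simp_all)+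
  have sub: "insert i (insert j (insert k X)) \<subseteq> {1..n}" using XC(3,4) C1 by (auto simp: Delta_def)
  have jD: "insert j X \<in> Delta n m' m" using c1[of j] h sub by (auto simp: Delta_def)
  have notin: "insert j X \<notin> C"
  proof
    assume "insert j X \<in> C"
    then have "wsep (insert j X) (insert i (insert k X))" using C1(2) XC by (simp add: ws_collection_iff)
    moreover have "encloses (insert i (insert k X)) (insert j X)" using X by (intro enclosesI[of i _ _ k j]) auto
    ultimately show False using wsep_card_less c1[of j] c2[of i k] X(1,2) h by fastforce
  qed
  let ?C' = "insert (insert j X) (C - {insert i (insert k X)})"
  have "flip3_applicable n m' m X i j k C"
    unfolding flip3_applicable_def using X(1-5) XC C1(1) jD sub by auto
  moreover have "exchange (insert i (insert k X)) (insert j X) C ?C'" using XC notin by (simp add: exchange_def)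
  ultimately have "lowering_flip3 n m' m C ?C'"
    unfolding lowering_flip3_def by (intro exI[of _ X] exI[of _ i] exI[of _ j] exI[of _ k]) simp
  moreover have "(\<Sum>T\<in>?C'. card T) < (\<Sum>T\<in>C. card T)"
  proof -
    have "(\<Sum>T\<in>C. card T) = card (insert i (insert k X)) + (\<Sum>T\<in>C - {insert i (insert k X)}. card T)"
      using XC(5) fC by (rule_tac sum.remove) auto
    moreover have "(\<Sum>T\<in>?C'. card T) = card (insert j X) + (\<Sum>T\<in>C - {insert i (insert k X)}. card T)"
      using notin fC by (subst sum.insert) auto
    moreover have "card (insert j X) < card (insert i (insert k X))" using c1[of j] c2[of i k] X(1,2) h by simp
    ultimately show ?thesis by simp
  qed
  ultimately show ?thesis by blast
qed

lemma lower_to_intervals: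
  assumes m: "m' \<le> m" "m' \<le> n" and C: "maximum_ws_collection n m' m C"
  shows "\<exists>C'. (lowering_flip3 n m' m)\<^sup>*\<^sup>* C C' \<and> maximum_ws_collection n m' m C' \<and> (\<forall>S\<in>C'. m' < card S \<longrightarrow> is_interval S)"
  using C
proof (induction "\<Sum>T\<in>C. card T" arbitrary: C rule: less_induct)
  case less
  show ?case
  proof (cases "\<forall>S\<in>C. m' < card S \<longrightarrow> is_interval S")
    case True
    then show ?thesis using less.prems by blast
  next
    case False
    then obtain C1 where C1: "lowering_flip3 n m' m C C1" "(\<Sum>T\<in>C1. card T) < (\<Sum>T\<in>C. card T)"
      using exists_lowering_flip3[OF m less.prems] by blast
    have "maximum_ws_collection n m' m C1" using flip3_maximum[OF m less.prems lowering_flip3_flip3[OF C1(1)]] .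
    from less.hyps[OF C1(2) this] C1(1) show ?thesis by (meson converse_rtranclp_into_rtranclp)
  qed
qed

text \<open>Above level \<open>m'\<close> there are at most as many members as intervals, so level
  \<open>m'\<close> holds at least as many sets as in the standard collection.\<close>

lemma maximum_lowest_level:
  assumes m: "m' \<le> m" "m' \<le> n" and C: "maximum_ws_collection n m' m C"
    and i: "\<And>S. S \<in> C \<Longrightarrow> m' < card S \<Longrightarrow> is_interval S"
  shows "maximum_ws_collection n m' m' {S \<in> C. card S = m'}"
proof -
  let ?A = "{S \<in> C. card S = m'}" and ?B = "{S \<in> C. m' < card S}"
  let ?I = "{S. S \<subseteq> {1..n} \<and> m' < card S \<and> card S \<le> m \<and> is_interval S}"
  have C1: "C \<subseteq> Delta n m' m" "ws_collection C" "card C = card (IS n m' m)" using C maximum_ws_iff[OF m] by auto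
  have fC: "finite C" using C1(1) finite_Delta finite_subset by blast
  have fI: "finite ?I" by (rule finite_subset[of _ "Pow {1..n}"]) auto
  have IS: "IS n m' m = IS n m' m' \<union> ?I"
  proof (rule set_eqI)
    fix S :: "nat set"
    have "m' \<le> card S \<and> card S \<le> m \<longleftrightarrow> m' \<le> card S \<and> card S \<le> m' \<or> m' < card S \<and> card S \<le> m"
      using m(1) by linarith
    then show "S \<in> IS n m' m \<longleftrightarrow> S \<in> IS n m' m' \<union> ?I" unfolding IS_iff Un_iff mem_Collect_eq by blast
  qed
  have "finite (IS n m' m')" by (simp add: finite_IS)
  moreover have "IS n m' m' \<inter> ?I = {}" using IS_Delta[of m' m' n] by (auto simp: Delta_def)
  ultimately have c: "card (IS n m' m) = card (IS n m' m') + card ?I" unfolding IS using fI by (intro card_Un_disjoint) auto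
  have "C = ?A \<union> ?B" using C1(1) by (auto simp: Delta_def)
  moreover have "card (?A \<union> ?B) = card ?A + card ?B" using fC by (intro card_Un_disjoint) auto
  ultimately have "card C = card ?A + card ?B" by simp
  moreover have "card ?B \<le> card ?I" using fI i C1(1) by (intro card_mono) (auto simp: Delta_def)
  ultimately have ge: "card (IS n m' m') \<le> card ?A" using c C1(3) by simp
  have A: "?A \<subseteq> Delta n m' m'" "ws_collection ?A" using C1 by (auto simp: Delta_def ws_collection_iff)
  then have "card ?A \<le> card (IS n m' m')" using ws_Delta_card_le[of m' m' n ?A] m by simp
  then show ?thesis using maximum_ws_iff[of m' m' n] A ge m by simp
qed

subsection \<open>A single level\<close>

text \<open>Deleting the element 1 and shifting down identifies level \<open>Suc k\<close> over \<open>Suc N\<close> with the levels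
  \<open>k\<close> and \<open>Suc k\<close> over \<open>N\<close>; the lowering 4-flips with \<open>i = 1\<close> become the lowering 3-flips.\<close>

definition add_one :: "nat \<Rightarrow> nat set \<Rightarrow> nat set" where
  "add_one k Y = (if card Y = Suc k then Suc ` Y else insert 1 (Suc ` Y))"

definition del_one :: "nat set \<Rightarrow> nat set" where
  "del_one S = {y. 1 \<le> y \<and> Suc y \<in> S}"

lemma del_add_one: "0 \<notin> Y \<Longrightarrow> del_one (add_one k Y) = Y"
  by (auto simp: del_one_def add_one_def) (metis Suc_le_eq not_gr_zero)+

lemma add_one_inj: "inj_on (add_one k) (Delta N a b)"
  by (rule inj_on_inverseI[of _ del_one], rule del_add_one) (auto simp: Delta_def)

lemma del_one_Delta:
  assumes "S \<in> Delta (Suc N) (Suc k) (Suc k)"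
  shows "del_one S \<in> Delta N k (Suc k)" "add_one k (del_one S) = S" "card (del_one S) = (if 1 \<in> S then k else Suc k)"
proof -
  have S: "S \<subseteq> {1..Suc N}" "card S = Suc k" "finite S" using assms Delta_finite[OF assms] by (auto simp: Delta_def)
  have 1: "Suc ` del_one S = S - {1}"
  proof
    show "S - {1} \<subseteq> Suc ` del_one S"
    proof
      fix x assume x: "x \<in> S - {1}"
      then have "x \<ge> 2" using S(1) by force
      then obtain y where "x = Suc y" "1 \<le> y" by (cases x) auto
      then show "x \<in> Suc ` del_one S" using x by (auto simp: del_one_def)
    qed
  qed (auto simp: del_one_def)
  have "card (del_one S) = card (S - {1})" using 1 card_image[of Suc "del_one S"] by simp
  then show c: "card (del_one S) = (if 1 \<in> S then k else Suc k)" using S by auto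
  have "del_one S \<subseteq> {1..N}" using S(1) by (auto simp: del_one_def)
  then show "del_one S \<in> Delta N k (Suc k)" using c by (auto simp: Delta_def)
  show "add_one k (del_one S) = S" unfolding add_one_def 1 c by (auto split: if_splits)
qed

lemma add_one_Delta:
  assumes "Y \<in> Delta N k (Suc k)"
  shows "add_one k Y \<in> Delta (Suc N) (Suc k) (Suc k)"
proof -
  have Y: "Y \<subseteq> {1..N}" "card Y = k \<or> card Y = Suc k" "finite Y" using assms Delta_finite[OF assms] by (auto simp: Delta_def)
  have n: "1 \<notin> Suc ` Y" using Y(1) by auto
  have c: "card (Suc ` Y) = card Y" by (simp add: card_image)
  have "card (add_one k Y) = Suc k" using Y n c by (auto simp: add_one_def)
  moreover have "add_one k Y \<subseteq> {1..Suc N}" using Y(1) by (auto simp: add_one_def)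
  ultimately show ?thesis by (simp add: Delta_def)
qed

text \<open>If only one of the sets contains 1, it becomes the smaller one. An enclosure of it by
  the other, preceded by 1, would be an alternation in the original sets.\<close>

lemma del_one_wsep:
  assumes S: "S \<in> Delta (Suc N) (Suc k) (Suc k)" and T: "T \<in> Delta (Suc N) (Suc k) (Suc k)" and w: "wsep S T"
  shows "wsep (del_one S) (del_one T)"
proof -
  have pos: "\<And>x. x \<in> S \<union> T \<Longrightarrow> 1 \<le> x" using S T by (auto simp: Delta_def)
  have en: "encloses S T" if "encloses (del_one S) (del_one T)" for S T
  proof -
    obtain a b c where "a \<in> del_one S" "a \<notin> del_one T" "b \<in> del_one S" "b \<notin> del_one T" "c \<in> del_one T" "c \<notin> del_one S" "a < c" "c < b"
      using \<open>encloses (del_one S) (del_one T)\<close> by (rule enclosesE)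
    then show ?thesis by (intro enclosesI[of "Suc a" _ _ "Suc b" "Suc c"]) (auto simp: del_one_def)
  qed
  have mixed: "wsep (del_one S) (del_one T)" if S: "S \<in> Delta (Suc N) (Suc k) (Suc k)" and T: "T \<in> Delta (Suc N) (Suc k) (Suc k)"
    and w: "wsep S T" and o: "1 \<in> S" "1 \<notin> T" for S T
  proof (rule wsep_card_lessI)
    show "card (del_one S) < card (del_one T)" using del_one_Delta(3)[OF S] del_one_Delta(3)[OF T] o by simp
    show "\<not> encloses (del_one T) (del_one S)"
    proof
      assume "encloses (del_one T) (del_one S)"
      then obtain a b c where "a \<in> del_one T" "a \<notin> del_one S" "b \<in> del_one T" "b \<notin> del_one S" "c \<in> del_one S" "c \<notin> del_one T" "a < c" "c < b"
        by (rule enclosesE)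
      then show False using wsep_alternate[OF w, of 1 "Suc a" "Suc c" "Suc b"] o by (auto simp: del_one_def)
    qed
  qed
  consider "1 \<in> S \<longleftrightarrow> 1 \<in> T" | "1 \<in> S" "1 \<notin> T" | "1 \<notin> S" "1 \<in> T" by blast
  then show ?thesis
  proof cases
    case 1
    then have "card (del_one S) = card (del_one T)" using del_one_Delta(3)[OF S] del_one_Delta(3)[OF T] by simp
    then show ?thesis using w en[of S T] en[of T S] by (auto simp: wsep_def)
  next
    case 2
    then show ?thesis using mixed[OF S T w] by blast
  next
    case 3
    then show ?thesis using mixed[OF T S] w wsep_sym by blast
  qed
qed

lemma add_one_IS: "add_one k ` IS N k (Suc k) \<subseteq> IS (Suc N) (Suc k) (Suc k)"
proof (rule image_subsetI)
  fix Y assume Y: "Y \<in> IS N k (Suc k)"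
  have YD: "Y \<in> Delta N k (Suc k)" using Y IS_Delta[of k "Suc k" N] by auto
  have aD: "add_one k Y \<in> Delta (Suc N) (Suc k) (Suc k)" by (rule add_one_Delta[OF YD])
  have Suc_int: "Suc ` {p..q} = {Suc p..Suc q}" for p q by (simp add: image_Suc_atLeastAtMost)
  \<comment> \<open>For \<open>a = p\<close> the two parts merge into one interval.\<close>
  have ses: "{1..a} \<union> {Suc p..Suc q} \<in> IS (Suc N) (Suc k) (Suc k)" if "1 \<le> a" "a \<le> p" "p \<le> q" "q \<le> N"
    "{1..a} \<union> {Suc p..Suc q} = add_one k Y" for a p q
  proof (cases "a = p")
    case True
    then have "{1..a} \<union> {Suc p..Suc q} = {1..Suc q}" using that(2,3) by auto
    then have "is_interval (add_one k Y)" using that(5) unfolding is_interval_def by metis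
    then show ?thesis using that(5) aD by (simp add: IS_iff Delta_def)
  next
    case False
    have "add_one k Y \<in> sesqui_intervals (Suc N) (Suc k)" unfolding sesqui_intervals_def
      using aD that False by (intro CollectI conjI exI[of _ a] exI[of _ "Suc p"] exI[of _ "Suc q"]) (auto simp: Delta_def)
    then show ?thesis using that(5) by (simp add: IS_iff)
  qed
  show "add_one k Y \<in> IS (Suc N) (Suc k) (Suc k)"
  proof (cases "Y \<in> sesqui_intervals N k")
    case True
    then obtain p q r where pqr: "1 \<le> p" "p + 1 < q" "q \<le> r" "r \<le> N" "Y = {1..p} \<union> {q..r}" "card Y = k" by (rule sesqui_intervalsE)
    have "add_one k Y = insert 1 (Suc ` ({1..p} \<union> {q..r}))" using pqr by (simp add: add_one_def)
    also have "\<dots> = {1..Suc p} \<union> {Suc q..Suc r}" unfolding image_Un Suc_int by auto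
    finally have "{1..Suc p} \<union> {Suc q..Suc r} = add_one k Y" by simp
    from ses[OF _ _ _ _ this] show ?thesis using \<open>{1..Suc p} \<union> {Suc q..Suc r} = add_one k Y\<close> pqr by auto
  next
    case False
    then have "is_interval Y" using Y by (simp add: IS_iff)
    then obtain p q where Ypq: "Y = {p..q}" by (auto simp: is_interval_def)
    show ?thesis
    proof (cases "card Y = Suc k")
      case True
      then have "add_one k Y = {Suc p..Suc q}" using Ypq Suc_int by (simp add: add_one_def)
      then have "is_interval (add_one k Y)" unfolding is_interval_def by blast
      then show ?thesis using aD by (simp add: IS_iff Delta_def)
    next
      case c: False
      then have e: "add_one k Y = insert 1 (Suc ` Y)" by (simp add: add_one_def)
      show ?thesis
      proof (cases "Y = {}")
        case True
        then have "add_one k Y = {1..1}" using e by simp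
        then have "is_interval (add_one k Y)" unfolding is_interval_def by blast
        then show ?thesis using aD by (simp add: IS_iff Delta_def)
      next
        case False
        then have pq: "p \<le> q" using Ypq by auto
        then have b: "1 \<le> p" "q \<le> N" using YD Ypq by (auto simp: Delta_def)
        have eq: "{1..1} \<union> {Suc p..Suc q} = add_one k Y" using e Ypq Suc_int by simp
        then show ?thesis using ses[of 1 p q] b pq by simp
      qed
    qed
  qed
qed

lemma exchange_image:
  assumes "exchange Y Z A B" "inj_on f (insert Z A)"
  shows "exchange (f Y) (f Z) (f ` A) (f ` B)"
proof -
  have e: "Y \<in> A" "Z \<notin> A" "B = insert Z (A - {Y})" using assms(1) by (auto simp: exchange_def)
  have "f Z \<notin> f ` A" using e assms(2) by (auto simp: inj_on_def)
  moreover have "f ` (A - {Y}) = f ` A - {f Y}" using assms(2) e by (auto simp: inj_on_def)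
  ultimately show ?thesis using e by (auto simp: exchange_def)
qed

lemma exchange_Un: "exchange Y Z A B \<Longrightarrow> Y \<notin> R \<Longrightarrow> Z \<notin> R \<Longrightarrow> exchange Y Z (A \<union> R) (B \<union> R)"
  by (auto simp: exchange_def)

lemma add_one_flip3:
  assumes A: "A \<subseteq> Delta N k (Suc k)" and f: "lowering_flip3 N k (Suc k) A B"
  shows "B \<subseteq> Delta N k (Suc k)"
    "lowering_flip4_in_level (Suc k) (Suc N) (Suc k) (Suc k) (add_one k ` A) (add_one k ` B)"
proof -
  let ?D = "Delta N k (Suc k)"
  obtain X i j l where a: "flip3_applicable N k (Suc k) X i j l A" and ex: "exchange (X \<union> {i, l}) (X \<union> {j}) A B"
    using f by (auto simp: lowering_flip3_def)
  have X: "i < j" "j < l" "X \<subseteq> {1..N}" "i \<notin> X" "j \<notin> X" "l \<notin> X"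
    "{X \<union> {i}, X \<union> {j}, X \<union> {l}, X \<union> {i, j}, X \<union> {i, l}, X \<union> {j, l}} \<subseteq> ?D"
    "{X \<union> {i}, X \<union> {l}, X \<union> {i, j}, X \<union> {j, l}} \<subseteq> A"
    using a by (auto simp: flip3_applicable_def)
  have fX: "finite X" using X(3) finite_subset by blast
  have "k \<le> card (X \<union> {i})" "card (X \<union> {i, j}) \<le> Suc k" using X(7) by (auto simp: Delta_def)
  then have cX: "Suc (card X) = k" using X(1,4,5) fX by simp
  have i1: "1 \<le> i" using X(7) by (auto simp: Delta_def)
  have s1: "add_one k (X \<union> {a}) = Suc ` X \<union> {1, Suc a}" if "a \<in> {i, j, l}" for a
    using that X(4-6) fX cX by (auto simp: add_one_def)
  have s2: "add_one k (X \<union> {a, b}) = Suc ` X \<union> {Suc a, Suc b}" if "a \<in> {i, j, l}" "b \<in> {i, j, l}" "a \<noteq> b" for a b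
  proof -
    have "card (X \<union> {a, b}) = Suc k" using that X(4-6) fX cX by auto
    then show ?thesis by (auto simp: add_one_def)
  qed
  have ss: "add_one k (X \<union> {i}) = Suc ` X \<union> {1, Suc i}" "add_one k (X \<union> {j}) = Suc ` X \<union> {1, Suc j}"
    "add_one k (X \<union> {l}) = Suc ` X \<union> {1, Suc l}" "add_one k (X \<union> {i, j}) = Suc ` X \<union> {Suc i, Suc j}"
    "add_one k (X \<union> {i, l}) = Suc ` X \<union> {Suc i, Suc l}" "add_one k (X \<union> {j, l}) = Suc ` X \<union> {Suc j, Suc l}"
    using s1 s2 X(1,2) by auto
  show "B \<subseteq> ?D" using ex A X(7) by (auto simp: exchange_def)
  have jD: "X \<union> {j} \<in> ?D" using X(7) by simp
  have "exchange (add_one k (X \<union> {i, l})) (add_one k (X \<union> {j})) (add_one k ` A) (add_one k ` B)"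
    by (rule exchange_image[OF ex]) (rule inj_on_subset[OF add_one_inj], use A jD in blast)
  then have ex4: "exchange (Suc ` X \<union> {Suc i, Suc l}) (Suc ` X \<union> {1, Suc j}) (add_one k ` A) (add_one k ` B)"
    by (simp only: ss)
  have DD: "add_one k ` {X \<union> {i}, X \<union> {j}, X \<union> {l}, X \<union> {i, j}, X \<union> {i, l}, X \<union> {j, l}} \<subseteq> Delta (Suc N) (Suc k) (Suc k)"
    by (rule image_subsetI, rule add_one_Delta, rule subsetD[OF X(7)])
  have AA: "add_one k ` {X \<union> {i}, X \<union> {l}, X \<union> {i, j}, X \<union> {j, l}} \<subseteq> add_one k ` A" using X(8) by blast
  have DD': "{Suc ` X \<union> {1, Suc i}, Suc ` X \<union> {1, Suc j}, Suc ` X \<union> {1, Suc l}, Suc ` X \<union> {Suc i, Suc j}, Suc ` X \<union> {Suc i, Suc l}, Suc ` X \<union> {Suc j, Suc l}} \<subseteq> Delta (Suc N) (Suc k) (Suc k)"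
    using DD by (simp only: image_insert image_empty ss)
  have AA': "{Suc ` X \<union> {1, Suc i}, Suc ` X \<union> {Suc j, Suc l}, Suc ` X \<union> {1, Suc l}, Suc ` X \<union> {Suc i, Suc j}} \<subseteq> add_one k ` A"
    using AA unfolding image_insert image_empty ss by blast
  have sX: "Suc ` X \<subseteq> {1..Suc N} - {1, Suc i, Suc j, Suc l}" using X(3-6) by auto
  have lt: "1 < Suc i" "Suc i < Suc j" "Suc j < Suc l" using X(1,2) i1 by auto
  have "flip4_applicable (Suc N) (Suc k) (Suc k) (Suc ` X) 1 (Suc i) (Suc j) (Suc l) (add_one k ` A)"
    unfolding flip4_applicable_def using lt sX DD' AA' by (intro conjI)
  moreover have "card (Suc ` X) + 2 = Suc k" using cX by (simp add: card_image)
  ultimately show "lowering_flip4_in_level (Suc k) (Suc N) (Suc k) (Suc k) (add_one k ` A) (add_one k ` B)"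
    unfolding lowering_flip4_in_level_def using ex4
    by (intro exI[of _ "Suc ` X"] exI[of _ 1] exI[of _ "Suc i"] exI[of _ "Suc j"] exI[of _ "Suc l"] conjI)
qed

text \<open>A flip in the lower level \<open>k\<close> lifts with 1 in the common part, while the
  sets of \<open>R\<close> lift to sets without 1 and are carried along.\<close>

lemma add_one_flip4:
  assumes A: "A \<subseteq> Delta N k k" and R: "R \<subseteq> Delta N (Suc k) (Suc k)" and f: "lowering_flip4_in_level k N k k A B"
  shows "B \<subseteq> Delta N k k"
    "lowering_flip4_in_level (Suc k) (Suc N) (Suc k) (Suc k) (add_one k ` (A \<union> R)) (add_one k ` (B \<union> R))"
proof -
  let ?D = "Delta N k k"
  obtain X i j h l where a: "flip4_applicable N k k X i j h l A" and cX: "card X + 2 = k"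
    and ex: "exchange (X \<union> {j, l}) (X \<union> {i, h}) A B"
    using f by (auto simp: lowering_flip4_in_level_def)
  have X: "i < j" "j < h" "h < l" "X \<subseteq> {1..N}" "i \<notin> X" "j \<notin> X" "h \<notin> X" "l \<notin> X"
    "{X \<union> {i, j}, X \<union> {i, h}, X \<union> {i, l}, X \<union> {j, h}, X \<union> {j, l}, X \<union> {h, l}} \<subseteq> ?D"
    "{X \<union> {i, j}, X \<union> {h, l}, X \<union> {i, l}, X \<union> {j, h}} \<subseteq> A"
    using a by (auto simp: flip4_applicable_def)
  have fX: "finite X" using X(4) finite_subset by blast
  have i1: "1 \<le> i" using X(9) by (auto simp: Delta_def)
  let ?X = "insert 1 (Suc ` X)"
  have s2: "add_one k (X \<union> {a, b}) = ?X \<union> {Suc a, Suc b}" if "X \<union> {a, b} \<in> ?D" for a b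
    using that by (auto simp: add_one_def Delta_def)
  have ss: "add_one k (X \<union> {i, j}) = ?X \<union> {Suc i, Suc j}" "add_one k (X \<union> {i, h}) = ?X \<union> {Suc i, Suc h}"
    "add_one k (X \<union> {i, l}) = ?X \<union> {Suc i, Suc l}" "add_one k (X \<union> {j, h}) = ?X \<union> {Suc j, Suc h}"
    "add_one k (X \<union> {j, l}) = ?X \<union> {Suc j, Suc l}" "add_one k (X \<union> {h, l}) = ?X \<union> {Suc h, Suc l}"
    using s2 X(9) by simp_all
  show "B \<subseteq> ?D" using ex A X(9) by (auto simp: exchange_def)
  have kD: "Delta N k k \<subseteq> Delta N k (Suc k)" "Delta N (Suc k) (Suc k) \<subseteq> Delta N k (Suc k)" by (auto simp: Delta_def)
  have disj: "Delta N k k \<inter> Delta N (Suc k) (Suc k) = {}" by (auto simp: Delta_def)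
  have jl: "X \<union> {j, l} \<in> ?D" and ih: "X \<union> {i, h} \<in> ?D" using X(9) by simp_all
  have "exchange (X \<union> {j, l}) (X \<union> {i, h}) (A \<union> R) (B \<union> R)"
    by (rule exchange_Un[OF ex]) (use jl ih R disj in blast)+
  then have "exchange (add_one k (X \<union> {j, l})) (add_one k (X \<union> {i, h})) (add_one k ` (A \<union> R)) (add_one k ` (B \<union> R))"
    by (rule exchange_image) (rule inj_on_subset[OF add_one_inj], use A R kD ih in blast)
  then have ex4: "exchange (?X \<union> {Suc j, Suc l}) (?X \<union> {Suc i, Suc h}) (add_one k ` (A \<union> R)) (add_one k ` (B \<union> R))"
    by (simp only: ss)
  have DD: "add_one k ` {X \<union> {i, j}, X \<union> {i, h}, X \<union> {i, l}, X \<union> {j, h}, X \<union> {j, l}, X \<union> {h, l}} \<subseteq> Delta (Suc N) (Suc k) (Suc k)"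
    by (rule image_subsetI, rule add_one_Delta, rule subsetD[OF kD(1)], rule subsetD[OF X(9)])
  have DD': "{?X \<union> {Suc i, Suc j}, ?X \<union> {Suc i, Suc h}, ?X \<union> {Suc i, Suc l}, ?X \<union> {Suc j, Suc h}, ?X \<union> {Suc j, Suc l}, ?X \<union> {Suc h, Suc l}} \<subseteq> Delta (Suc N) (Suc k) (Suc k)"
    using DD by (simp only: image_insert image_empty ss)
  have AA: "add_one k ` {X \<union> {i, j}, X \<union> {h, l}, X \<union> {i, l}, X \<union> {j, h}} \<subseteq> add_one k ` (A \<union> R)" using X(10) by blast
  have AA': "{?X \<union> {Suc i, Suc j}, ?X \<union> {Suc h, Suc l}, ?X \<union> {Suc i, Suc l}, ?X \<union> {Suc j, Suc h}} \<subseteq> add_one k ` (A \<union> R)"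
    using AA by (simp only: image_insert image_empty ss)
  have sX: "?X \<subseteq> {1..Suc N} - {Suc i, Suc j, Suc h, Suc l}" using X(1-8) i1 by auto
  have "Suc i < Suc j" "Suc j < Suc h" "Suc h < Suc l" using X(1-3) by auto
  then have "flip4_applicable (Suc N) (Suc k) (Suc k) ?X (Suc i) (Suc j) (Suc h) (Suc l) (add_one k ` (A \<union> R))"
    unfolding flip4_applicable_def using sX DD' AA' by (intro conjI)
  moreover have "card ?X + 2 = Suc k"
  proof -
    have "1 \<notin> Suc ` X" using X(4) by auto
    then show ?thesis using cX fX by (simp add: card_image)
  qed
  ultimately show "lowering_flip4_in_level (Suc k) (Suc N) (Suc k) (Suc k) (add_one k ` (A \<union> R)) (add_one k ` (B \<union> R))"
    unfolding lowering_flip4_in_level_def using ex4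
    by (intro exI[of _ ?X] exI[of _ "Suc i"] exI[of _ "Suc j"] exI[of _ "Suc h"] exI[of _ "Suc l"] conjI)
qed

text \<open>Lowering 3-flips between the two levels over \<open>N\<close> turn the upper level into
  intervals. What remains is the single level \<open>k\<close> over \<open>N\<close>, where the
  induction hypothesis applies; both kinds of flips lift to lowering 4-flips in level
  \<open>Suc k\<close>.\<close>

lemma level_lower_to_IS:
  assumes "k \<le> n" "maximum_ws_collection n k k C"
  shows "(lowering_flip4_in_level k n k k)\<^sup>*\<^sup>* C (IS n k k)"
  using assms
proof (induction k arbitrary: n C)
  case 0
  have D: "Delta n 0 0 = {{}}"
  proof -
    have "S = {}" if "S \<in> Delta n 0 0" for S using that Delta_finite[OF that] by (auto simp: Delta_def)
    moreover have "{} \<in> Delta n 0 0" by (simp add: Delta_def)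
    ultimately show ?thesis by blast
  qed
  have C: "C \<subseteq> {{}}" "card C = card (IS n 0 0)" using 0 maximum_ws_iff[of 0 0 n C] D by auto
  have I: "IS n 0 0 \<subseteq> {{}}" using IS_Delta[of 0 0 n] D by simp
  have "C = IS n 0 0"
  proof -
    have "A = {} \<or> A = {{}}" if "A \<subseteq> {{}::nat set}" for A using that by blast
    then show ?thesis using C I by (metis card.empty card_1_singleton_iff One_nat_def n_not_Suc_n card_insert_disjoint equals0D finite.emptyI zero_neq_one)
  qed
  then show ?case by simp
next
  case (Suc k)
  obtain N where n: "n = Suc N" using Suc.prems by (cases n) auto
  have kN: "k \<le> N" using Suc.prems n by simp
  let ?f = "lowering_flip4_in_level (Suc k) (Suc N) (Suc k) (Suc k)"
  have kk: "Suc k \<le> Suc k" "Suc k \<le> Suc N" "k \<le> Suc k" using kN by auto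
  have C: "C \<subseteq> Delta (Suc N) (Suc k) (Suc k)" "ws_collection C" "card C = card (IS (Suc N) (Suc k) (Suc k))"
    using Suc.prems n maximum_ws_iff[OF kk(1,2)] by auto
  define D where "D = del_one ` C"
  have DC: "add_one k ` D = C"
  proof -
    have "add_one k ` D = (\<lambda>S. add_one k (del_one S)) ` C" by (simp add: D_def image_image)
    also have "\<dots> = (\<lambda>S. S) ` C" by (rule image_cong) (use del_one_Delta(2) C(1) in auto)
    finally show ?thesis by simp
  qed
  have DD: "D \<subseteq> Delta N k (Suc k)" using del_one_Delta(1) C(1) by (auto simp: D_def)
  have "ws_collection D" unfolding ws_collection_iff
  proof (intro ballI)
    fix X Y assume "X \<in> D" "Y \<in> D"
    then obtain S T where ST: "S \<in> C" "T \<in> C" "X = del_one S" "Y = del_one T" by (auto simp: D_def)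
    moreover have "wsep S T" using C(2) ST by (simp add: ws_collection_iff)
    ultimately show "wsep X Y" using del_one_wsep[of S N k T] C(1) by blast
  qed
  \<comment> \<open>\<open>D\<close> is at most as large as \<open>IS N k (Suc k)\<close>, which
    embeds by \<open>add_one\<close> into a collection of the size of \<open>C\<close>, hence of the
    size of \<open>D\<close>.\<close>
  moreover have "card D = card (IS N k (Suc k))"
  proof -
    have "card C = card D" using card_image[OF inj_on_subset[OF add_one_inj DD]] DC by metis
    moreover have "card D \<le> card (IS N k (Suc k))" by (rule ws_Delta_card_le) (use kN DD calculation \<open>ws_collection D\<close> in auto)
    moreover have "card (IS N k (Suc k)) \<le> card (IS (Suc N) (Suc k) (Suc k))"
    proof -
      have "finite (IS (Suc N) (Suc k) (Suc k))" by (simp add: finite_IS)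
      then have "card (add_one k ` IS N k (Suc k)) \<le> card (IS (Suc N) (Suc k) (Suc k))"
        by (rule card_mono[OF _ add_one_IS])
      moreover have "card (add_one k ` IS N k (Suc k)) = card (IS N k (Suc k))"
        by (rule card_image[OF inj_on_subset[OF add_one_inj IS_Delta]]) simp
      ultimately show ?thesis by simp
    qed
    ultimately show ?thesis using C(3) by simp
  qed
  ultimately have "maximum_ws_collection N k (Suc k) D" using DD maximum_ws_iff[OF kk(3) kN] by simp
  then obtain D' where D': "(lowering_flip3 N k (Suc k))\<^sup>*\<^sup>* D D'" "maximum_ws_collection N k (Suc k) D'"
    "\<And>S. S \<in> D' \<Longrightarrow> k < card S \<Longrightarrow> is_interval S"
    using lower_to_intervals[OF kk(3) kN] by blast
  have "D' \<subseteq> Delta N k (Suc k) \<and> ?f\<^sup>*\<^sup>* (add_one k ` D) (add_one k ` D')"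
    using D'(1)
  proof (induction rule: rtranclp_induct)
    case base
    then show ?case using DD by simp
  next
    case (step A B)
    then show ?case using add_one_flip3[of A N k B] by (meson rtranclp.rtrancl_into_rtrancl)
  qed
  then have D'D: "D' \<subseteq> Delta N k (Suc k)" and r1: "?f\<^sup>*\<^sup>* C (add_one k ` D')" using DC by auto
  let ?A = "{S \<in> D'. card S = k}" and ?R = "{S \<in> D'. card S = Suc k}"
  have AR: "D' = ?A \<union> ?R" using D'D by (auto simp: Delta_def)
  have RD: "?R \<subseteq> Delta N (Suc k) (Suc k)" using D'D by (auto simp: Delta_def)
  have maxA: "maximum_ws_collection N k k ?A" by (rule maximum_lowest_level[OF kk(3) kN D'(2,3)])
  have "(lowering_flip4_in_level k N k k)\<^sup>*\<^sup>* ?A (IS N k k)" by (rule Suc.IH[OF kN maxA])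
  then have "IS N k k \<subseteq> Delta N k k \<and> ?f\<^sup>*\<^sup>* (add_one k ` (?A \<union> ?R)) (add_one k ` (IS N k k \<union> ?R))"
  proof (induction rule: rtranclp_induct)
    case base
    then show ?case using D'D by (auto simp: Delta_def)
  next
    case (step A B)
    then show ?case using add_one_flip4[OF _ RD step.hyps(2)] by (meson rtranclp.rtrancl_into_rtrancl)
  qed
  then have r: "?f\<^sup>*\<^sup>* C (add_one k ` (IS N k k \<union> ?R))" using r1 AR by (metis (no_types, lifting) rtranclp_trans)
  let ?E = "add_one k ` (IS N k k \<union> ?R)"
  \<comment> \<open>Flips keep the collection maximum, so inclusion in the standard collection
    becomes equality by counting.\<close>
  have "maximum_ws_collection (Suc N) (Suc k) (Suc k) ?E"
    by (rule lowering_flip4_rtranclp_maximum[OF kk(1,2) r]) (use Suc.prems n in simp)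
  then have "card ?E = card (IS (Suc N) (Suc k) (Suc k))" using maximum_ws_iff[OF kk(1,2)] by simp
  moreover have "?E \<subseteq> IS (Suc N) (Suc k) (Suc k)"
  proof -
    have "IS N k k \<union> ?R \<subseteq> IS N k (Suc k)" using D'(3) D'D by (auto simp: IS_iff Delta_def)
    then show ?thesis using add_one_IS by blast
  qed
  moreover have "finite (IS (Suc N) (Suc k) (Suc k))" by (simp add: finite_IS)
  ultimately have "?E = IS (Suc N) (Suc k) (Suc k)" by (metis card_subset_eq)
  then show ?case using r n by simp
qed

lemma flip4_applicable_mono:
  assumes "flip4_applicable n a b X i j k l A" "Delta n a b \<subseteq> Delta n a' b'" "A \<subseteq> A'"
  shows "flip4_applicable n a' b' X i j k l A'"
  using assms unfolding flip4_applicable_def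
  by (elim conjE, intro conjI) (assumption | erule subset_trans, assumption)+

text \<open>Flips inside level \<open>m'\<close> do not touch the higher sets \<open>?R\<close>, so
  the single-level result applies with \<open>?R\<close> carried along.\<close>

lemma lower_to_IS:
  assumes m: "m' \<le> m" "m' \<le> n" and C: "maximum_ws_collection n m' m C"
  shows "\<exists>C'. (lowering_flip3 n m' m)\<^sup>*\<^sup>* C C' \<and> (lowering_flip4_in_level m' n m' m)\<^sup>*\<^sup>* C' (IS n m' m)"
proof -
  obtain C' where C': "(lowering_flip3 n m' m)\<^sup>*\<^sup>* C C'" "maximum_ws_collection n m' m C'"
    "\<And>S. S \<in> C' \<Longrightarrow> m' < card S \<Longrightarrow> is_interval S"
    using lower_to_intervals[OF m C] by blast
  let ?A = "{S \<in> C'. card S = m'}" and ?R = "{S \<in> C'. m' < card S}"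
  have C'D: "C' \<subseteq> Delta n m' m" using C'(2) by (simp add: maximum_ws_collection_def)
  have AR: "C' = ?A \<union> ?R" using C'D by (auto simp: Delta_def)
  have "(lowering_flip4_in_level m' n m' m')\<^sup>*\<^sup>* ?A (IS n m' m')"
    by (rule level_lower_to_IS[OF m(2) maximum_lowest_level[OF m C'(2,3)]])
  then have "(lowering_flip4_in_level m' n m' m)\<^sup>*\<^sup>* (?A \<union> ?R) (IS n m' m' \<union> ?R)"
  proof (induction rule: rtranclp_induct)
    case base
    then show ?case by simp
  next
    case (step A B)
    obtain X i j h l where a: "flip4_applicable n m' m' X i j h l A" "card X + 2 = m'" "exchange (X \<union> {j, l}) (X \<union> {i, h}) A B"
      using step.hyps(2) unfolding lowering_flip4_in_level_def by blast
    have D: "Delta n m' m' \<subseteq> Delta n m' m" using m by (auto simp: Delta_def)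
    have "flip4_applicable n m' m X i j h l (A \<union> ?R)"
      by (rule flip4_applicable_mono[OF a(1) D]) simp
    moreover have "X \<union> {j, l} \<in> Delta n m' m'" "X \<union> {i, h} \<in> Delta n m' m'"
      using a(1) unfolding flip4_applicable_def by simp_all
    then have "X \<union> {j, l} \<notin> ?R" "X \<union> {i, h} \<notin> ?R" by (simp_all add: Delta_def)
    then have "exchange (X \<union> {j, l}) (X \<union> {i, h}) (A \<union> ?R) (B \<union> ?R)"
      by (intro exchange_Un[OF a(3)])
    ultimately have "lowering_flip4_in_level m' n m' m (A \<union> ?R) (B \<union> ?R)"
      unfolding lowering_flip4_in_level_def using a(2) by blast
    then show ?case using step.IH by (rule_tac rtranclp.rtrancl_into_rtrancl)
  qed
  then have r: "(lowering_flip4_in_level m' n m' m)\<^sup>*\<^sup>* C' (IS n m' m' \<union> ?R)" using AR by simp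
  let ?E = "IS n m' m' \<union> ?R"
  have "maximum_ws_collection n m' m ?E" by (rule lowering_flip4_rtranclp_maximum[OF m r C'(2)])
  then have "card ?E = card (IS n m' m)" using maximum_ws_iff[OF m] by simp
  moreover have "?E \<subseteq> IS n m' m" using C'(3) C'D m by (auto simp: IS_iff Delta_def)
  moreover have "finite (IS n m' m)" by (simp add: finite_IS m)
  ultimately have "?E = IS n m' m" by (metis card_subset_eq)
  then show ?thesis using r C'(1) by auto
qed

subsection \<open>Flips and TP-bases\<close>

lemma TP_functions_3:
  assumes "f \<in> TP_functions n m' m" "i < j" "j < k" "X \<subseteq> {1..n} - {i, j, k}"
    "{X \<union> {i}, X \<union> {j}, X \<union> {k}, X \<union> {i, j}, X \<union> {i, k}, X \<union> {j, k}} \<subseteq> Delta n m' m"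
  shows "f (X \<union> {i, k}) + f (X \<union> {j}) = max (f (X \<union> {i, j}) + f (X \<union> {k})) (f (X \<union> {i}) + f (X \<union> {j, k}))"
  by (rule assms(1)[unfolded TP_functions_def mem_Collect_eq, THEN conjunct2, THEN conjunct1,
      THEN spec[of _ X], THEN spec[of _ i], THEN spec[of _ j], THEN spec[of _ k], THEN mp]) (intro conjI assms(2-))

lemma TP_functions_4:
  assumes "f \<in> TP_functions n m' m" "i < j" "j < k" "k < l" "X \<subseteq> {1..n} - {i, j, k, l}"
    "{X \<union> {i, j}, X \<union> {i, k}, X \<union> {i, l}, X \<union> {j, k}, X \<union> {j, l}, X \<union> {k, l}} \<subseteq> Delta n m' m"
  shows "f (X \<union> {i, k}) + f (X \<union> {j, l}) = max (f (X \<union> {i, j}) + f (X \<union> {k, l})) (f (X \<union> {i, l}) + f (X \<union> {j, k}))"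
  by (rule assms(1)[unfolded TP_functions_def mem_Collect_eq, THEN conjunct2, THEN conjunct2,
      THEN spec[of _ X], THEN spec[of _ i], THEN spec[of _ j], THEN spec[of _ k], THEN spec[of _ l], THEN mp]) (intro conjI assms(2-))

text \<open>The sum of the values at \<open>Y\<close> and \<open>Z\<close> is a function of four
  values in the common part, so either one determines the other.\<close>

lemma TP_basis_exchange:
  assumes B: "TP_basis n m' m B" and ex: "exchange Y Z B B'" and Z: "Z \<in> Delta n m' m"
    and abcd: "{a, b, c, d} \<subseteq> B - {Y}"
    and rel: "\<And>f. f \<in> TP_functions n m' m \<Longrightarrow> f Y + f Z = max (f a + f b) (f c + f d)"
  shows "TP_basis n m' m B'"
proof -
  let ?TP = "TP_functions n m' m"
  have e: "Y \<in> B" "Z \<notin> B" "B' = insert Z (B - {Y})" using ex by (auto simp: exchange_def)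
  have BD: "B \<subseteq> Delta n m' m" and inj: "inj_on (\<lambda>f. restrict f B) ?TP" and im: "(\<lambda>f. restrict f B) ` ?TP = extensional B"
    using B by (auto simp: TP_basis_def bij_betw_def)
  have in': "a \<in> B'" "b \<in> B'" "c \<in> B'" "d \<in> B'" "Z \<in> B'" using abcd e by auto
  have "inj_on (\<lambda>f. restrict f B') ?TP"
  proof (rule inj_onI)
    fix f g assume fg: "f \<in> ?TP" "g \<in> ?TP" "restrict f B' = restrict g B'"
    have eq: "f x = g x" if "x \<in> B'" for x using fg(3) that by (metis restrict_apply')
    have "f Y = g Y" using rel[OF fg(1)] rel[OF fg(2)] eq[OF in'(1)] eq[OF in'(2)] eq[OF in'(3)] eq[OF in'(4)] eq[OF in'(5)] by simp
    then have "f x = g x" if "x \<in> B" for x using eq[of x] that e by (cases "x = Y") auto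
    then have "restrict f B = restrict g B" by (auto simp: restrict_def)
    then show "f = g" using inj fg by (auto dest: inj_onD)
  qed
  moreover have "(\<lambda>f. restrict f B') ` ?TP = extensional B'"
  proof
    show "extensional B' \<subseteq> (\<lambda>f. restrict f B') ` ?TP"
    proof
      fix \<phi> :: "nat set \<Rightarrow> real" assume p: "\<phi> \<in> extensional B'"
      \<comment> \<open>The value at \<open>Y\<close> is the one that the relation forces once
        \<open>Z\<close> gets its prescribed value.\<close>
      define \<psi> where "\<psi> = restrict (\<phi>(Y := max (\<phi> a + \<phi> b) (\<phi> c + \<phi> d) - \<phi> Z)) B"
      have "\<psi> \<in> extensional B" by (simp add: \<psi>_def)
      then obtain f where f: "f \<in> ?TP" "restrict f B = \<psi>" using im by (metis imageE)
      have fx: "f x = \<phi> x" if "x \<in> B" "x \<noteq> Y" for x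
        using fun_cong[OF f(2), of x] that by (simp add: \<psi>_def)
      have fY: "f Y = max (\<phi> a + \<phi> b) (\<phi> c + \<phi> d) - \<phi> Z"
        using fun_cong[OF f(2), of Y] e by (simp add: \<psi>_def)
      have "f a = \<phi> a" "f b = \<phi> b" "f c = \<phi> c" "f d = \<phi> d" using fx abcd by auto
      then have fZ: "f Z = \<phi> Z" using rel[OF f(1)] fY by simp
      have "restrict f B' = \<phi>"
      proof
        fix x show "restrict f B' x = \<phi> x"
          using fx[of x] fZ e p by (cases "x \<in> B'") (auto simp: extensional_def)
      qed
      then show "\<phi> \<in> (\<lambda>f. restrict f B') ` ?TP" using f(1) by blast
    qed
  qed auto
  moreover have "B' \<subseteq> Delta n m' m" using e BD Z by auto
  ultimately show ?thesis by (simp add: TP_basis_def bij_betw_def)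
qed

lemma flip3_sets_neq:
  fixes X A :: "nat set"
  assumes "i < j" "j < k" "X \<subseteq> A - {i, j, k}" "Y = X \<union> {j} \<or> Y = X \<union> {i, k}"
  shows "X \<union> {i, j} \<noteq> Y \<and> X \<union> {k} \<noteq> Y \<and> X \<union> {i} \<noteq> Y \<and> X \<union> {j, k} \<noteq> Y"
proof -
  have d: "i \<notin> X" "j \<notin> X" "k \<notin> X" "i \<noteq> j" "j \<noteq> k" "i \<noteq> k" using assms(1-3) by auto
  from assms(4) show ?thesis
  proof
    assume Y: "Y = X \<union> {j}"
    show ?thesis unfolding Y using d by (intro conjI; blast)
  next
    assume Y: "Y = X \<union> {i, k}"
    show ?thesis unfolding Y using d by (intro conjI; blast)
  qed
qed

lemma flip4_sets_neq:
  fixes X A :: "nat set"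
  assumes "i < j" "j < k" "k < l" "X \<subseteq> A - {i, j, k, l}" "Y = X \<union> {j, l} \<or> Y = X \<union> {i, k}"
  shows "X \<union> {i, j} \<noteq> Y \<and> X \<union> {k, l} \<noteq> Y \<and> X \<union> {i, l} \<noteq> Y \<and> X \<union> {j, k} \<noteq> Y"
proof -
  have d: "i \<notin> X" "j \<notin> X" "k \<notin> X" "l \<notin> X" "i \<noteq> j" "j \<noteq> k" "i \<noteq> k" "i \<noteq> l" "j \<noteq> l" "k \<noteq> l"
    using assms(1-4) by auto
  from assms(5) show ?thesis
  proof
    assume Y: "Y = X \<union> {j, l}"
    show ?thesis unfolding Y using d by (intro conjI; blast)
  next
    assume Y: "Y = X \<union> {i, k}"
    show ?thesis unfolding Y using d by (intro conjI; blast)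
  qed
qed

lemma flip3_TP_basis:
  assumes B: "TP_basis n m' m B" and f: "flip3 n m' m B B'"
  shows "TP_basis n m' m B'"
proof -
  obtain X i j k where a: "flip3_applicable n m' m X i j k B"
    and ex: "exchange (X \<union> {j}) (X \<union> {i, k}) B B' \<or> exchange (X \<union> {i, k}) (X \<union> {j}) B B'"
    using f by (auto simp: flip3_def)
  have X: "i < j" "j < k" "X \<subseteq> {1..n} - {i, j, k}"
    "{X \<union> {i}, X \<union> {j}, X \<union> {k}, X \<union> {i, j}, X \<union> {i, k}, X \<union> {j, k}} \<subseteq> Delta n m' m"
    "{X \<union> {i}, X \<union> {k}, X \<union> {i, j}, X \<union> {j, k}} \<subseteq> B"
    using a unfolding flip3_applicable_def by simp_all
  have ne: "X \<union> {i, j} \<noteq> Y \<and> X \<union> {k} \<noteq> Y \<and> X \<union> {i} \<noteq> Y \<and> X \<union> {j, k} \<noteq> Y" if "Y = X \<union> {j} \<or> Y = X \<union> {i, k}" for Y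
    by (rule flip3_sets_neq[OF X(1-3) that])
  have rel: "f (X \<union> {i, k}) + f (X \<union> {j}) = max (f (X \<union> {i, j}) + f (X \<union> {k})) (f (X \<union> {i}) + f (X \<union> {j, k}))"
    if "f \<in> TP_functions n m' m" for f by (rule TP_functions_3[OF that X(1-4)])
  have D: "X \<union> {j} \<in> Delta n m' m" "X \<union> {i, k} \<in> Delta n m' m" using X(4) by simp_all
  from ex show ?thesis
  proof
    assume e: "exchange (X \<union> {j}) (X \<union> {i, k}) B B'"
    show ?thesis by (rule TP_basis_exchange[OF B e D(2), of "X \<union> {i, j}" "X \<union> {k}" "X \<union> {i}" "X \<union> {j, k}"])
        (use X(5) ne[of "X \<union> {j}"] rel in \<open>simp_all add: add.commute\<close>)
  next
    assume e: "exchange (X \<union> {i, k}) (X \<union> {j}) B B'"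
    show ?thesis by (rule TP_basis_exchange[OF B e D(1), of "X \<union> {i, j}" "X \<union> {k}" "X \<union> {i}" "X \<union> {j, k}"])
        (use X(5) ne[of "X \<union> {i, k}"] rel in simp_all)
  qed
qed

lemma flip4_TP_basis:
  assumes B: "TP_basis n m' m B" and f: "flip4 n m' m B B'"
  shows "TP_basis n m' m B'"
proof -
  obtain X i j k l where a: "flip4_applicable n m' m X i j k l B"
    and ex: "exchange (X \<union> {i, k}) (X \<union> {j, l}) B B' \<or> exchange (X \<union> {j, l}) (X \<union> {i, k}) B B'"
    using f by (auto simp: flip4_def)
  have X: "i < j" "j < k" "k < l" "X \<subseteq> {1..n} - {i, j, k, l}"
    "{X \<union> {i, j}, X \<union> {i, k}, X \<union> {i, l}, X \<union> {j, k}, X \<union> {j, l}, X \<union> {k, l}} \<subseteq> Delta n m' m"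
    "{X \<union> {i, j}, X \<union> {k, l}, X \<union> {i, l}, X \<union> {j, k}} \<subseteq> B"
    using a unfolding flip4_applicable_def by simp_all
  have ne: "X \<union> {i, j} \<noteq> Y \<and> X \<union> {k, l} \<noteq> Y \<and> X \<union> {i, l} \<noteq> Y \<and> X \<union> {j, k} \<noteq> Y" if "Y = X \<union> {j, l} \<or> Y = X \<union> {i, k}" for Y
    by (rule flip4_sets_neq[OF X(1-4) that])
  have rel: "f (X \<union> {i, k}) + f (X \<union> {j, l}) = max (f (X \<union> {i, j}) + f (X \<union> {k, l})) (f (X \<union> {i, l}) + f (X \<union> {j, k}))"
    if "f \<in> TP_functions n m' m" for f by (rule TP_functions_4[OF that X(1-5)])
  have D: "X \<union> {j, l} \<in> Delta n m' m" "X \<union> {i, k} \<in> Delta n m' m" using X(5) by simp_all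
  from ex show ?thesis
  proof
    assume e: "exchange (X \<union> {i, k}) (X \<union> {j, l}) B B'"
    show ?thesis by (rule TP_basis_exchange[OF B e D(1), of "X \<union> {i, j}" "X \<union> {k, l}" "X \<union> {i, l}" "X \<union> {j, k}"])
        (use X(6) ne[of "X \<union> {i, k}"] rel in simp_all)
  next
    assume e: "exchange (X \<union> {j, l}) (X \<union> {i, k}) B B'"
    show ?thesis by (rule TP_basis_exchange[OF B e D(2), of "X \<union> {i, j}" "X \<union> {k, l}" "X \<union> {i, l}" "X \<union> {j, k}"])
        (use X(6) ne[of "X \<union> {j, l}"] rel in \<open>simp_all add: add.commute\<close>)
  qed
qed

lemma exchange_sym: "exchange Y Z C C' \<Longrightarrow> exchange Z Y C' C"
  unfolding exchange_def by auto

lemma flip3_sym: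
  assumes "flip3 n m' m C C'" shows "flip3 n m' m C' C"
proof -
  obtain X i j k where a: "flip3_applicable n m' m X i j k C"
    and ex: "exchange (X \<union> {j}) (X \<union> {i, k}) C C' \<or> exchange (X \<union> {i, k}) (X \<union> {j}) C C'"
    using assms by (auto simp: flip3_def)
  have X: "i < j" "j < k" "X \<subseteq> {1..n} - {i, j, k}"
    "{X \<union> {i}, X \<union> {j}, X \<union> {k}, X \<union> {i, j}, X \<union> {i, k}, X \<union> {j, k}} \<subseteq> Delta n m' m"
    "{X \<union> {i}, X \<union> {k}, X \<union> {i, j}, X \<union> {j, k}} \<subseteq> C"
    using a unfolding flip3_applicable_def by simp_all
  have ne: "X \<union> {i, j} \<noteq> Y \<and> X \<union> {k} \<noteq> Y \<and> X \<union> {i} \<noteq> Y \<and> X \<union> {j, k} \<noteq> Y" if "Y = X \<union> {j} \<or> Y = X \<union> {i, k}" for Y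
    by (rule flip3_sets_neq[OF X(1-3) that])
  have "{X \<union> {i}, X \<union> {k}, X \<union> {i, j}, X \<union> {j, k}} \<subseteq> C'"
    using ex X(5) ne[of "X \<union> {j}"] ne[of "X \<union> {i, k}"] unfolding exchange_def by (elim disjE conjE) simp_all
  then have "flip3_applicable n m' m X i j k C'" unfolding flip3_applicable_def using X(1-4) by (intro conjI)
  moreover have "exchange (X \<union> {j}) (X \<union> {i, k}) C' C \<or> exchange (X \<union> {i, k}) (X \<union> {j}) C' C"
    using ex exchange_sym by blast
  ultimately show ?thesis unfolding flip3_def by blast
qed

lemma flip4_sym:
  assumes "flip4 n m' m C C'" shows "flip4 n m' m C' C"
proof -
  obtain X i j k l where a: "flip4_applicable n m' m X i j k l C"
    and ex: "exchange (X \<union> {i, k}) (X \<union> {j, l}) C C' \<or> exchange (X \<union> {j, l}) (X \<union> {i, k}) C C'"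
    using assms by (auto simp: flip4_def)
  have X: "i < j" "j < k" "k < l" "X \<subseteq> {1..n} - {i, j, k, l}"
    "{X \<union> {i, j}, X \<union> {i, k}, X \<union> {i, l}, X \<union> {j, k}, X \<union> {j, l}, X \<union> {k, l}} \<subseteq> Delta n m' m"
    "{X \<union> {i, j}, X \<union> {k, l}, X \<union> {i, l}, X \<union> {j, k}} \<subseteq> C"
    using a unfolding flip4_applicable_def by simp_all
  have ne: "X \<union> {i, j} \<noteq> Y \<and> X \<union> {k, l} \<noteq> Y \<and> X \<union> {i, l} \<noteq> Y \<and> X \<union> {j, k} \<noteq> Y" if "Y = X \<union> {j, l} \<or> Y = X \<union> {i, k}" for Y
    by (rule flip4_sets_neq[OF X(1-4) that])
  have "{X \<union> {i, j}, X \<union> {k, l}, X \<union> {i, l}, X \<union> {j, k}} \<subseteq> C'"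
    using ex X(6) ne[of "X \<union> {j, l}"] ne[of "X \<union> {i, k}"] unfolding exchange_def by (elim disjE conjE) simp_all
  then have "flip4_applicable n m' m X i j k l C'" unfolding flip4_applicable_def using X(1-5) by (intro conjI)
  moreover have "exchange (X \<union> {i, k}) (X \<union> {j, l}) C' C \<or> exchange (X \<union> {j, l}) (X \<union> {i, k}) C' C"
    using ex exchange_sym by blast
  ultimately show ?thesis unfolding flip4_def by blast
qed

abbreviation flip :: "nat \<Rightarrow> nat \<Rightarrow> nat \<Rightarrow> nat set set \<Rightarrow> nat set set \<Rightarrow> bool" where
  "flip n m' m \<equiv> \<lambda>C C'. flip3 n m' m C C' \<or> flip4 n m' m C C'"

lemma flips_TP_basis: "(flip n m' m)\<^sup>*\<^sup>* B B' \<Longrightarrow> TP_basis n m' m B \<Longrightarrow> TP_basis n m' m B'"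
  by (induction rule: rtranclp_induct) (auto intro: flip3_TP_basis flip4_TP_basis)

text \<open>Flips are reversible, so the lowering sequences can be read backwards.\<close>

lemma flips_from_IS:
  assumes m: "m' \<le> m" "m' \<le> n" and C: "maximum_ws_collection n m' m C"
  shows "(flip n m' m)\<^sup>*\<^sup>* (IS n m' m) C"
proof -
  obtain C' where r: "(lowering_flip3 n m' m)\<^sup>*\<^sup>* C C'" "(lowering_flip4_in_level m' n m' m)\<^sup>*\<^sup>* C' (IS n m' m)"
    using lower_to_IS[OF m C] by blast
  have "(flip n m' m)\<^sup>*\<^sup>* C C'"
    using r(1) by (rule rtranclp_mono[THEN predicate2D, rotated]) (blast intro: lowering_flip3_flip3)
  moreover have "(flip n m' m)\<^sup>*\<^sup>* C' (IS n m' m)"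
    using r(2) by (rule rtranclp_mono[THEN predicate2D, rotated]) (blast intro: lowering_flip4_flip4)
  ultimately have "(flip n m' m)\<^sup>*\<^sup>* C (IS n m' m)" by (rule rtranclp_trans)
  moreover have "symp (flip n m' m)" by (rule sympI) (blast intro: flip3_sym flip4_sym)
  ultimately show ?thesis by (meson sympD symp_rtranclp)
qed

subsection \<open>Interval values determine a TP-function\<close>

lemma is_interval_gap:
  assumes "finite S" "\<not> is_interval S" "S \<subseteq> {a..a + r}"
  obtains i j k where "i \<in> S" "k \<in> S" "j \<notin> S" "i < j" "j < k" "S \<subseteq> {i..k}" "a \<le> i" "k \<le> a + r"
proof -
  obtain x z y where xyz: "x \<in> S" "z \<in> S" "x < y" "y < z" "y \<notin> S" using is_intervalI[OF assms(1)] assms(2) by blast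
  have ne: "S \<noteq> {}" using xyz by auto
  have "Min S \<le> x" "z \<le> Max S" using assms(1) xyz by auto
  moreover have "Min S \<in> S" "Max S \<in> S" using assms(1) ne by auto
  moreover have "S \<subseteq> {Min S..Max S}" using assms(1) by auto
  ultimately show ?thesis using that[of "Min S" "Max S" y] xyz assms(3) by (auto simp: subset_iff)
qed

text \<open>The outer induction shortens the guaranteed initial run, the inner one the width of the
  rest. In the four-term relation with \<open>i\<close> the first missing element, \<open>j\<close>
  and \<open>l\<close> the ends of the rest and \<open>k\<close> a gap, three of the other five sets
  have a longer initial run and two a narrower rest.\<close>

lemma TP_determined_low:
  assumes m: "m' \<le> m" and fg: "f \<in> TP_functions n m' m" "g \<in> TP_functions n m' m"
    and IS: "\<And>S. S \<in> IS n m' m \<Longrightarrow> f S = g S"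
  shows "S \<in> Delta n m' m \<Longrightarrow> card S = m' \<Longrightarrow> t \<le> m' \<Longrightarrow> {1..m' - t} \<subseteq> S \<Longrightarrow> f S = g S"
proof (induction t arbitrary: S)
  case 0
  then have "{1..m'} = S" using Delta_finite[OF 0(1)] by (intro card_subset_eq) auto
  then have "is_interval S" unfolding is_interval_def by blast
  then show ?case using IS 0 by (auto simp: IS_iff Delta_def)
next
  case (Suc t)
  define s where "s = m' - Suc t"
  have s: "Suc s = m' - t" "s < m'" using Suc.prems by (auto simp: s_def)
  have outer: "f S = g S" if "S \<in> Delta n m' m" "card S = m'" "{1..Suc s} \<subseteq> S" for S
    using Suc.IH[of S] that s Suc.prems(3) by simp
  have inner: "f S = g S" if "S \<in> Delta n m' m" "card S = m'" "{1..s} \<subseteq> S" "Suc s \<notin> S" "S - {1..s} \<subseteq> {a..a + r}" for S a r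
    using that
  proof (induction r arbitrary: S a rule: less_induct)
    case (less r)
    note S = less.prems
    let ?R = "S - {1..s}"
    have fS: "finite S" and Sn: "S \<subseteq> {1..n}" using Delta_finite[OF S(1)] S(1) by (auto simp: Delta_def)
    have R: "?R \<subseteq> {Suc (Suc s)..n}"
    proof
      fix x assume x: "x \<in> ?R"
      then have "x \<noteq> Suc s" using S(4) by auto
      then show "x \<in> {Suc (Suc s)..n}" using x Sn by (auto simp: not_less_eq_eq subset_iff)
    qed
    show ?case
    proof (cases "is_interval ?R")
      case True
      then obtain q z where qz: "?R = {q..z}" by (auto simp: is_interval_def)
      have Rne: "?R \<noteq> {}"
      proof
        assume "?R = {}"
        then have "card S \<le> card {1..s}" by (intro card_mono) auto
        then show False using S(2) s by simp
      qed
      then have qz': "q \<le> z" "Suc s < q" "z \<le> n" using qz R by auto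
      have Se: "S = {1..s} \<union> {q..z}" using qz S(3) by auto
      have "S \<in> IS n m' m"
      \<comment> \<open>An empty initial run is not allowed in a sesqui-interval; the set is then an
        interval.\<close>
      proof (cases "s = 0")
        case True
        then have "S = {q..z}" using Se by simp
        then have "is_interval S" unfolding is_interval_def by blast
        then show ?thesis using S(1) by (simp add: IS_iff Delta_def)
      next
        case False
        then have "1 \<le> s" "s + 1 < q" using qz' by auto
        then have "S \<in> sesqui_intervals n m'" unfolding sesqui_intervals_def using Se qz' S(2) by blast
        then show ?thesis by (simp add: IS_iff)
      qed
      then show ?thesis by (rule IS)
    next
      case False
      obtain j k l where jkl: "j \<in> ?R" "l \<in> ?R" "k \<notin> ?R" "j < k" "k < l" "?R \<subseteq> {j..l}" "a \<le> j" "l \<le> a + r"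
        using is_interval_gap[OF finite_Diff[OF fS] False S(5)] by metis
      define X where "X = S - {j, l}"
      define i where "i = Suc s"
      have jl: "Suc (Suc s) \<le> j" "l \<le> n" "j \<in> S" "l \<in> S" using jkl R by auto
      have kS: "k \<notin> S" using jkl jl by auto
      have o: "i < j" "j < k" "k < l" using jl jkl by (auto simp: i_def)
      have SX: "S = X \<union> {j, l}" using jl by (auto simp: X_def)
      have Xn: "X \<subseteq> {1..n} - {i, j, k, l}" using Sn S(4) kS by (auto simp: X_def i_def)
      have fX: "finite X" using fS by (simp add: X_def)
      have cX: "card X + 2 = m'"
      proof -
        have "card S = card (insert j (insert l X))" using SX by simp
        also have "\<dots> = card X + 2" using fX o by (simp add: X_def)
        finally show ?thesis using S(2) by simp
      qed
      have D2: "X \<union> {b, c} \<in> Delta n m' m \<and> card (X \<union> {b, c}) = m'" if "b \<in> {i, j, k, l}" "c \<in> {i, j, k, l}" "b \<noteq> c" for b c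
      proof -
        have "b \<notin> X" "c \<notin> X" using that Xn by auto
        then have "card (X \<union> {b, c}) = m'" using fX cX that(3) by simp
        moreover have "X \<union> {b, c} \<subseteq> {1..n}" using that Xn o jl by (auto simp: i_def)
        ultimately show ?thesis using m by (auto simp: Delta_def)
      qed
      have D: "{X \<union> {i, j}, X \<union> {i, k}, X \<union> {i, l}, X \<union> {j, k}, X \<union> {j, l}, X \<union> {k, l}} \<subseteq> Delta n m' m"
        using D2 o by simp
      have sX: "{1..s} \<subseteq> X" using S(3) jl o by (auto simp: X_def)
      have iX: "f (X \<union> {i, b}) = g (X \<union> {i, b})" if "b \<in> {j, k, l}" for b
        by (rule outer) (use D2[of i b] that o sX in \<open>auto simp: i_def atLeastAtMostSuc_conv\<close>)
      have RX: "X - {1..s} \<subseteq> {Suc j..l - 1}"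
      proof
        fix x assume "x \<in> X - {1..s}"
        then have "x \<in> {j..l}" "x \<noteq> j" "x \<noteq> l" using jkl(6) by (auto simp: X_def)
        then show "x \<in> {Suc j..l - 1}" by auto
      qed
      have jk: "f (X \<union> {j, k}) = g (X \<union> {j, k})"
      proof (rule less.IH[of "l - 1 - j" _ j])
        show "l - 1 - j < r" using jkl by auto
        show "Suc s \<notin> X \<union> {j, k}" using S(4) o by (auto simp: X_def i_def)
        show "X \<union> {j, k} - {1..s} \<subseteq> {j..j + (l - 1 - j)}" using RX o by (auto simp: subset_iff)
      qed (use D2[of j k] o sX in auto)
      have kl: "f (X \<union> {k, l}) = g (X \<union> {k, l})"
      proof (rule less.IH[of "l - Suc j" _ "Suc j"])
        show "l - Suc j < r" using jkl by auto
        show "Suc s \<notin> X \<union> {k, l}" using S(4) o by (auto simp: X_def i_def)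
        show "X \<union> {k, l} - {1..s} \<subseteq> {Suc j..Suc j + (l - Suc j)}" using RX o by (auto simp: subset_iff)
      qed (use D2[of k l] o sX in auto)
      show ?thesis
        using TP_functions_4[OF fg(1) o Xn D] TP_functions_4[OF fg(2) o Xn D] iX[of j] iX[of k] iX[of l] jk kl unfolding SX by simp
    qed
  qed
  show ?case
  proof (cases "Suc s \<in> S")
    case True
    then have "{1..Suc s} \<subseteq> S" using Suc.prems(4) by (auto simp: s_def[symmetric] atLeastAtMostSuc_conv)
    then show ?thesis using outer Suc.prems by blast
  next
    case False
    show ?thesis
      by (rule inner[of S 0 n]) (use Suc.prems False in \<open>auto simp: s_def Delta_def\<close>)
  qed
qed

text \<open>Above level \<open>m'\<close> the three-term relation, with \<open>i\<close> and
  \<open>k\<close> the ends of \<open>S\<close> and \<open>j\<close> a gap, expresses the value at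
  \<open>S\<close> by values at narrower sets of the same level and the one below.\<close>

lemma TP_determined:
  assumes m: "m' \<le> m" and fg: "f \<in> TP_functions n m' m" "g \<in> TP_functions n m' m"
    and IS: "\<And>S. S \<in> IS n m' m \<Longrightarrow> f S = g S" and S: "S \<in> Delta n m' m"
  shows "f S = g S"
proof -
  have "f S = g S" if "S \<in> Delta n m' m" "S \<subseteq> {a..a + r}" for S a r
    using that
  proof (induction r arbitrary: S a rule: less_induct)
    case (less r)
    note S = less.prems
    have fS: "finite S" and Sn: "S \<subseteq> {1..n}" using Delta_finite[OF S(1)] S(1) by (auto simp: Delta_def)
    consider "card S = m'" | "is_interval S" | "m' < card S" "\<not> is_interval S" using S(1) by (force simp: Delta_def)
    then show ?case
    proof cases
      case 1
      then show ?thesis using TP_determined_low[OF m fg IS S(1), of m'] by simp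
    next
      case 2
      then show ?thesis using IS S(1) by (simp add: IS_iff Delta_def)
    next
      case 3
      obtain i j k where ijk: "i \<in> S" "k \<in> S" "j \<notin> S" "i < j" "j < k" "S \<subseteq> {i..k}" "a \<le> i" "k \<le> a + r"
        using is_interval_gap[OF fS 3(2) S(2)] by metis
      define X where "X = S - {i, k}"
      have SX: "S = X \<union> {i, k}" using ijk by (auto simp: X_def)
      have kn: "k \<le> n" "1 \<le> i" using ijk Sn by auto
      have Xn: "X \<subseteq> {1..n} - {i, j, k}" using Sn ijk by (auto simp: X_def)
      have fX: "finite X" using fS by (simp add: X_def)
      have cX: "card S = card X + 2"
      proof -
        have "card S = card (insert i (insert k X))" using SX by simp
        also have "\<dots> = card X + 2" using fX ijk(4,5) by (simp add: X_def)
        finally show ?thesis .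
      qed
      have cS: "card S \<le> m" using S(1) by (simp add: Delta_def)
      have D1: "X \<union> {b} \<in> Delta n m' m" if "b \<in> {i, j, k}" for b
      proof -
        have "b \<notin> X" using that Xn by auto
        then have "card (X \<union> {b}) = Suc (card X)" using fX by simp
        moreover have "X \<union> {b} \<subseteq> {1..n}" using that Xn ijk(4,5) kn by auto
        ultimately show ?thesis using cX cS 3 by (auto simp: Delta_def)
      qed
      have D2: "X \<union> {b, c} \<in> Delta n m' m" if "b \<in> {i, j, k}" "c \<in> {i, j, k}" "b \<noteq> c" for b c
      proof -
        have "b \<notin> X" "c \<notin> X" using that Xn by auto
        then have "card (X \<union> {b, c}) = card X + 2" using fX that(3) by simp
        moreover have "X \<union> {b, c} \<subseteq> {1..n}" using that Xn ijk(4,5) kn by auto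
        ultimately show ?thesis using cX cS 3 by (auto simp: Delta_def)
      qed
      have D: "{X \<union> {i}, X \<union> {j}, X \<union> {k}, X \<union> {i, j}, X \<union> {i, k}, X \<union> {j, k}} \<subseteq> Delta n m' m"
        using D1 D2 ijk(4,5) by simp
      have RX: "X \<subseteq> {Suc i..k - 1}"
      proof
        fix x assume "x \<in> X"
        then have "x \<in> {i..k}" "x \<noteq> i" "x \<noteq> k" using ijk(6) by (auto simp: X_def)
        then show "x \<in> {Suc i..k - 1}" by auto
      qed
      have L: "f (X \<union> T) = g (X \<union> T)" if "X \<union> T \<in> Delta n m' m" "T \<subseteq> {i..k - 1}" for T
        by (rule less.IH[of "k - 1 - i" _ i]) (use that RX ijk(4,5,7,8) in \<open>auto simp: subset_iff\<close>)
      have U: "f (X \<union> T) = g (X \<union> T)" if "X \<union> T \<in> Delta n m' m" "T \<subseteq> {Suc i..k}" for T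
        by (rule less.IH[of "k - Suc i" _ "Suc i"]) (use that RX ijk(4,5,7,8) in \<open>auto simp: subset_iff\<close>)
      have le: "i \<le> k - 1" "j \<le> k - 1" "Suc i \<le> j" "Suc i \<le> k" "i \<le> j" "j \<le> k" using ijk(4,5) by auto
      have "f (X \<union> {i}) = g (X \<union> {i})" "f (X \<union> {i, j}) = g (X \<union> {i, j})" "f (X \<union> {j}) = g (X \<union> {j})"
        using L[of "{i}"] L[of "{i, j}"] L[of "{j}"] D le by auto
      moreover have "f (X \<union> {k}) = g (X \<union> {k})" "f (X \<union> {j, k}) = g (X \<union> {j, k})"
        using U[of "{k}"] U[of "{j, k}"] D le by auto
      ultimately show ?thesis
        using TP_functions_3[OF fg(1) ijk(4,5) Xn D] TP_functions_3[OF fg(2) ijk(4,5) Xn D] unfolding SX by simp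
    qed
  qed
  moreover have "S \<subseteq> {0..0 + n}" using S by (auto simp: Delta_def)
  ultimately show ?thesis using S by blast
qed

subsection \<open>Flag minors\<close>

text \<open>The cofactor sign of row \<open>a\<close> in the last column: with rows in increasing
  order it depends only on the number of rows after \<open>a\<close>.\<close>

definition sgn_above :: "nat \<Rightarrow> nat set \<Rightarrow> real" where
  "sgn_above a S = (-1) ^ card {b \<in> S. a < b}"

text \<open>The minor with row set \<open>S\<close> and columns \<open>1, \<dots>, d\<close>, expanded along the last column; it is
  meaningful only for \<open>card S = d\<close>.\<close>

fun minor :: "(nat \<Rightarrow> nat \<Rightarrow> real) \<Rightarrow> nat \<Rightarrow> nat set \<Rightarrow> real" where
  "minor M 0 S = 1"
| "minor M (Suc d) S = (\<Sum>a\<in>S. sgn_above a S * M a (Suc d) * minor M d (S - {a}))"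

lemma minor_cong: "(\<And>a c. c \<le> d \<Longrightarrow> M a c = M' a c) \<Longrightarrow> minor M d S = minor M' d S"
  by (induction d arbitrary: S) auto

lemma sgn_above_square [simp]: "sgn_above a S * sgn_above a S = 1" "sgn_above a S * (sgn_above a S * x) = x"
  by (simp_all add: sgn_above_def flip: power_mult_distrib mult.assoc)

lemma sgn_above_insert:
  assumes "finite S" "b \<notin> S"
  shows "sgn_above a (insert b S) = (if a < b then - sgn_above a S else sgn_above a S)"
proof -
  have "{x \<in> insert b S. a < x} = (if a < b then insert b {x \<in> S. a < x} else {x \<in> S. a < x})" by auto
  then show ?thesis using assms by (simp add: sgn_above_def)
qed

lemma sgn_above_self: "finite Q \<Longrightarrow> x \<notin> Q \<Longrightarrow> sgn_above x (insert x Q) = sgn_above x Q"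
  by (simp add: sgn_above_insert)

lemma sgn_above_swap:
  assumes "finite T" "a \<in> T" "b \<in> T" "a \<noteq> b"
  shows "sgn_above a T * sgn_above b (T - {a}) = - (sgn_above b T * sgn_above a (T - {b}))"
proof -
  define R where "R = T - {a, b}"
  have R: "finite R" "a \<notin> R" "b \<notin> R" using assms by (auto simp: R_def)
  have e: "T = insert a (insert b R)" "T = insert b (insert a R)" "T - {a} = insert b R" "T - {b} = insert a R"
    using assms by (auto simp: R_def)
  have s1: "sgn_above a T = sgn_above a (insert b R)"
    by (subst e(1), rule sgn_above_self) (use R assms(4) in auto)
  have s2: "sgn_above b T = sgn_above b (insert a R)"
    by (subst e(2), rule sgn_above_self) (use R assms(4) in auto)
  have s3: "sgn_above b (T - {a}) = sgn_above b R" "sgn_above a (T - {b}) = sgn_above a R"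
    unfolding e(3,4) using R by (simp_all add: sgn_above_self)
  show ?thesis unfolding s1 s2 s3 using sgn_above_insert[OF R(1,3), of a] sgn_above_insert[OF R(1,2), of b] assms(4) by auto
qed

lemma sum_remove_if:
  fixes g :: "'a \<Rightarrow> real"
  assumes "finite T" "a \<in> T"
  shows "(\<Sum>b\<in>T - {a}. g b) = (\<Sum>b\<in>T. if a = b then 0 else g b)"
proof -
  have "(\<Sum>b\<in>T. if a = b then 0 else g b) = (if a = a then 0 else g a) + (\<Sum>b\<in>T - {a}. if a = b then 0 else g b)"
    by (rule sum.remove[OF assms])
  also have "(\<Sum>b\<in>T - {a}. if a = b then 0 else g b) = (\<Sum>b\<in>T - {a}. g b)" by (rule sum.cong) auto
  finally show ?thesis by simp
qed

text \<open>The sum expands a determinant whose last column repeats column \<open>c\<close>. After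
  one further expansion, exchanging the two chosen rows changes the sign; this settles adjacent
  equal columns and reduces the other cases to fewer columns.\<close>

lemma minor_repeated_column:
  assumes "finite T" "1 \<le> c" "c \<le> t"
  shows "(\<Sum>a\<in>T. sgn_above a T * M a c * minor M t (T - {a})) = 0"
  using assms
proof (induction t arbitrary: T)
  case 0
  then show ?case by simp
next
  case (Suc t)
  note fT = Suc.prems(1)
  define h where "h a b = sgn_above a T * sgn_above b (T - {a}) * M a c * M b (Suc t) * minor M t (T - {a} - {b})" for a b
  have pairs: "(\<Sum>a\<in>T. \<Sum>b\<in>T - {a}. g a b) = (\<Sum>b\<in>T. \<Sum>a\<in>T - {b}. g a b)" for g :: "nat \<Rightarrow> nat \<Rightarrow> real"
  proof -
    have "(\<Sum>a\<in>T. \<Sum>b\<in>T - {a}. g a b) = (\<Sum>a\<in>T. \<Sum>b\<in>T. if a = b then 0 else g a b)"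
      by (rule sum.cong[OF refl]) (rule sum_remove_if[OF fT])
    also have "\<dots> = (\<Sum>b\<in>T. \<Sum>a\<in>T. if a = b then 0 else g a b)" by (rule sum.swap)
    also have "\<dots> = (\<Sum>b\<in>T. \<Sum>a\<in>T. if b = a then 0 else g a b)" by (intro sum.cong refl) auto
    also have "\<dots> = (\<Sum>b\<in>T. \<Sum>a\<in>T - {b}. g a b)"
      by (rule sum.cong[OF refl]) (rule sum_remove_if[OF fT, symmetric])
    finally show ?thesis .
  qed
  have start: "(\<Sum>a\<in>T. sgn_above a T * M a c * minor M (Suc t) (T - {a})) = (\<Sum>a\<in>T. \<Sum>b\<in>T - {a}. h a b)"
    by (simp add: sum_distrib_left h_def mult_ac)
  have h_swap: "h a b = - (sgn_above b T * sgn_above a (T - {b}) * M a c * M b (Suc t) * minor M t (T - {b} - {a}))" if "a \<in> T" "b \<in> T" "a \<noteq> b" for a b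
  proof -
    have "T - {a} - {b} = T - {b} - {a}" by auto
    then show ?thesis using sgn_above_swap[OF fT that] by (simp add: h_def)
  qed
  show ?case
  proof (cases "c = Suc t")
    case True
    have anti: "h a b = - h b a" if "a \<in> T" "b \<in> T" "a \<noteq> b" for a b
      using h_swap[OF that] True by (simp add: h_def)
    have "(\<Sum>a\<in>T. \<Sum>b\<in>T - {a}. h a b) = (\<Sum>a\<in>T. \<Sum>b\<in>T - {a}. - h b a)"
      by (intro sum.cong refl anti) auto
    also have "\<dots> = - (\<Sum>a\<in>T. \<Sum>b\<in>T - {a}. h a b)" unfolding sum_negf using pairs[of h] by simp
    finally show ?thesis using start by simp
  next
    case False
    have "(\<Sum>a\<in>T. \<Sum>b\<in>T - {a}. h a b) = (\<Sum>b\<in>T. \<Sum>a\<in>T - {b}. h a b)" by (rule pairs)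
    also have "\<dots> = (\<Sum>b\<in>T. - (sgn_above b T * M b (Suc t)) * (\<Sum>a\<in>T - {b}. sgn_above a (T - {b}) * M a c * minor M t (T - {b} - {a})))"
      unfolding sum_distrib_left by (intro sum.cong refl) (auto simp: h_swap)
    also have "\<dots> = 0"
    proof (rule sum.neutral, rule ballI)
      fix b assume "b \<in> T"
      have "(\<Sum>a\<in>T - {b}. sgn_above a (T - {b}) * M a c * minor M t (T - {b} - {a})) = 0"
        by (rule Suc.IH) (use Suc.prems False in simp_all)
      then show "- (sgn_above b T * M b (Suc t)) * (\<Sum>a\<in>T - {b}. sgn_above a (T - {b}) * M a c * minor M t (T - {b} - {a})) = 0" by simp
    qed
    finally show ?thesis using start by simp
  qed
qed

text \<open>As a function of the row \<open>a\<close>, the signed minor of \<open>X \<union> {a}\<close> is a combination of the first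
  \<open>card X + 1\<close> columns.\<close>

definition row_form :: "(nat \<Rightarrow> nat \<Rightarrow> real) \<Rightarrow> nat \<Rightarrow> nat set \<Rightarrow> nat \<Rightarrow> real" where
  "row_form M d X a = (if a \<in> X then 0 else sgn_above a X * minor M d (insert a X))"

text \<open>Expansion of the minor along column \<open>Suc e\<close>; for a row already in
  \<open>X\<close> the right-hand side cancels.\<close>

lemma row_form_Suc:
  assumes "finite X"
  shows "row_form M (Suc e) X a = minor M e X * M a (Suc e) - (\<Sum>b\<in>X. sgn_above b X * M b (Suc e) * row_form M e (X - {b}) a)"
proof -
  show ?thesis
  proof (cases "a \<in> X")
    case True
    have "(\<Sum>b\<in>X. sgn_above b X * M b (Suc e) * row_form M e (X - {b}) a) = sgn_above a X * M a (Suc e) * row_form M e (X - {a}) a"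
      using True assms by (subst sum.remove[of X a]) (auto simp: row_form_def intro!: sum.neutral)
    moreover have "row_form M e (X - {a}) a = sgn_above a (X - {a}) * minor M e X"
      using True by (simp add: row_form_def insert_absorb)
    moreover have "sgn_above a X = sgn_above a (X - {a})" using sgn_above_self[of "X - {a}" a] assms True by (simp add: insert_absorb)
    ultimately show ?thesis using True by (simp add: row_form_def[of M "Suc e" X a])
  next
    case False
    have "minor M (Suc e) (insert a X) = sgn_above a (insert a X) * M a (Suc e) * minor M e X
        + (\<Sum>b\<in>X. sgn_above b (insert a X) * M b (Suc e) * minor M e (insert a X - {b}))"
      using False assms by simp
    moreover have "(\<Sum>b\<in>X. sgn_above a X * (sgn_above b (insert a X) * M b (Suc e) * minor M e (insert a X - {b})))
       = (\<Sum>b\<in>X. - (sgn_above b X * M b (Suc e) * row_form M e (X - {b}) a))"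
    proof (rule sum.cong[OF refl])
      fix b assume b: "b \<in> X"
      have ab: "a \<noteq> b" using b False by auto
      have ins: "insert a X - {b} = insert a (X - {b})" using ab by auto
      have "sgn_above a X = (if a < b then - sgn_above a (X - {b}) else sgn_above a (X - {b}))"
        using sgn_above_insert[of "X - {b}" b a] assms b by (simp add: insert_absorb)
      moreover have "sgn_above b (insert a X) = (if b < a then - sgn_above b X else sgn_above b X)"
        by (rule sgn_above_insert[OF assms False])
      ultimately show "sgn_above a X * (sgn_above b (insert a X) * M b (Suc e) * minor M e (insert a X - {b}))
        = - (sgn_above b X * M b (Suc e) * row_form M e (X - {b}) a)"
        using ab False unfolding ins row_form_def by auto
    qed
    ultimately show ?thesis using False sgn_above_self[OF assms False]
      by (simp add: row_form_def sum_distrib_left distrib_left sum_negf mult.assoc)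
  qed
qed

text \<open>The row form combines columns up to \<open>Suc e \<le> t\<close>, and each of them
  contributes zero by \<open>minor_repeated_column\<close>. These are the incidence relations
  between flag minors.\<close>

lemma row_form_relation:
  assumes "finite X" "card X = e" "finite T" "Suc e \<le> t"
  shows "(\<Sum>a\<in>T. sgn_above a T * row_form M (Suc e) X a * minor M t (T - {a})) = 0"
  using assms
proof (induction e arbitrary: X)
  case 0
  then have X: "X = {}" by simp
  have "row_form M (Suc 0) X a = M a 1" for a using row_form_Suc[OF 0(1), of M 0 a] X by simp
  then show ?case using minor_repeated_column[OF 0(3), of 1 t M] 0 by simp
next
  case (Suc e)
  have r: "row_form M (Suc (Suc e)) X a = minor M (Suc e) X * M a (Suc (Suc e)) - (\<Sum>b\<in>X. sgn_above b X * M b (Suc (Suc e)) * row_form M (Suc e) (X - {b}) a)" for a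
    by (rule row_form_Suc[OF Suc.prems(1)])
  have "(\<Sum>a\<in>T. sgn_above a T * row_form M (Suc (Suc e)) X a * minor M t (T - {a}))
     = minor M (Suc e) X * (\<Sum>a\<in>T. sgn_above a T * M a (Suc (Suc e)) * minor M t (T - {a}))
       - (\<Sum>a\<in>T. \<Sum>b\<in>X. sgn_above b X * M b (Suc (Suc e)) * (sgn_above a T * row_form M (Suc e) (X - {b}) a * minor M t (T - {a})))"
    unfolding r sum_distrib_left sum_subtractf[symmetric]
    by (intro sum.cong refl) (simp add: algebra_simps sum_distrib_left sum_distrib_right)
  also have "(\<Sum>a\<in>T. \<Sum>b\<in>X. sgn_above b X * M b (Suc (Suc e)) * (sgn_above a T * row_form M (Suc e) (X - {b}) a * minor M t (T - {a})))
     = (\<Sum>b\<in>X. sgn_above b X * M b (Suc (Suc e)) * (\<Sum>a\<in>T. sgn_above a T * row_form M (Suc e) (X - {b}) a * minor M t (T - {a})))"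
    unfolding sum_distrib_left by (rule sum.swap)
  also have "\<dots> = 0"
  proof (rule sum.neutral, rule ballI)
    fix b assume b: "b \<in> X"
    have "(\<Sum>a\<in>T. sgn_above a T * row_form M (Suc e) (X - {b}) a * minor M t (T - {a})) = 0"
      by (rule Suc.IH) (use Suc.prems b in auto)
    then show "sgn_above b X * M b (Suc (Suc e)) * (\<Sum>a\<in>T. sgn_above a T * row_form M (Suc e) (X - {b}) a * minor M t (T - {a})) = 0" by simp
  qed
  finally show ?case using minor_repeated_column[OF Suc.prems(3), of "Suc (Suc e)" t M] Suc.prems by simp
qed

definition flag_minor :: "(nat \<Rightarrow> nat \<Rightarrow> real) \<Rightarrow> nat set \<Rightarrow> real" where
  "flag_minor M S = minor M (card S) S"

text \<open>In \<open>row_form_relation\<close> for \<open>X \<union> {i, j, k}\<close> the rows of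
  \<open>X\<close> drop out. Of the other three terms only that of \<open>j\<close> changes sign, as
  exactly one new row comes after it.\<close>

lemma flag_minor_relation:
  assumes fX: "finite X" and o: "i < j" "j < k" and d: "i \<notin> X" "j \<notin> X" "k \<notin> X"
  shows "flag_minor M (insert i (insert k X)) * flag_minor M (insert j X) =
    flag_minor M (insert i (insert j X)) * flag_minor M (insert k X) + flag_minor M (insert i X) * flag_minor M (insert j (insert k X))"
proof -
  let ?T = "insert i (insert j (insert k X))"
  let ?t = "Suc (Suc (card X))"
  let ?h = "\<lambda>a. sgn_above a ?T * row_form M (Suc (card X)) X a * minor M ?t (?T - {a})"
  have "(\<Sum>a\<in>?T. ?h a) = 0" by (rule row_form_relation) (use fX in auto)
  moreover have "(\<Sum>a\<in>?T. ?h a) = ?h i + (?h j + (?h k + (\<Sum>a\<in>X. ?h a)))"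
    using fX d o by (simp add: sum.insert)
  moreover have "(\<Sum>a\<in>X. ?h a) = 0" by (rule sum.neutral) (simp add: row_form_def)
  ultimately have z: "?h i + ?h j + ?h k = 0" by simp
  have s: "sgn_above i ?T = sgn_above i X" "sgn_above j ?T = - sgn_above j X" "sgn_above k ?T = sgn_above k X"
    using fX d o by (simp_all add: sgn_above_insert)
  have diff: "?T - {i} = insert j (insert k X)" "?T - {j} = insert i (insert k X)" "?T - {k} = insert i (insert j X)"
    using d o by auto
  have "?h i = flag_minor M (insert i X) * flag_minor M (insert j (insert k X))"
    "?h j = - (flag_minor M (insert j X) * flag_minor M (insert i (insert k X)))"
    "?h k = flag_minor M (insert k X) * flag_minor M (insert i (insert j X))"
    unfolding diff s row_form_def flag_minor_def using d o fX by (simp_all add: mult.assoc del: minor.simps)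
  then show ?thesis using z by (simp add: algebra_simps)
qed

text \<open>The equations are triangular: the one for \<open>p\<close> is the first to contain
  \<open>m (p + e)\<close>, with the nonzero coefficient \<open>G {p..<p + e}\<close>.\<close>

lemma exists_column:
  fixes G :: "nat set \<Rightarrow> real" and w :: "nat \<Rightarrow> real"
  assumes G: "\<And>p. 1 \<le> p \<Longrightarrow> p + e \<le> N \<Longrightarrow> G {p..<p + e} \<noteq> 0"
  shows "\<exists>m. \<forall>p. 1 \<le> p \<and> p + e \<le> N \<longrightarrow> (\<Sum>a\<in>{p..p + e}. sgn_above a {p..p + e} * m a * G ({p..p + e} - {a})) = w p"
  using G
proof (induction N)
  case 0
  then show ?case by auto
next
  case (Suc N)
  obtain m where m: "\<And>p. 1 \<le> p \<Longrightarrow> p + e \<le> N \<Longrightarrow> (\<Sum>a\<in>{p..p + e}. sgn_above a {p..p + e} * m a * G ({p..p + e} - {a})) = w p"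
    using Suc by auto
  show ?case
  proof (cases "1 + e \<le> Suc N")
    case False
    then show ?thesis by (intro exI[of _ m]) auto
  next
    case True
    define q where "q = Suc N - e"
    have q: "1 \<le> q" "q + e = Suc N" using True by (auto simp: q_def)
    define y where "y = (w q - (\<Sum>a\<in>{q..<q + e}. sgn_above a {q..q + e} * m a * G ({q..q + e} - {a}))) / G {q..<q + e}"
    define m' where "m' = m(Suc N := y)"
    have Gq: "G {q..<q + e} \<noteq> 0" using Suc.prems[of q] q by simp
    have "(\<Sum>a\<in>{p..p + e}. sgn_above a {p..p + e} * m' a * G ({p..p + e} - {a})) = w p" if p: "1 \<le> p" "p + e \<le> Suc N" for p
    proof (cases "p + e = Suc N")
      case False
      have "(\<Sum>a\<in>{p..p + e}. sgn_above a {p..p + e} * m' a * G ({p..p + e} - {a})) = (\<Sum>a\<in>{p..p + e}. sgn_above a {p..p + e} * m a * G ({p..p + e} - {a}))"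
        using p False by (intro sum.cong refl) (auto simp: m'_def)
      then show ?thesis using m[of p] p False by simp
    next
      case True
      then have pq: "p = q" using q by simp
      have split: "{q..q + e} = insert (q + e) {q..<q + e}" "q + e \<notin> {q..<q + e}" by auto
      have dif: "{q..q + e} - {q + e} = {q..<q + e}" by auto
      have none: "{b \<in> {q..q + e}. q + e < b} = {}" by auto
      have s1: "sgn_above (q + e) {q..q + e} = 1" unfolding sgn_above_def none by simp
      have "(\<Sum>a\<in>{q..q + e}. sgn_above a {q..q + e} * m' a * G ({q..q + e} - {a}))
        = sgn_above (q + e) {q..q + e} * m' (q + e) * G ({q..q + e} - {q + e}) + (\<Sum>a\<in>{q..<q + e}. sgn_above a {q..q + e} * m' a * G ({q..q + e} - {a}))"
        using sum.insert[OF _ split(2)] split(1) by (metis (no_types, lifting) finite_atLeastLessThan)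
      also have "(\<Sum>a\<in>{q..<q + e}. sgn_above a {q..q + e} * m' a * G ({q..q + e} - {a})) = (\<Sum>a\<in>{q..<q + e}. sgn_above a {q..q + e} * m a * G ({q..q + e} - {a}))"
        using q by (intro sum.cong refl) (auto simp: m'_def)
      also have "sgn_above (q + e) {q..q + e} * m' (q + e) * G ({q..q + e} - {q + e}) = y * G {q..<q + e}"
        unfolding s1 dif using q by (simp add: m'_def)
      finally show ?thesis using Gq pq by (simp add: y_def)
    qed
    then show ?thesis by (intro exI[of _ m']) auto
  qed
qed

text \<open>A new column does not affect earlier minors, and positivity of \<open>w\<close> makes
  the earlier interval minors usable as pivots.\<close>

lemma exists_matrix:
  fixes w :: "nat set \<Rightarrow> real"
  assumes w: "\<And>S. w S > 0"
  shows "\<exists>M. \<forall>c p. 1 \<le> c \<and> c \<le> C \<and> 1 \<le> p \<and> p + c \<le> Suc n \<longrightarrow> minor M c {p..<p + c} = w {p..<p + c}"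
proof (induction C)
  case 0
  then show ?case by auto
next
  case (Suc C)
  then obtain M where M: "\<And>c p. 1 \<le> c \<Longrightarrow> c \<le> C \<Longrightarrow> 1 \<le> p \<Longrightarrow> p + c \<le> Suc n \<Longrightarrow> minor M c {p..<p + c} = w {p..<p + c}" by blast
  have "minor M C {p..<p + C} \<noteq> 0" if "1 \<le> p" "p + C \<le> n" for p
  proof (cases "C = 0")
    case False
    then show ?thesis using M[of C p] that w[of "{p..<p + C}"] by simp
  qed simp
  then obtain m where m: "\<And>p. 1 \<le> p \<Longrightarrow> p + C \<le> n \<Longrightarrow>
    (\<Sum>a\<in>{p..p + C}. sgn_above a {p..p + C} * m a * minor M C ({p..p + C} - {a})) = w {p..<p + Suc C}"
    using exists_column[of C n "minor M C" "\<lambda>p. w {p..<p + Suc C}"] by blast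
  define M' where "M' a c = (if c = Suc C then m a else M a c)" for a c
  have old: "minor M' c S = minor M c S" if "c \<le> C" for c S
    by (rule minor_cong) (use that in \<open>auto simp: M'_def\<close>)
  have "minor M' c {p..<p + c} = w {p..<p + c}" if c: "1 \<le> c" "c \<le> Suc C" "1 \<le> p" "p + c \<le> Suc n" for c p
  proof (cases "c = Suc C")
    case False
    then show ?thesis using M[of c p] c old[of c] by simp
  next
    case True
    have "{p..<p + Suc C} = {p..p + C}" by auto
    then have "minor M' (Suc C) {p..<p + Suc C} = (\<Sum>a\<in>{p..p + C}. sgn_above a {p..p + C} * m a * minor M C ({p..p + C} - {a}))"
      by (simp add: old M'_def)
    then show ?thesis using m[of p] c True by simp
  qed
  then show ?case by blast
qed

text \<open>Positivity spreads from intervals to all sets because the three-term relation expresses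
  the widest set by sums, products and one division.\<close>

lemma exists_positive_flag:
  fixes w :: "nat set \<Rightarrow> real"
  assumes w: "\<And>S. w S > 0"
  shows "\<exists>F. (\<forall>S. S \<subseteq> {1..n} \<longrightarrow> F S > 0) \<and> (\<forall>S. S \<subseteq> {1..n} \<longrightarrow> is_interval S \<longrightarrow> F S = w S) \<and>
    (\<forall>X i j k. finite X \<longrightarrow> i < j \<longrightarrow> j < k \<longrightarrow> i \<notin> X \<longrightarrow> j \<notin> X \<longrightarrow> k \<notin> X \<longrightarrow>
      F (insert i (insert k X)) * F (insert j X) = F (insert i (insert j X)) * F (insert k X) + F (insert i X) * F (insert j (insert k X)))"
proof -
  obtain M where M: "\<forall>c p. 1 \<le> c \<and> c \<le> n \<and> 1 \<le> p \<and> p + c \<le> Suc n \<longrightarrow> minor M c {p..<p + c} = w {p..<p + c}"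
    using exists_matrix[of w n n] w by blast
  \<comment> \<open>The empty minor is always 1. Its value may be changed to \<open>w {}\<close>,
    since the empty set occurs in no three-term relation.\<close>
  define F where "F S = (if S = {} then w {} else flag_minor M S)" for S
  have rel: "F (insert i (insert k X)) * F (insert j X) = F (insert i (insert j X)) * F (insert k X) + F (insert i X) * F (insert j (insert k X))"
    if "finite X" "i < j" "j < k" "i \<notin> X" "j \<notin> X" "k \<notin> X" for X i j k
    using flag_minor_relation[OF that, of M] by (simp add: F_def)
  have int: "F S = w S" if S: "S \<subseteq> {1..n}" "is_interval S" for S
  proof (cases "S = {}")
    case False
    obtain p q where pq: "S = {p..q}" using S by (auto simp: is_interval_def)
    have "p \<le> q" using False pq by auto
    then have b: "1 \<le> p" "q \<le> n" using S pq by auto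
    define c where "c = Suc q - p"
    have c: "S = {p..<p + c}" "card S = c" "1 \<le> c" "c \<le> n" "p + c \<le> Suc n" using pq \<open>p \<le> q\<close> b by (auto simp: c_def)
    have "minor M c {p..<p + c} = w {p..<p + c}" using M c b by blast
    then show ?thesis using c(1,2) False by (simp add: F_def flag_minor_def)
  qed (simp add: F_def)
  have pos: "F S > 0" if "S \<subseteq> {1..n}" "S \<subseteq> {a..a + r}" for S a r
    using that
  proof (induction r arbitrary: S a rule: less_induct)
    case (less r)
    note S = less.prems
    have fS: "finite S" using S(1) finite_subset by blast
    show ?case
    proof (cases "is_interval S")
      case True
      then show ?thesis using int[OF S(1)] w[of S] by simp
    next
      case False
      obtain i j k where ijk: "i \<in> S" "k \<in> S" "j \<notin> S" "i < j" "j < k" "S \<subseteq> {i..k}" "a \<le> i" "k \<le> a + r"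
        using is_interval_gap[OF fS False S(2)] by metis
      define X where "X = S - {i, k}"
      have SX: "S = insert i (insert k X)" using ijk by (auto simp: X_def)
      have RX: "X \<subseteq> {Suc i..k - 1}"
      proof
        fix x assume "x \<in> X"
        then have "x \<in> {i..k}" "x \<noteq> i" "x \<noteq> k" using ijk(6) by (auto simp: X_def)
        then show "x \<in> {Suc i..k - 1}" by auto
      qed
      have Xn: "X \<subseteq> {1..n}" "1 \<le> i" "k \<le> n" using S(1) ijk by (auto simp: X_def)
      have d: "finite X" "i \<notin> X" "j \<notin> X" "k \<notin> X" using fS ijk by (auto simp: X_def)
      have L: "F (T \<union> X) > 0" if "T \<subseteq> {i..k - 1}" for T
        by (rule less.IH[of "k - 1 - i" _ i]) (use that RX Xn ijk(4,5,7,8) in \<open>auto simp: subset_iff\<close>)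
      have U: "F (T \<union> X) > 0" if "T \<subseteq> {Suc i..k}" for T
        by (rule less.IH[of "k - Suc i" _ "Suc i"]) (use that RX Xn ijk(4,5,7,8) in \<open>auto simp: subset_iff\<close>)
      have le: "i \<le> k - 1" "j \<le> k - 1" "Suc i \<le> j" "Suc i \<le> k" "i \<le> j" "j \<le> k" using ijk(4,5) by auto
      have "F (insert i X) > 0" "F (insert i (insert j X)) > 0" "F (insert j X) > 0"
        using L[of "{i}"] L[of "{i, j}"] L[of "{j}"] le by auto
      moreover have "F (insert k X) > 0" "F (insert j (insert k X)) > 0"
        using U[of "{k}"] U[of "{j, k}"] le by auto
      ultimately have "0 < F (insert i (insert k X)) * F (insert j X)"
        unfolding rel[OF d(1) ijk(4,5) d(2-4)] by (intro add_pos_pos mult_pos_pos)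
      then show ?thesis using \<open>F (insert j X) > 0\<close> unfolding SX by (simp add: zero_less_mult_iff)
    qed
  qed
  have "F S > 0" if "S \<subseteq> {1..n}" for S
  proof (rule pos[OF that])
    show "S \<subseteq> {0..0 + n}" using that by auto
  qed
  then show ?thesis using int rel by (intro exI[of _ F]) blast
qed

subsection \<open>Tropicalization\<close>

text \<open>By the three-term relations \<open>F (X \<union> {i, j}) / (F (X \<union> {i}) * F (X \<union> {j}))\<close> is additive in \<open>i < j\<close>,
  so the four-term relation is an identity in three variables.\<close>

lemma four_term_relation:
  fixes F :: "nat set \<Rightarrow> real"
  assumes rel: "\<And>i j k. i < j \<Longrightarrow> j < k \<Longrightarrow> {i, j, k} \<subseteq> {a, b, c, d} \<Longrightarrow>
      F (insert i (insert k X)) * F (insert j X) = F (insert i (insert j X)) * F (insert k X) + F (insert i X) * F (insert j (insert k X))"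
    and pos: "F (insert a X) > 0" "F (insert b X) > 0" "F (insert c X) > 0" "F (insert d X) > 0"
    and o: "a < b" "b < c" "c < d"
  shows "F (insert a (insert c X)) * F (insert b (insert d X)) =
    F (insert a (insert b X)) * F (insert c (insert d X)) + F (insert a (insert d X)) * F (insert b (insert c X))"
proof -
  define u where "u i j = F (insert i (insert j X)) / (F (insert i X) * F (insert j X))" for i j
  have add: "u i k = u i j + u j k" if "i < j" "j < k" "{i, j, k} \<subseteq> {a, b, c, d}" for i j k
  proof -
    have "F (insert i X) > 0" "F (insert j X) > 0" "F (insert k X) > 0" using that(3) pos by auto
    then show ?thesis using rel[OF that] by (simp add: u_def field_simps)
  qed
  have F: "F (insert i (insert j X)) = u i j * (F (insert i X) * F (insert j X))" if "{i, j} \<subseteq> {a, b, c, d}" for i j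
    using that pos by (auto simp: u_def)
  have 1: "u a c = u a b + u b c" "u b d = u b c + u c d" "u a d = u a b + (u b c + u c d)"
    using add[of a b c] add[of b c d] add[of a b d] o by auto
  show ?thesis using F[of a c] F[of b d] F[of a b] F[of c d] F[of a d] F[of b c] unfolding 1 by (simp add: algebra_simps)
qed

text \<open>The logarithm of a sum exceeds that of the larger summand by at most
  \<open>ln 2\<close>, which vanishes after scaling.\<close>

lemma ln_add_tendsto_max:
  fixes P Q :: "nat \<Rightarrow> real"
  assumes pos: "\<And>N. P N > 0" "\<And>N. Q N > 0"
    and lim: "(\<lambda>N. ln (P N) / real (Suc N)) \<longlonglongrightarrow> A" "(\<lambda>N. ln (Q N) / real (Suc N)) \<longlonglongrightarrow> B"
  shows "(\<lambda>N. ln (P N + Q N) / real (Suc N)) \<longlonglongrightarrow> max A B"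
proof -
  let ?m = "\<lambda>N. max (ln (P N) / real (Suc N)) (ln (Q N) / real (Suc N))"
  have m: "?m \<longlonglongrightarrow> max A B" by (rule tendsto_max[OF lim])
  have "(\<lambda>N. ln 2 * inverse (real (Suc N))) \<longlonglongrightarrow> ln 2 * 0" by (intro tendsto_mult tendsto_const LIMSEQ_inverse_real_of_nat)
  then have u: "(\<lambda>N. ?m N + ln 2 * inverse (real (Suc N))) \<longlonglongrightarrow> max A B" using tendsto_add[OF m] by fastforce
  have mm: "?m N = ln (max (P N) (Q N)) / real (Suc N)" for N
  proof -
    have "ln (P N) / real (Suc N) \<le> ln (Q N) / real (Suc N) \<longleftrightarrow> P N \<le> Q N"
      using pos[of N] by (simp add: divide_le_cancel)
    then show ?thesis by (simp add: max_def)
  qed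
  have lo: "?m N \<le> ln (P N + Q N) / real (Suc N)" for N
    unfolding mm using pos[of N] by (intro divide_right_mono) (auto simp: max_def)
  have hi: "ln (P N + Q N) / real (Suc N) \<le> ?m N + ln 2 * inverse (real (Suc N))" for N
  proof -
    have "ln (P N + Q N) \<le> ln (2 * max (P N) (Q N))" using pos[of N] by (auto simp: max_def)
    also have "\<dots> = ln 2 + ln (max (P N) (Q N))" using pos[of N] by (intro ln_mult_pos) (auto simp: max_def)
    finally have "ln (P N + Q N) / real (Suc N) \<le> (ln 2 + ln (max (P N) (Q N))) / real (Suc N)" by (intro divide_right_mono) auto
    also have "(ln 2 + ln (max (P N) (Q N))) / real (Suc N) = ?m N + ln 2 * inverse (real (Suc N))"
      unfolding mm by (simp only: divide_inverse distrib_right add.commute)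
    finally show ?thesis .
  qed
  show ?thesis by (rule tendsto_sandwich[OF _ _ m u]) (use lo hi in auto)
qed

text \<open>Prescribe the interval minors \<open>exp (t * v S)\<close>, take \<open>ln / t\<close> of all flag minors and let \<open>t\<close> tend
  to infinity.\<close>

lemma exists_TP_function:
  fixes v :: "nat set \<Rightarrow> real"
  shows "\<exists>f \<in> TP_functions n 0 n. \<forall>S. S \<subseteq> {1..n} \<longrightarrow> is_interval S \<longrightarrow> f S = v S"
proof -
  have "\<exists>F. (\<forall>S. S \<subseteq> {1..n} \<longrightarrow> F S > 0) \<and> (\<forall>S. S \<subseteq> {1..n} \<longrightarrow> is_interval S \<longrightarrow> F S = exp (real (Suc N) * v S)) \<and>
    (\<forall>X i j k. finite X \<longrightarrow> i < j \<longrightarrow> j < k \<longrightarrow> i \<notin> X \<longrightarrow> j \<notin> X \<longrightarrow> k \<notin> X \<longrightarrow>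
      F (insert i (insert k X)) * F (insert j X) = F (insert i (insert j X)) * F (insert k X) + F (insert i X) * F (insert j (insert k X)))" for N
    by (rule exists_positive_flag) simp
  then obtain F where F: "\<And>N S. S \<subseteq> {1..n} \<Longrightarrow> F N S > 0"
    "\<And>N S. S \<subseteq> {1..n} \<Longrightarrow> is_interval S \<Longrightarrow> F N S = exp (real (Suc N) * v S)"
    "\<And>N X i j k. finite X \<Longrightarrow> i < j \<Longrightarrow> j < k \<Longrightarrow> i \<notin> X \<Longrightarrow> j \<notin> X \<Longrightarrow> k \<notin> X \<Longrightarrow>
      F N (insert i (insert k X)) * F N (insert j X) = F N (insert i (insert j X)) * F N (insert k X) + F N (insert i X) * F N (insert j (insert k X))"
    by metis
  define \<phi> where "\<phi> S N = ln (F N S) / real (Suc N)" for S N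
  have prod: "(\<lambda>N. ln (F N S * F N T) / real (Suc N)) = (\<lambda>N. \<phi> S N + \<phi> T N)" if "S \<subseteq> {1..n}" "T \<subseteq> {1..n}" for S T
    using F(1)[OF that(1)] F(1)[OF that(2)] by (intro ext) (simp add: \<phi>_def ln_mult_pos add_divide_distrib)
  \<comment> \<open>Intervals give constant sequences; otherwise the three-term relation reduces
    convergence to narrower sets.\<close>
  have conv: "convergent (\<phi> S)" if "S \<subseteq> {1..n}" "S \<subseteq> {a..a + r}" for S a r
    using that
  proof (induction r arbitrary: S a rule: less_induct)
    case (less r)
    note S = less.prems
    have fS: "finite S" using S(1) finite_subset by blast
    show ?case
    proof (cases "is_interval S")
      case True
      have "\<phi> S = (\<lambda>N. v S)" by (intro ext) (simp add: \<phi>_def F(2)[OF S(1) True])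
      then show ?thesis by (simp add: convergent_const)
    next
      case False
      obtain i j k where ijk: "i \<in> S" "k \<in> S" "j \<notin> S" "i < j" "j < k" "S \<subseteq> {i..k}" "a \<le> i" "k \<le> a + r"
        using is_interval_gap[OF fS False S(2)] by metis
      define X where "X = S - {i, k}"
      have SX: "S = insert i (insert k X)" using ijk by (auto simp: X_def)
      have RX: "X \<subseteq> {Suc i..k - 1}"
      proof
        fix x assume "x \<in> X"
        then have "x \<in> {i..k}" "x \<noteq> i" "x \<noteq> k" using ijk(6) by (auto simp: X_def)
        then show "x \<in> {Suc i..k - 1}" by auto
      qed
      have Xn: "X \<subseteq> {1..n}" "1 \<le> i" "k \<le> n" using S(1) ijk by (auto simp: X_def)
      have d: "finite X" "i \<notin> X" "j \<notin> X" "k \<notin> X" using fS ijk by (auto simp: X_def)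
      have L: "convergent (\<phi> (T \<union> X))" if "T \<subseteq> {i..k - 1}" for T
        by (rule less.IH[of "k - 1 - i" _ i]) (use that RX Xn ijk(4,5,7,8) in \<open>auto simp: subset_iff\<close>)
      have U: "convergent (\<phi> (T \<union> X))" if "T \<subseteq> {Suc i..k}" for T
        by (rule less.IH[of "k - Suc i" _ "Suc i"]) (use that RX Xn ijk(4,5,7,8) in \<open>auto simp: subset_iff\<close>)
      have le: "i \<le> k - 1" "j \<le> k - 1" "Suc i \<le> j" "Suc i \<le> k" "i \<le> j" "j \<le> k" using ijk(4,5) by auto
      have "convergent (\<phi> (insert i X))" "convergent (\<phi> (insert i (insert j X)))" "convergent (\<phi> (insert j X))"
        using L[of "{i}"] L[of "{i, j}"] L[of "{j}"] le by auto
      moreover have "convergent (\<phi> (insert k X))" "convergent (\<phi> (insert j (insert k X)))"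
        using U[of "{k}"] U[of "{j, k}"] le by auto
      ultimately obtain A B C D E where lims: "\<phi> (insert i X) \<longlonglongrightarrow> A" "\<phi> (insert i (insert j X)) \<longlonglongrightarrow> B" "\<phi> (insert j X) \<longlonglongrightarrow> C"
        "\<phi> (insert k X) \<longlonglongrightarrow> D" "\<phi> (insert j (insert k X)) \<longlonglongrightarrow> E" by (meson convergent_def)
      have sub: "insert i X \<subseteq> {1..n}" "insert i (insert j X) \<subseteq> {1..n}" "insert j X \<subseteq> {1..n}" "insert k X \<subseteq> {1..n}" "insert j (insert k X) \<subseteq> {1..n}"
        "insert i (insert k X) \<subseteq> {1..n}"
        using Xn ijk(4,5) by auto
      have "(\<lambda>N. ln (F N (insert i (insert j X)) * F N (insert k X) + F N (insert i X) * F N (insert j (insert k X))) / real (Suc N)) \<longlonglongrightarrow> max (B + D) (A + E)"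
        by (rule ln_add_tendsto_max) (use F(1) sub lims prod in \<open>auto intro!: tendsto_add\<close>)
      then have "(\<lambda>N. \<phi> (insert i (insert k X)) N + \<phi> (insert j X) N) \<longlonglongrightarrow> max (B + D) (A + E)"
        unfolding F(3)[OF d(1) ijk(4,5) d(2-4), symmetric] prod[OF sub(6,3)] .
      from tendsto_diff[OF this lims(3)] show ?thesis unfolding SX convergent_def by auto
    qed
  qed
  define \<Phi> where "\<Phi> S = lim (\<phi> S)" for S
  have lim: "\<phi> S \<longlonglongrightarrow> \<Phi> S" if "S \<subseteq> {1..n}" for S
  proof -
    have "S \<subseteq> {0..0 + n}" using that by auto
    then have "convergent (\<phi> S)" by (rule conv[OF that])
    then show ?thesis unfolding \<Phi>_def by (simp add: convergent_LIMSEQ_iff)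
  qed
  define f where "f = restrict \<Phi> (Delta n 0 n)"
  have D: "S \<in> Delta n 0 n \<longleftrightarrow> S \<subseteq> {1..n}" for S using card_mono[of "{1..n}" S] by (auto simp: Delta_def)
  have fS: "f S = \<Phi> S" if "S \<subseteq> {1..n}" for S using that D by (simp add: f_def)
  have trop: "f A + f B = max (f P + f Q) (f R + f T)"
    if sub: "A \<subseteq> {1..n}" "B \<subseteq> {1..n}" "P \<subseteq> {1..n}" "Q \<subseteq> {1..n}" "R \<subseteq> {1..n}" "T \<subseteq> {1..n}"
      and rel: "\<And>N. F N A * F N B = F N P * F N Q + F N R * F N T" for A B P Q R T
  proof -
    have "(\<lambda>N. ln (F N P * F N Q + F N R * F N T) / real (Suc N)) \<longlonglongrightarrow> max (\<Phi> P + \<Phi> Q) (\<Phi> R + \<Phi> T)"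
      by (rule ln_add_tendsto_max) (use F(1) sub lim prod in \<open>auto intro!: tendsto_add\<close>)
    then have "(\<lambda>N. \<phi> A N + \<phi> B N) \<longlonglongrightarrow> max (\<Phi> P + \<Phi> Q) (\<Phi> R + \<Phi> T)"
      unfolding rel[symmetric] prod[OF sub(1,2)] .
    moreover have "(\<lambda>N. \<phi> A N + \<phi> B N) \<longlonglongrightarrow> \<Phi> A + \<Phi> B" by (intro tendsto_add lim sub)
    ultimately show ?thesis using LIMSEQ_unique fS sub by simp
  qed
  have "f \<in> TP_functions n 0 n" unfolding TP_functions_def mem_Collect_eq
  proof (intro conjI allI impI)
    show "f \<in> extensional (Delta n 0 n)" by (simp add: f_def)
  next
    fix X i j k assume a: "i < j \<and> j < k \<and> X \<subseteq> {1..n} - {i, j, k} \<and>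
        {X \<union> {i}, X \<union> {j}, X \<union> {k}, X \<union> {i, j}, X \<union> {i, k}, X \<union> {j, k}} \<subseteq> Delta n 0 n"
    have d: "finite X" "i \<notin> X" "j \<notin> X" "k \<notin> X" "X \<union> {i, j, k} \<subseteq> {1..n}" using a finite_subset[of X "{1..n}"] by (auto simp: D)
    show "f (X \<union> {i, k}) + f (X \<union> {j}) = max (f (X \<union> {i, j}) + f (X \<union> {k})) (f (X \<union> {i}) + f (X \<union> {j, k}))"
      by (rule trop) (use d a F(3)[of X i j k] in auto)
  next
    fix X i j k l assume a: "i < j \<and> j < k \<and> k < l \<and> X \<subseteq> {1..n} - {i, j, k, l} \<and>
        {X \<union> {i, j}, X \<union> {i, k}, X \<union> {i, l}, X \<union> {j, k}, X \<union> {j, l}, X \<union> {k, l}} \<subseteq> Delta n 0 n"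
    have d: "finite X" "i \<notin> X" "j \<notin> X" "k \<notin> X" "l \<notin> X" "X \<union> {i, j, k, l} \<subseteq> {1..n}" using a finite_subset[of X "{1..n}"] by (auto simp: D)
    have "F N (insert i (insert k X)) * F N (insert j (insert l X)) =
      F N (insert i (insert j X)) * F N (insert k (insert l X)) + F N (insert i (insert l X)) * F N (insert j (insert k X))" for N
      by (rule four_term_relation) (use d a F(1)[of _ N] F(3)[of X _ _ _ N] in auto)
    then show "f (X \<union> {i, k}) + f (X \<union> {j, l}) = max (f (X \<union> {i, j}) + f (X \<union> {k, l})) (f (X \<union> {i, l}) + f (X \<union> {j, k}))"
      by (intro trop) (use d in auto)
  qed
  moreover have "f S = v S" if S: "S \<subseteq> {1..n}" "is_interval S" for S
  proof -
    have "\<phi> S = (\<lambda>N. v S)" by (intro ext) (simp add: \<phi>_def F(2)[OF S])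
    then show ?thesis using fS[OF S(1)] by (simp add: \<Phi>_def)
  qed
  ultimately show ?thesis by blast
qed

text \<open>A sesqui-interval is nonempty, so there is none of size 0 and only intervals
  remain.\<close>

lemma TP_basis_IS_full: "TP_basis n 0 n (IS n 0 n)"
proof -
  let ?TP = "TP_functions n 0 n" and ?B = "IS n 0 n"
  have BD: "?B \<subseteq> Delta n 0 n" by (rule IS_Delta) simp
  have Bint: "S \<subseteq> {1..n} \<and> is_interval S" if "S \<in> ?B" for S
  proof -
    have "S \<notin> sesqui_intervals n 0"
    proof
      assume "S \<in> sesqui_intervals n 0"
      then obtain p q r where "1 \<le> p" "S = {1..p} \<union> {q..r}" "card S = 0" by (rule sesqui_intervalsE)
      then show False by auto
    qed
    then show ?thesis using that by (simp add: IS_iff)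
  qed
  have "inj_on (\<lambda>f. restrict f ?B) ?TP"
  proof (rule inj_onI)
    fix f g assume fg: "f \<in> ?TP" "g \<in> ?TP" "restrict f ?B = restrict g ?B"
    have "f S = g S" if "S \<in> ?B" for S using fg(3) that by (metis restrict_apply')
    then have "f S = g S" if "S \<in> Delta n 0 n" for S using TP_determined[OF _ fg(1,2) _ that] by blast
    then show "f = g" using fg(1,2) by (intro extensionalityI[of f "Delta n 0 n" g]) (auto simp: TP_functions_def)
  qed
  moreover have "(\<lambda>f. restrict f ?B) ` ?TP = extensional ?B"
  proof
    show "extensional ?B \<subseteq> (\<lambda>f. restrict f ?B) ` ?TP"
    proof
      fix v :: "nat set \<Rightarrow> real" assume v: "v \<in> extensional ?B"
      obtain f where f: "f \<in> ?TP" "\<And>S. S \<subseteq> {1..n} \<Longrightarrow> is_interval S \<Longrightarrow> f S = v S" using exists_TP_function[of n v] by blast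
      have "restrict f ?B = v"
      proof
        fix S show "restrict f ?B S = v S" using f(2)[of S] Bint[of S] v by (cases "S \<in> ?B") (auto simp: extensional_def)
      qed
      then show "v \<in> (\<lambda>f. restrict f ?B) ` ?TP" using f(1) by blast
    qed
  qed auto
  ultimately show ?thesis using BD by (simp add: TP_basis_def bij_betw_def)
qed

lemma TP_functions_restrict:
  assumes "f \<in> TP_functions n 0 n" "m \<le> n"
  shows "restrict f (Delta n m' m) \<in> TP_functions n m' m"
proof -
  let ?D = "Delta n m' m"
  have D: "?D \<subseteq> Delta n 0 n" using assms(2) by (auto simp: Delta_def)
  show ?thesis unfolding TP_functions_def mem_Collect_eq
  proof (intro conjI allI impI)
    fix X i j k assume a: "i < j \<and> j < k \<and> X \<subseteq> {1..n} - {i, j, k} \<and>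
        {X \<union> {i}, X \<union> {j}, X \<union> {k}, X \<union> {i, j}, X \<union> {i, k}, X \<union> {j, k}} \<subseteq> ?D"
    then have o: "i < j" "j < k" and X: "X \<subseteq> {1..n} - {i, j, k}"
      and DD: "{X \<union> {i}, X \<union> {j}, X \<union> {k}, X \<union> {i, j}, X \<union> {i, k}, X \<union> {j, k}} \<subseteq> ?D" by simp_all
    show "restrict f ?D (X \<union> {i, k}) + restrict f ?D (X \<union> {j}) =
      max (restrict f ?D (X \<union> {i, j}) + restrict f ?D (X \<union> {k})) (restrict f ?D (X \<union> {i}) + restrict f ?D (X \<union> {j, k}))"
      using TP_functions_3[OF assms(1) o X subset_trans[OF DD D]] DD by simp
  next
    fix X i j k l assume a: "i < j \<and> j < k \<and> k < l \<and> X \<subseteq> {1..n} - {i, j, k, l} \<and>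
        {X \<union> {i, j}, X \<union> {i, k}, X \<union> {i, l}, X \<union> {j, k}, X \<union> {j, l}, X \<union> {k, l}} \<subseteq> ?D"
    then have o: "i < j" "j < k" "k < l" and X: "X \<subseteq> {1..n} - {i, j, k, l}"
      and DD: "{X \<union> {i, j}, X \<union> {i, k}, X \<union> {i, l}, X \<union> {j, k}, X \<union> {j, l}, X \<union> {k, l}} \<subseteq> ?D" by simp_all
    show "restrict f ?D (X \<union> {i, k}) + restrict f ?D (X \<union> {j, l}) =
      max (restrict f ?D (X \<union> {i, j}) + restrict f ?D (X \<union> {k, l})) (restrict f ?D (X \<union> {i, l}) + restrict f ?D (X \<union> {j, k}))"
      using TP_functions_4[OF assms(1) o X subset_trans[OF DD D]] DD by simp
  qed simp
qed

text \<open>For surjectivity, flips in the full cube make \<open>?E\<close> a TP-basis there; a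
  function with the prescribed values is then restricted to the truncated domain.\<close>

lemma TP_basis_IS:
  assumes m: "m' \<le> m" "m \<le> n"
  shows "TP_basis n m' m (IS n m' m)"
proof -
  let ?TP = "TP_functions n m' m" and ?B = "IS n m' m"
  let ?E = "?B \<union> padding n m' m"
  have m'n: "m' \<le> n" using m by simp
  have BD: "?B \<subseteq> Delta n m' m" by (rule IS_Delta[OF m(1)])
  have "maximum_ws_collection n m' m ?B" using maximum_ws_iff[OF m(1) m'n] BD IS_ws by simp
  then have "maxws n ?E" by (rule maximum_ws_padding[OF m(1) m'n])
  moreover have D: "S \<in> Delta n 0 n \<longleftrightarrow> S \<subseteq> {1..n}" for S using card_mono[of "{1..n}" S] by (auto simp: Delta_def)
  moreover have "padding n 0 n = {}"
  proof -
    have "S \<notin> padding n 0 n" for S using card_mono[of "{1..n}" S] by (auto simp: padding_def)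
    then show ?thesis by blast
  qed
  ultimately have "maximum_ws_collection n 0 n ?E"
    using maximum_ws_iff[of 0 n n ?E] card_IS_padding[of 0 n n] by (auto simp: maxws_def)
  then have "TP_basis n 0 n ?E" using flips_TP_basis[OF flips_from_IS TP_basis_IS_full] by simp
  then have im: "(\<lambda>f. restrict f ?E) ` TP_functions n 0 n = extensional ?E" by (simp add: TP_basis_def bij_betw_def)
  have "inj_on (\<lambda>f. restrict f ?B) ?TP"
  proof (rule inj_onI)
    fix f g assume fg: "f \<in> ?TP" "g \<in> ?TP" "restrict f ?B = restrict g ?B"
    have "f S = g S" if "S \<in> ?B" for S using fg(3) that by (metis restrict_apply')
    then have "f S = g S" if "S \<in> Delta n m' m" for S using TP_determined[OF m(1) fg(1,2) _ that] by blast
    then show "f = g" using fg(1,2) by (intro extensionalityI[of f "Delta n m' m" g]) (auto simp: TP_functions_def)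
  qed
  moreover have "(\<lambda>f. restrict f ?B) ` ?TP = extensional ?B"
  proof
    show "extensional ?B \<subseteq> (\<lambda>f. restrict f ?B) ` ?TP"
    proof
      fix v :: "nat set \<Rightarrow> real" assume v: "v \<in> extensional ?B"
      \<comment> \<open>On the padding \<open>v\<close> takes the default value
        \<open>undefined\<close>; the argument works for any extension of the prescribed
        values.\<close>
      have "restrict v ?E \<in> extensional ?E" by simp
      then obtain f where f: "f \<in> TP_functions n 0 n" "restrict f ?E = restrict v ?E" using im by (metis (no_types, lifting) imageE)
      let ?g = "restrict f (Delta n m' m)"
      have "restrict ?g ?B = v"
      proof
        fix S show "restrict ?g ?B S = v S"
        proof (cases "S \<in> ?B")
          case True
          then have "f S = v S" using fun_cong[OF f(2), of S] by simp
          then show ?thesis using True BD by auto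
        next
          case False
          then show ?thesis using v by (simp add: extensional_def)
        qed
      qed
      moreover have "?g \<in> ?TP" by (rule TP_functions_restrict[OF f(1) m(2)])
      ultimately show "v \<in> (\<lambda>f. restrict f ?B) ` ?TP" by (metis image_eqI)
    qed
  qed auto
  ultimately show ?thesis using BD by (simp add: TP_basis_def bij_betw_def)
qed

theorem theorem11p4:
  fixes n m' m :: nat
  assumes "m' \<le> m" and "m \<le> n"
  shows "(\<forall>C. maximum_ws_collection n m' m C \<longrightarrow>
            (\<exists>C'. (lowering_flip3 n m' m)\<^sup>*\<^sup>* C C' \<and>
                  (lowering_flip4_in_level m' n m' m)\<^sup>*\<^sup>* C' (IS n m' m))) \<and>
         flip_TP_bases n m' m = {C. maximum_ws_collection n m' m C}"
proof
  have m'n: "m' \<le> n" using assms by simp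
  show "\<forall>C. maximum_ws_collection n m' m C \<longrightarrow>
            (\<exists>C'. (lowering_flip3 n m' m)\<^sup>*\<^sup>* C C' \<and> (lowering_flip4_in_level m' n m' m)\<^sup>*\<^sup>* C' (IS n m' m))"
    using lower_to_IS[OF assms(1) m'n] by blast
  have IS: "maximum_ws_collection n m' m (IS n m' m)"
    using maximum_ws_iff[OF assms(1) m'n] IS_Delta[OF assms(1)] IS_ws by simp
  have "maximum_ws_collection n m' m B" if "(flip n m' m)\<^sup>*\<^sup>* (IS n m' m) B" for B
    using that
  proof (induction rule: rtranclp_induct)
    case base
    show ?case by (rule IS)
  next
    case (step A B)
    then show ?case using flip3_maximum[OF assms(1) m'n] flip4_maximum[OF assms(1) m'n] by blast
  qed
  moreover have "(flip n m' m)\<^sup>*\<^sup>* (IS n m' m) C \<and> TP_basis n m' m C" if "maximum_ws_collection n m' m C" for C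
    using flips_from_IS[OF assms(1) m'n that] flips_TP_basis[OF _ TP_basis_IS[OF assms]] by blast
  ultimately show "flip_TP_bases n m' m = {C. maximum_ws_collection n m' m C}"
    unfolding flip_TP_bases_def by blast
qed

end
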